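(* Let $\mathcal S=(\mathcal S,\otimes,\mathbb 1)$ be a symmetric monoidal category. Hopf algebras in the symmetric monoidal category $\mathcal E(\mathcal S)$ are in bijective correspondence with pairs $(\chi,A)$ where $\chi$ is a crossed module and $A$ is a Hopf $\chi$-coalgebra in $\mathcal S$.
   Context: A *Hopf algebra* in a symmetric monoidal category is a bialgebra object $(A,m,u,\Delta,\varepsilon)$ that admits an invertible antipode $S\colon A\to A$, i.e. $m(S\otimes\mathrm{id})\Delta=u\varepsilon=m(\mathrm{id}\otimes S)\Delta$. Associativity and unit constraints are suppressed. **Crossed module.** A group homomorphism $\chi\colon E\to H$ with a left action $(x,e)\mapsto {}^{x}e$ of $H$ on $E$ by group automorphisms such that $\chi({}^{x}e)=x\chi(e)x^{-1}$ and ${}^{\chi(e)}f=efe^{-1}$. **Hopf $\chi$-coalgebra in $\mathcal S$.** A family $A=\{A_x\}_{x\in H}$ of algebras in $\mathcal S$ (products $\mu_x$, units $\eta_x$) with algebra morphisms $\Delta_{x,y}\colon A_{xy}\to A_x\otimes A_y$ and $\varepsilon\colon A_1\to\mathbb 1$, isomorphisms $S_x\colon A_{x^{-1}}\to A_x$ in $\mathcal S$, and algebra isomorphisms $\phi_{x,e}\colon A_x\to A_{\chi(e)x}$ ($x,y\in H$, $e\in E$) such that $(\Delta_{x,y}\otimes\mathrm{id})\Delta_{xy,z}=(\mathrm{id}\otimes\Delta_{y,z})\Delta_{x,yz}$; $(\mathrm{id}\otimes\varepsilon)\Delta_{x,1}=\mathrm{id}_{A_x}=(\varepsilon\otimes\mathrm{id})\Delta_{1,x}$;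 $\mu_x(S_x\otimes\mathrm{id})\Delta_{x^{-1},x}=\eta_x\varepsilon=\mu_x(\mathrm{id}\otimes S_x)\Delta_{x,x^{-1}}$; $\phi_{x,1}=\mathrm{id}$; $\phi_{\chi(e)x,f}\phi_{x,e}=\phi_{x,fe}$; $(\phi_{x,e}\otimes\phi_{y,f})\Delta_{x,y}=\Delta_{\chi(e)x,\chi(f)y}\,\phi_{xy,\,e\,{}^{x}f}$. **The category $\mathcal E(\mathcal S)$.** Objects: pairs $(\mathcal C,F)$ with $\mathcal C$ a small category and $F\colon\mathcal C\to\mathcal S$ a functor. A morphism $(\mathcal C,F)\to(\mathcal D,G)$ is a pair $(\Gamma,\gamma)$ with $\Gamma\colon\mathcal D\to\mathcal C$ a functor and $\gamma=\{\gamma_Y\colon F\Gamma(Y)\to G(Y)\}_{Y\in\mathcal D}$ a natural transformation from $F\Gamma$ to $G$. The composite of $(\Gamma,\gamma)\colon(\mathcal C,F)\to(\mathcal D,G)$ with $(\Lambda,\lambda)\colon(\mathcal D,G)\to(\mathcal K,L)$ is $(\Gamma\Lambda,\{\lambda_Z\circ\gamma_{\Lambda(Z)}\}_{Z\in\mathcal K})$. Monoidal product: $(\mathcal C,F)\boxtimes(\mathcal D,G)=(\mathcal C\times\mathcal D,\otimes\circ(F\times G))$ and $(\Gamma,\gamma)\boxtimes(\Lambda,\lambda)=(\Gamma\times\Lambda,\{\gamma_X\otimes\lambda_Y\})$; unit object $(\mathbf 1,\ast\mapsto\mathbb 1)$ with $\mathbf 1$ the one-object, one-morphism category; constraints and symmetry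 are induced by those of $\mathbf{Cat}$ (cartesian product) and $\mathcal S$. **Crossed modules as Hopf algebras in $\mathbf{Cat}$.** Let $\mathbf{Cat}$ be the category of small categories and functors with its cartesian monoidal structure. To $\chi\colon E\to H$ is associated the Hopf algebra $\mathcal G_\chi$ in $\mathbf{Cat}$: objects are the elements of $H$; $\mathrm{Hom}(x,y)=\{e\in E\mid y=\chi(e)x\}$; composition is the product of $E$ ($f\circ e=fe$); product $m_\chi(x,y)=xy$, $m_\chi(x\xrightarrow{e}y,\,z\xrightarrow{f}t)=(xz\xrightarrow{e\,{}^{x}f}yt)$; unit $u_\chi(\ast)=1$; coproduct $\Delta_\chi$ and counit $\varepsilon_\chi$ the diagonal and the unique functor to $\mathbf 1$; antipode $S_\chi(x)=x^{-1}$, $S_\chi(x\xrightarrow{e}y)=(x^{-1}\xrightarrow{{}^{x^{-1}}(e^{-1})}y^{-1})$. As usual, Hopf algebras in $\mathbf{Cat}$ (equivalently group objects in $\mathbf{Cat}$) are identified with crossed modules through $\chi\leftrightarrow\mathcal G_\chi$. **The correspondence meant.** To $(\chi,A)$ corresponds the object $(\mathcal G_\chi,F_A)$ of $\mathcal E(\mathcal S)$ with $F_A(x)=A_x$, $F_A(x\xrightarrow{e}\chi(e)x)=\phi_{x,e}$, with product $(\Delta_\chi,\{\mu_x\})$, unit $(\varepsilon_\chi,\{\eta_x\})$, coproduct $(m_\chi,\{\Delta_{x,y}\})$, counit $(u_\chi,\varepsilon)$, and antipode $(S_\chi,\{S_x\})$. *)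

theory Defs
  imports "HOL-Algebra.Bij" "HOL-Library.Infinite_Typeclass"
begin

section \<open>Categories\<close>

record ('o, 'a) cat =
  Ob :: "'o set"
  Ar :: "'a set"
  Dom :: "'a \<Rightarrow> 'o"
  Cod :: "'a \<Rightarrow> 'o"
  Idn :: "'o \<Rightarrow> 'a"
  Cmp :: "'a \<Rightarrow> 'a \<Rightarrow> 'a" (infixr \<open>\<cdot>\<index>\<close> 55)

definition Hom :: "('o, 'a, 'm) cat_scheme \<Rightarrow> 'o \<Rightarrow> 'o \<Rightarrow> 'a set" where
  "Hom C x y = {f \<in> Ar C. Dom C f = x \<and> Cod C f = y}"

definition composable :: "('o, 'a, 'm) cat_scheme \<Rightarrow> 'a \<Rightarrow> 'a \<Rightarrow> bool" where
  "composable C g f \<longleftrightarrow> g \<in> Ar C \<and> f \<in> Ar C \<and> Dom C g = Cod C f"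

locale category =
  fixes C :: "('o, 'a, 'm) cat_scheme" (structure)
  assumes Dom_closed: "f \<in> Ar C \<Longrightarrow> Dom C f \<in> Ob C"
    and Cod_closed: "f \<in> Ar C \<Longrightarrow> Cod C f \<in> Ob C"
    and Idn_closed: "x \<in> Ob C \<Longrightarrow> Idn C x \<in> Hom C x x"
    and Cmp_closed: "\<lbrakk>f \<in> Hom C x y; g \<in> Hom C y z\<rbrakk> \<Longrightarrow> g \<cdot> f \<in> Hom C x z"
    and Cmp_assoc: "\<lbrakk>f \<in> Hom C w x; g \<in> Hom C x y; h \<in> Hom C y z\<rbrakk>
          \<Longrightarrow> h \<cdot> (g \<cdot> f) = (h \<cdot> g) \<cdot> f"
    and Cmp_Idn: "f \<in> Hom C x y \<Longrightarrow> f \<cdot> Idn C x = f"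
    and Idn_Cmp: "f \<in> Hom C x y \<Longrightarrow> Idn C y \<cdot> f = f"

definition inverse_arrows :: "('o, 'a, 'm) cat_scheme \<Rightarrow> 'a \<Rightarrow> 'a \<Rightarrow> bool" where
  "inverse_arrows C f g \<longleftrightarrow> f \<in> Ar C \<and> g \<in> Hom C (Cod C f) (Dom C f) \<and>
     g \<cdot> f = Idn C (Dom C f) \<and> f \<cdot> g = Idn C (Cod C f)" for C (structure)

definition iso_arr :: "('o, 'a, 'm) cat_scheme \<Rightarrow> 'a \<Rightarrow> bool" where
  "iso_arr C f \<longleftrightarrow> (\<exists>g. inverse_arrows C f g)"

definition inv_arr :: "('o, 'a, 'm) cat_scheme \<Rightarrow> 'a \<Rightarrow> 'a" where
  "inv_arr C f = (THE g. inverse_arrows C f g)"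

text \<open>
  HOL functions are total.  Wherever a function is part of the data of an object that is
  compared by equality, it is required to be \<open>undefined\<close> off its domain, so that equality
  in HOL is equality of the set-theoretic data.
\<close>

definition extensional2 :: "'x set \<Rightarrow> 'y set \<Rightarrow> ('x \<Rightarrow> 'y \<Rightarrow> 'z) \<Rightarrow> bool" where
  "extensional2 A B f \<longleftrightarrow> (\<forall>x y. \<not> (x \<in> A \<and> y \<in> B) \<longrightarrow> f x y = undefined)"

record ('o, 'a, 'p, 'b) fctr =
  FO :: "'o \<Rightarrow> 'p"
  FA :: "'a \<Rightarrow> 'b"

definition is_functor ::
  "('o, 'a, 'm) cat_scheme \<Rightarrow> ('p, 'b, 'n) cat_scheme \<Rightarrow> ('o, 'a, 'p, 'b) fctr \<Rightarrow> bool" where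
  "is_functor C D F \<longleftrightarrow>
     FO F \<in> Ob C \<rightarrow>\<^sub>E Ob D \<and>
     FA F \<in> extensional (Ar C) \<and>
     (\<forall>x y. \<forall>f \<in> Hom C x y. FA F f \<in> Hom D (FO F x) (FO F y)) \<and>
     (\<forall>x \<in> Ob C. FA F (Idn C x) = Idn D (FO F x)) \<and>
     (\<forall>g f. composable C g f \<longrightarrow> FA F (g \<cdot>\<^bsub>C\<^esub> f) = FA F g \<cdot>\<^bsub>D\<^esub> FA F f)"

definition id_functor :: "('o, 'a, 'm) cat_scheme \<Rightarrow> ('o, 'a, 'o, 'a) fctr" where
  "id_functor C = \<lparr>FO = \<lambda>x \<in> Ob C. x, FA = \<lambda>f \<in> Ar C. f\<rparr>"

text \<open>\<open>comp_functor C G F\<close> is $G \circ F$, where $F$ has source $C$.\<close>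

definition comp_functor ::
  "('o, 'a, 'm) cat_scheme \<Rightarrow> ('p, 'b, 'q, 'c) fctr \<Rightarrow> ('o, 'a, 'p, 'b) fctr
     \<Rightarrow> ('o, 'a, 'q, 'c) fctr" where
  "comp_functor C G F =
     \<lparr>FO = \<lambda>x \<in> Ob C. FO G (FO F x), FA = \<lambda>f \<in> Ar C. FA G (FA F f)\<rparr>"

definition nat_trans ::
  "('o, 'a, 'm) cat_scheme \<Rightarrow> ('p, 'b, 'n) cat_scheme \<Rightarrow> ('o, 'a, 'p, 'b) fctr
     \<Rightarrow> ('o, 'a, 'p, 'b) fctr \<Rightarrow> ('o \<Rightarrow> 'b) \<Rightarrow> bool" where
  "nat_trans C D F G \<gamma> \<longleftrightarrow>
     \<gamma> \<in> extensional (Ob C) \<and>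
     (\<forall>x \<in> Ob C. \<gamma> x \<in> Hom D (FO F x) (FO G x)) \<and>
     (\<forall>x y. \<forall>f \<in> Hom C x y. \<gamma> y \<cdot>\<^bsub>D\<^esub> FA F f = FA G f \<cdot>\<^bsub>D\<^esub> \<gamma> x)"


section \<open>Symmetric monoidal categories and Hopf algebras in them\<close>

record ('o, 'a) smc = "('o, 'a) cat" +
  TensO :: "'o \<Rightarrow> 'o \<Rightarrow> 'o" (infixl \<open>\<boxtimes>\<index>\<close> 70)
  TensA :: "'a \<Rightarrow> 'a \<Rightarrow> 'a" (infixl \<open>\<boxdot>\<index>\<close> 70)
  UnitO :: "'o"
  Assoc :: "'o \<Rightarrow> 'o \<Rightarrow> 'o \<Rightarrow> 'a"
  LUnit :: "'o \<Rightarrow> 'a"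
  RUnit :: "'o \<Rightarrow> 'a"
  Symm :: "'o \<Rightarrow> 'o \<Rightarrow> 'a"

locale symmetric_monoidal_category = category M
  for M :: "('o, 'a, 'm) smc_scheme" (structure) +
  assumes TensO_closed: "\<lbrakk>X \<in> Ob M; Y \<in> Ob M\<rbrakk> \<Longrightarrow> X \<boxtimes> Y \<in> Ob M"
    and TensA_closed: "\<lbrakk>f \<in> Hom M X X'; g \<in> Hom M Y Y'\<rbrakk>
          \<Longrightarrow> f \<boxdot> g \<in> Hom M (X \<boxtimes> Y) (X' \<boxtimes> Y')"
    and TensA_Idn: "\<lbrakk>X \<in> Ob M; Y \<in> Ob M\<rbrakk> \<Longrightarrow> Idn M X \<boxdot> Idn M Y = Idn M (X \<boxtimes> Y)"
    and TensA_Cmp: "\<lbrakk>f \<in> Hom M X X'; f' \<in> Hom M X' X''; g \<in> Hom M Y Y'; g' \<in> Hom M Y' Y''\<rbrakk>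
          \<Longrightarrow> (f' \<cdot> f) \<boxdot> (g' \<cdot> g) = (f' \<boxdot> g') \<cdot> (f \<boxdot> g)"
    and UnitO_closed: "UnitO M \<in> Ob M"
    and Assoc_closed: "\<lbrakk>X \<in> Ob M; Y \<in> Ob M; Z \<in> Ob M\<rbrakk>
          \<Longrightarrow> Assoc M X Y Z \<in> Hom M ((X \<boxtimes> Y) \<boxtimes> Z) (X \<boxtimes> (Y \<boxtimes> Z))"
    and Assoc_iso: "\<lbrakk>X \<in> Ob M; Y \<in> Ob M; Z \<in> Ob M\<rbrakk> \<Longrightarrow> iso_arr M (Assoc M X Y Z)"
    and Assoc_natural: "\<lbrakk>f \<in> Hom M X X'; g \<in> Hom M Y Y'; h \<in> Hom M Z Z'\<rbrakk>
          \<Longrightarrow> Assoc M X' Y' Z' \<cdot> ((f \<boxdot> g) \<boxdot> h) = (f \<boxdot> (g \<boxdot> h)) \<cdot> Assoc M X Y Z"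
    and LUnit_closed: "X \<in> Ob M \<Longrightarrow> LUnit M X \<in> Hom M (UnitO M \<boxtimes> X) X"
    and LUnit_iso: "X \<in> Ob M \<Longrightarrow> iso_arr M (LUnit M X)"
    and LUnit_natural: "f \<in> Hom M X X' \<Longrightarrow> LUnit M X' \<cdot> (Idn M (UnitO M) \<boxdot> f) = f \<cdot> LUnit M X"
    and RUnit_closed: "X \<in> Ob M \<Longrightarrow> RUnit M X \<in> Hom M (X \<boxtimes> UnitO M) X"
    and RUnit_iso: "X \<in> Ob M \<Longrightarrow> iso_arr M (RUnit M X)"
    and RUnit_natural: "f \<in> Hom M X X' \<Longrightarrow> RUnit M X' \<cdot> (f \<boxdot> Idn M (UnitO M)) = f \<cdot> RUnit M X"
    and Symm_closed: "\<lbrakk>X \<in> Ob M; Y \<in> Ob M\<rbrakk> \<Longrightarrow> Symm M X Y \<in> Hom M (X \<boxtimes> Y) (Y \<boxtimes> X)"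
    and Symm_natural: "\<lbrakk>f \<in> Hom M X X'; g \<in> Hom M Y Y'\<rbrakk>
          \<Longrightarrow> Symm M X' Y' \<cdot> (f \<boxdot> g) = (g \<boxdot> f) \<cdot> Symm M X Y"
    and Symm_Symm: "\<lbrakk>X \<in> Ob M; Y \<in> Ob M\<rbrakk> \<Longrightarrow> Symm M Y X \<cdot> Symm M X Y = Idn M (X \<boxtimes> Y)"
    and pentagon: "\<lbrakk>W \<in> Ob M; X \<in> Ob M; Y \<in> Ob M; Z \<in> Ob M\<rbrakk>
          \<Longrightarrow> Assoc M W X (Y \<boxtimes> Z) \<cdot> Assoc M (W \<boxtimes> X) Y Z =
              (Idn M W \<boxdot> Assoc M X Y Z) \<cdot> Assoc M W (X \<boxtimes> Y) Z \<cdot> (Assoc M W X Y \<boxdot> Idn M Z)"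
    and triangle: "\<lbrakk>X \<in> Ob M; Y \<in> Ob M\<rbrakk>
          \<Longrightarrow> (Idn M X \<boxdot> LUnit M Y) \<cdot> Assoc M X (UnitO M) Y = RUnit M X \<boxdot> Idn M Y"
    and hexagon: "\<lbrakk>X \<in> Ob M; Y \<in> Ob M; Z \<in> Ob M\<rbrakk>
          \<Longrightarrow> Assoc M Y Z X \<cdot> Symm M X (Y \<boxtimes> Z) \<cdot> Assoc M X Y Z =
              (Idn M Y \<boxdot> Symm M X Z) \<cdot> Assoc M Y X Z \<cdot> (Symm M X Y \<boxdot> Idn M Z)"

text \<open>
  The canonical arrow \<open>(W \<boxtimes> X) \<boxtimes> (Y \<boxtimes> Z) \<rightarrow> (W \<boxtimes> Y) \<boxtimes> (X \<boxtimes> Z)\<close>, that is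
  \<open>id \<otimes> \<tau> \<otimes> id\<close> with the associativity constraints written out.
\<close>

definition middle_four :: "('o, 'a, 'm) smc_scheme \<Rightarrow> 'o \<Rightarrow> 'o \<Rightarrow> 'o \<Rightarrow> 'o \<Rightarrow> 'a" where
  "middle_four M W X Y Z =
     inv_arr M (Assoc M W Y (X \<boxtimes> Z)) \<cdot>
     (Idn M W \<boxdot> (Assoc M Y X Z \<cdot> (Symm M X Y \<boxdot> Idn M Z) \<cdot> inv_arr M (Assoc M X Y Z))) \<cdot>
     Assoc M W X (Y \<boxtimes> Z)" for M (structure)

definition algebra_obj :: "('o, 'a, 'm) smc_scheme \<Rightarrow> 'o \<Rightarrow> 'a \<Rightarrow> 'a \<Rightarrow> bool" where
  "algebra_obj M A \<mu> \<eta> \<longleftrightarrow>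
     A \<in> Ob M \<and> \<mu> \<in> Hom M (A \<boxtimes> A) A \<and> \<eta> \<in> Hom M (UnitO M) A \<and>
     \<mu> \<cdot> (\<mu> \<boxdot> Idn M A) = \<mu> \<cdot> (Idn M A \<boxdot> \<mu>) \<cdot> Assoc M A A A \<and>
     \<mu> \<cdot> (\<eta> \<boxdot> Idn M A) = LUnit M A \<and>
     \<mu> \<cdot> (Idn M A \<boxdot> \<eta>) = RUnit M A" for M (structure)

definition coalgebra_obj :: "('o, 'a, 'm) smc_scheme \<Rightarrow> 'o \<Rightarrow> 'a \<Rightarrow> 'a \<Rightarrow> bool" where
  "coalgebra_obj M A \<Delta> \<epsilon> \<longleftrightarrow>
     A \<in> Ob M \<and> \<Delta> \<in> Hom M A (A \<boxtimes> A) \<and> \<epsilon> \<in> Hom M A (UnitO M) \<and>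
     Assoc M A A A \<cdot> (\<Delta> \<boxdot> Idn M A) \<cdot> \<Delta> = (Idn M A \<boxdot> \<Delta>) \<cdot> \<Delta> \<and>
     LUnit M A \<cdot> (\<epsilon> \<boxdot> Idn M A) \<cdot> \<Delta> = Idn M A \<and>
     RUnit M A \<cdot> (Idn M A \<boxdot> \<epsilon>) \<cdot> \<Delta> = Idn M A" for M (structure)

definition algebra_hom ::
  "('o, 'a, 'm) smc_scheme \<Rightarrow> 'o \<Rightarrow> 'a \<Rightarrow> 'a \<Rightarrow> 'o \<Rightarrow> 'a \<Rightarrow> 'a \<Rightarrow> 'a \<Rightarrow> bool" where
  "algebra_hom M A \<mu> \<eta> B \<mu>' \<eta>' f \<longleftrightarrow>
     f \<in> Hom M A B \<and> f \<cdot> \<mu> = \<mu>' \<cdot> (f \<boxdot> f) \<and> f \<cdot> \<eta> = \<eta>'" for M (structure)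

text \<open>Product and unit of the tensor product of two algebras.\<close>

definition tens_mult :: "('o, 'a, 'm) smc_scheme \<Rightarrow> 'o \<Rightarrow> 'a \<Rightarrow> 'o \<Rightarrow> 'a \<Rightarrow> 'a" where
  "tens_mult M A \<mu> B \<mu>' = (\<mu> \<boxdot> \<mu>') \<cdot> middle_four M A B A B" for M (structure)

definition tens_unit :: "('o, 'a, 'm) smc_scheme \<Rightarrow> 'a \<Rightarrow> 'a \<Rightarrow> 'a" where
  "tens_unit M \<eta> \<eta>' = (\<eta> \<boxdot> \<eta>') \<cdot> inv_arr M (LUnit M (UnitO M))" for M (structure)

record ('o, 'a) bialg =
  carr :: "'o"
  mlt :: "'a"
  unt :: "'a"
  cmlt :: "'a"
  cunt :: "'a"

definition bialgebra_obj :: "('o, 'a, 'm) smc_scheme \<Rightarrow> ('o, 'a) bialg \<Rightarrow> bool" where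
  "bialgebra_obj M B \<longleftrightarrow>
     algebra_obj M (carr B) (mlt B) (unt B) \<and>
     coalgebra_obj M (carr B) (cmlt B) (cunt B) \<and>
     algebra_hom M (carr B) (mlt B) (unt B)
       (carr B \<boxtimes> carr B) (tens_mult M (carr B) (mlt B) (carr B) (mlt B))
       (tens_unit M (unt B) (unt B)) (cmlt B) \<and>
     algebra_hom M (carr B) (mlt B) (unt B)
       (UnitO M) (LUnit M (UnitO M)) (Idn M (UnitO M)) (cunt B)" for M (structure)

definition antipode :: "('o, 'a, 'm) smc_scheme \<Rightarrow> ('o, 'a) bialg \<Rightarrow> 'a \<Rightarrow> bool" where
  "antipode M B s \<longleftrightarrow>
     s \<in> Hom M (carr B) (carr B) \<and>
     mlt B \<cdot> (s \<boxdot> Idn M (carr B)) \<cdot> cmlt B = unt B \<cdot> cunt B \<and>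
     mlt B \<cdot> (Idn M (carr B) \<boxdot> s) \<cdot> cmlt B = unt B \<cdot> cunt B" for M (structure)

definition hopf_algebra :: "('o, 'a, 'm) smc_scheme \<Rightarrow> ('o, 'a) bialg \<Rightarrow> bool" where
  "hopf_algebra M B \<longleftrightarrow> bialgebra_obj M B \<and> (\<exists>s. antipode M B s \<and> iso_arr M s)"

definition bialgebra_hom ::
  "('o, 'a, 'm) smc_scheme \<Rightarrow> ('o, 'a) bialg \<Rightarrow> ('o, 'a) bialg \<Rightarrow> 'a \<Rightarrow> bool" where
  "bialgebra_hom M B B' f \<longleftrightarrow>
     algebra_hom M (carr B) (mlt B) (unt B) (carr B') (mlt B') (unt B') f \<and>
     cmlt B' \<cdot> f = (f \<boxdot> f) \<cdot> cmlt B \<and> cunt B' \<cdot> f = cunt B" for M (structure)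


section \<open>Small categories\<close>

text \<open>
  "Small" is relative to an arbitrary infinite type \<open>'u\<close>, which plays the role of the
  universe: objects and arrows of a small category are elements of \<open>'u\<close>.  Since
  \<open>'u\<close> is infinite it is closed under pairing, so the cartesian product of two small
  categories is again small.
\<close>

lemma ex_inj_pairing: "\<exists>p :: 'u::infinite \<times> 'u \<Rightarrow> 'u. inj p"
proof -
  have "(card_of (UNIV \<times> UNIV :: ('u \<times> 'u) set), card_of (UNIV :: 'u set)) \<in> ordIso"
    using card_of_Times_same_infinite infinite_UNIV by blast
  then obtain p :: "'u \<times> 'u \<Rightarrow> 'u" where "bij_betw p (UNIV \<times> UNIV) UNIV"
    using card_of_ordIso by blast
  then show ?thesis
    by (auto simp: bij_betw_def)
qed

definition upair :: "'u::infinite \<Rightarrow> 'u \<Rightarrow> 'u" where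
  "upair x y = (SOME p. inj p) (x, y)"

lemma upair_eq_iff [simp]: "upair x y = upair x' y' \<longleftrightarrow> x = x' \<and> y = y'"
  using someI_ex [OF ex_inj_pairing] unfolding upair_def by (auto dest: injD)

definition ufst :: "'u::infinite \<Rightarrow> 'u" where
  "ufst z = (THE x. \<exists>y. z = upair x y)"

definition usnd :: "'u::infinite \<Rightarrow> 'u" where
  "usnd z = (THE y. \<exists>x. z = upair x y)"

lemma ufst_upair [simp]: "ufst (upair x y) = x"
  by (auto simp: ufst_def)

lemma usnd_upair [simp]: "usnd (upair x y) = y"
  by (auto simp: usnd_def)

definition uprod :: "'u::infinite set \<Rightarrow> 'u set \<Rightarrow> 'u set" where
  "uprod A B = {upair x y | x y. x \<in> A \<and> y \<in> B}"

definition upoint :: "'u::infinite" where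
  "upoint = (SOME x. True)"

type_synonym 'u scat = "('u, 'u) cat"
type_synonym 'u sfun = "('u, 'u, 'u, 'u) fctr"

definition small_category :: "'u::infinite scat \<Rightarrow> bool" where
  "small_category C \<longleftrightarrow> category C \<and>
     Dom C \<in> extensional (Ar C) \<and> Cod C \<in> extensional (Ar C) \<and> Idn C \<in> extensional (Ob C) \<and>
     (\<forall>g f. \<not> composable C g f \<longrightarrow> g \<cdot>\<^bsub>C\<^esub> f = undefined)"

definition prod_cat :: "'u::infinite scat \<Rightarrow> 'u scat \<Rightarrow> 'u scat" where
  "prod_cat C D =
     \<lparr>Ob = uprod (Ob C) (Ob D),
      Ar = uprod (Ar C) (Ar D),
      Dom = \<lambda>f \<in> uprod (Ar C) (Ar D). upair (Dom C (ufst f)) (Dom D (usnd f)),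
      Cod = \<lambda>f \<in> uprod (Ar C) (Ar D). upair (Cod C (ufst f)) (Cod D (usnd f)),
      Idn = \<lambda>x \<in> uprod (Ob C) (Ob D). upair (Idn C (ufst x)) (Idn D (usnd x)),
      Cmp = \<lambda>g f.
        if g \<in> uprod (Ar C) (Ar D) \<and> f \<in> uprod (Ar C) (Ar D) \<and>
           composable C (ufst g) (ufst f) \<and> composable D (usnd g) (usnd f)
        then upair (ufst g \<cdot>\<^bsub>C\<^esub> ufst f) (usnd g \<cdot>\<^bsub>D\<^esub> usnd f) else undefined\<rparr>"

definition one_cat :: "'u::infinite scat" where
  "one_cat =
     \<lparr>Ob = {upoint}, Ar = {upoint},
      Dom = \<lambda>f \<in> {upoint}. upoint, Cod = \<lambda>f \<in> {upoint}. upoint, Idn = \<lambda>x \<in> {upoint}. upoint,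
      Cmp = \<lambda>g f. if g = upoint \<and> f = upoint then upoint else undefined\<rparr>"

text \<open>\<open>prod_functor C D F G\<close> is $F \times G$, where $F$ has source $C$ and $G$ source $D$.\<close>

definition prod_functor ::
  "'u::infinite scat \<Rightarrow> 'u scat \<Rightarrow> 'u sfun \<Rightarrow> 'u sfun \<Rightarrow> 'u sfun" where
  "prod_functor C D F G =
     \<lparr>FO = \<lambda>z \<in> Ob (prod_cat C D). upair (FO F (ufst z)) (FO G (usnd z)),
      FA = \<lambda>z \<in> Ar (prod_cat C D). upair (FA F (ufst z)) (FA G (usnd z))\<rparr>"


section \<open>The symmetric monoidal category of functors into a symmetric monoidal category\<close>

type_synonym ('u, 'o, 'a) eobj = "'u scat \<times> ('u, 'u, 'o, 'a) fctr"

text \<open>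
  An arrow \<open>(C, F) \<rightarrow> (D, G)\<close> consists of a functor \<open>e_fun :: D \<rightarrow> C\<close> and a
  natural transformation \<open>e_nat\<close> from \<open>F \<circ> e_fun\<close> to \<open>G\<close>.
\<close>

record ('u, 'o, 'a) earr =
  e_dom :: "('u, 'o, 'a) eobj"
  e_cod :: "('u, 'o, 'a) eobj"
  e_fun :: "'u sfun"
  e_nat :: "'u \<Rightarrow> 'a"

definition E_Ob :: "('o, 'a) smc \<Rightarrow> ('u::infinite, 'o, 'a) eobj set" where
  "E_Ob S = {(C, F). small_category C \<and> is_functor C S F}"

definition E_Ar :: "('o, 'a) smc \<Rightarrow> ('u::infinite, 'o, 'a) earr set" where
  "E_Ar S = {f. e_dom f \<in> E_Ob S \<and> e_cod f \<in> E_Ob S \<and>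
     is_functor (fst (e_cod f)) (fst (e_dom f)) (e_fun f) \<and>
     nat_trans (fst (e_cod f)) S
       (comp_functor (fst (e_cod f)) (snd (e_dom f)) (e_fun f)) (snd (e_cod f)) (e_nat f)}"

definition E_TensO ::
  "('o, 'a) smc \<Rightarrow> ('u::infinite, 'o, 'a) eobj \<Rightarrow> ('u, 'o, 'a) eobj \<Rightarrow> ('u, 'o, 'a) eobj" where
  "E_TensO S X Y =
     (prod_cat (fst X) (fst Y),
      \<lparr>FO = \<lambda>z \<in> Ob (prod_cat (fst X) (fst Y)). FO (snd X) (ufst z) \<boxtimes> FO (snd Y) (usnd z),
       FA = \<lambda>z \<in> Ar (prod_cat (fst X) (fst Y)). FA (snd X) (ufst z) \<boxdot> FA (snd Y) (usnd z)\<rparr>)"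
  for S (structure)

definition E_UnitO :: "('o, 'a) smc \<Rightarrow> ('u::infinite, 'o, 'a) eobj" where
  "E_UnitO S = (one_cat, \<lparr>FO = \<lambda>z \<in> {upoint}. UnitO S, FA = \<lambda>z \<in> {upoint}. Idn S (UnitO S)\<rparr>)"

text \<open>
  The functor components of the constraints of \<open>E S\<close> are the inverses of the
  corresponding constraints of the cartesian category of small categories, because the
  functor component of an arrow points backwards.
\<close>

definition E :: "('o, 'a) smc \<Rightarrow> (('u::infinite, 'o, 'a) eobj, ('u, 'o, 'a) earr) smc" where
  "E S =
     \<lparr>Ob = E_Ob S,
      Ar = E_Ar S,
      Dom = e_dom,
      Cod = e_cod,
      Idn = \<lambda>X. \<lparr>e_dom = X, e_cod = X, e_fun = id_functor (fst X),
                 e_nat = \<lambda>x \<in> Ob (fst X). Idn S (FO (snd X) x)\<rparr>,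
      Cmp = \<lambda>g f. \<lparr>e_dom = e_dom f, e_cod = e_cod g,
                   e_fun = comp_functor (fst (e_cod g)) (e_fun f) (e_fun g),
                   e_nat = \<lambda>z \<in> Ob (fst (e_cod g)). e_nat g z \<cdot> e_nat f (FO (e_fun g) z)\<rparr>,
      TensO = E_TensO S,
      TensA = \<lambda>f g. \<lparr>e_dom = E_TensO S (e_dom f) (e_dom g), e_cod = E_TensO S (e_cod f) (e_cod g),
                     e_fun = prod_functor (fst (e_cod f)) (fst (e_cod g)) (e_fun f) (e_fun g),
                     e_nat = \<lambda>z \<in> Ob (prod_cat (fst (e_cod f)) (fst (e_cod g))).
                               e_nat f (ufst z) \<boxdot> e_nat g (usnd z)\<rparr>,
      UnitO = E_UnitO S,
      Assoc = \<lambda>X Y Z.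
        let D = prod_cat (fst X) (prod_cat (fst Y) (fst Z));
            r = \<lambda>z. upair (upair (ufst z) (ufst (usnd z))) (usnd (usnd z))
        in \<lparr>e_dom = E_TensO S (E_TensO S X Y) Z, e_cod = E_TensO S X (E_TensO S Y Z),
            e_fun = \<lparr>FO = restrict r (Ob D), FA = restrict r (Ar D)\<rparr>,
            e_nat = \<lambda>z \<in> Ob D. Assoc S (FO (snd X) (ufst z)) (FO (snd Y) (ufst (usnd z)))
                                         (FO (snd Z) (usnd (usnd z)))\<rparr>,
      LUnit = \<lambda>X. \<lparr>e_dom = E_TensO S (E_UnitO S) X, e_cod = X,
                   e_fun = \<lparr>FO = \<lambda>z \<in> Ob (fst X). upair upoint z,
                            FA = \<lambda>z \<in> Ar (fst X). upair upoint z\<rparr>,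
                   e_nat = \<lambda>z \<in> Ob (fst X). LUnit S (FO (snd X) z)\<rparr>,
      RUnit = \<lambda>X. \<lparr>e_dom = E_TensO S X (E_UnitO S), e_cod = X,
                   e_fun = \<lparr>FO = \<lambda>z \<in> Ob (fst X). upair z upoint,
                            FA = \<lambda>z \<in> Ar (fst X). upair z upoint\<rparr>,
                   e_nat = \<lambda>z \<in> Ob (fst X). RUnit S (FO (snd X) z)\<rparr>,
      Symm = \<lambda>X Y.
        let D = prod_cat (fst Y) (fst X); r = \<lambda>z. upair (usnd z) (ufst z)
        in \<lparr>e_dom = E_TensO S X Y, e_cod = E_TensO S Y X,
            e_fun = \<lparr>FO = restrict r (Ob D), FA = restrict r (Ar D)\<rparr>,
            e_nat = \<lambda>z \<in> Ob D. Symm S (FO (snd X) (usnd z)) (FO (snd Y) (ufst z))\<rparr>\<rparr>"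
  for S (structure)

text \<open>
  The structure functors on the underlying small category of a bialgebra in \<open>E S\<close>.
  The direction of functors is reversed, so the coproduct in \<open>E S\<close> lies over the product
  in the category of small categories, and vice versa.
\<close>

definition cat_part ::
  "(('u::infinite, 'o, 'a) eobj, ('u, 'o, 'a) earr) bialg \<Rightarrow> ('u scat, 'u sfun) bialg" where
  "cat_part X =
     \<lparr>carr = fst (carr X),
      mlt = e_fun (cmlt X), unt = e_fun (cunt X), cmlt = e_fun (mlt X), cunt = e_fun (unt X)\<rparr>"


section \<open>Crossed modules\<close>

record 'u xmod =
  xE :: "'u monoid"
  xH :: "'u monoid"
  bd :: "'u \<Rightarrow> 'u"
  act :: "'u \<Rightarrow> 'u \<Rightarrow> 'u"

definition crossed_module :: "'u xmod \<Rightarrow> bool" where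
  "crossed_module \<chi> \<longleftrightarrow>
     group (xE \<chi>) \<and> extensional2 (carrier (xE \<chi>)) (carrier (xE \<chi>)) (mult (xE \<chi>)) \<and>
     group (xH \<chi>) \<and> extensional2 (carrier (xH \<chi>)) (carrier (xH \<chi>)) (mult (xH \<chi>)) \<and>
     bd \<chi> \<in> hom (xE \<chi>) (xH \<chi>) \<inter> extensional (carrier (xE \<chi>)) \<and>
     act \<chi> \<in> hom (xH \<chi>) (AutoGroup (xE \<chi>)) \<and>
     extensional2 (carrier (xH \<chi>)) (carrier (xE \<chi>)) (act \<chi>) \<and>
     (\<forall>x \<in> carrier (xH \<chi>). \<forall>e \<in> carrier (xE \<chi>).
        bd \<chi> (act \<chi> x e) = x \<otimes>\<^bsub>xH \<chi>\<^esub> bd \<chi> e \<otimes>\<^bsub>xH \<chi>\<^esub> inv\<^bsub>xH \<chi>\<^esub> x) \<and>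
     (\<forall>e \<in> carrier (xE \<chi>). \<forall>f \<in> carrier (xE \<chi>).
        act \<chi> (bd \<chi> e) f = e \<otimes>\<^bsub>xE \<chi>\<^esub> f \<otimes>\<^bsub>xE \<chi>\<^esub> inv\<^bsub>xE \<chi>\<^esub> e)"

definition xmod_iso :: "'u xmod \<Rightarrow> 'u xmod \<Rightarrow> ('u \<Rightarrow> 'u) \<Rightarrow> ('u \<Rightarrow> 'u) \<Rightarrow> bool" where
  "xmod_iso \<chi> \<chi>' k h \<longleftrightarrow>
     k \<in> iso (xE \<chi>) (xE \<chi>') \<and> h \<in> iso (xH \<chi>) (xH \<chi>') \<and>
     (\<forall>e \<in> carrier (xE \<chi>). bd \<chi>' (k e) = h (bd \<chi> e)) \<and>
     (\<forall>x \<in> carrier (xH \<chi>). \<forall>e \<in> carrier (xE \<chi>). k (act \<chi> x e) = act \<chi>' (h x) (k e))"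

text \<open>
  The arrow \<open>e : x \<rightarrow> \<chi>(e)x\<close> of the category of a crossed module is encoded as
  \<open>upair x e\<close>, since a single \<open>e\<close> is an arrow out of every object.
\<close>

definition xcat :: "'u::infinite xmod \<Rightarrow> 'u scat" where
  "xcat \<chi> =
     (let A = uprod (carrier (xH \<chi>)) (carrier (xE \<chi>));
          cod = (\<lambda>f \<in> A. bd \<chi> (usnd f) \<otimes>\<^bsub>xH \<chi>\<^esub> ufst f)
      in \<lparr>Ob = carrier (xH \<chi>),
          Ar = A,
          Dom = restrict ufst A,
          Cod = cod,
          Idn = \<lambda>x \<in> carrier (xH \<chi>). upair x \<one>\<^bsub>xE \<chi>\<^esub>,
          Cmp = \<lambda>g f. if g \<in> A \<and> f \<in> A \<and> ufst g = cod f
                        then upair (ufst f) (usnd g \<otimes>\<^bsub>xE \<chi>\<^esub> usnd f) else undefined\<rparr>)"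

definition xmult :: "'u::infinite xmod \<Rightarrow> 'u sfun" where
  "xmult \<chi> =
     \<lparr>FO = \<lambda>z \<in> Ob (prod_cat (xcat \<chi>) (xcat \<chi>)). ufst z \<otimes>\<^bsub>xH \<chi>\<^esub> usnd z,
      FA = \<lambda>w \<in> Ar (prod_cat (xcat \<chi>) (xcat \<chi>)).
             let x = ufst (ufst w); e = usnd (ufst w); z = ufst (usnd w); f = usnd (usnd w)
             in upair (x \<otimes>\<^bsub>xH \<chi>\<^esub> z) (e \<otimes>\<^bsub>xE \<chi>\<^esub> act \<chi> x f)\<rparr>"

definition xunit :: "'u::infinite xmod \<Rightarrow> 'u sfun" where
  "xunit \<chi> = \<lparr>FO = \<lambda>z \<in> {upoint}. \<one>\<^bsub>xH \<chi>\<^esub>, FA = \<lambda>z \<in> {upoint}. upair \<one>\<^bsub>xH \<chi>\<^esub> \<one>\<^bsub>xE \<chi>\<^esub>\<rparr>"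

definition xdiag :: "'u::infinite xmod \<Rightarrow> 'u sfun" where
  "xdiag \<chi> = \<lparr>FO = \<lambda>x \<in> Ob (xcat \<chi>). upair x x, FA = \<lambda>f \<in> Ar (xcat \<chi>). upair f f\<rparr>"

definition xcounit :: "'u::infinite xmod \<Rightarrow> 'u sfun" where
  "xcounit \<chi> = \<lparr>FO = \<lambda>x \<in> Ob (xcat \<chi>). upoint, FA = \<lambda>f \<in> Ar (xcat \<chi>). upoint\<rparr>"

definition xantipode :: "'u::infinite xmod \<Rightarrow> 'u sfun" where
  "xantipode \<chi> =
     \<lparr>FO = \<lambda>x \<in> Ob (xcat \<chi>). inv\<^bsub>xH \<chi>\<^esub> x,
      FA = \<lambda>f \<in> Ar (xcat \<chi>).
             upair (inv\<^bsub>xH \<chi>\<^esub> ufst f) (act \<chi> (inv\<^bsub>xH \<chi>\<^esub> ufst f) (inv\<^bsub>xE \<chi>\<^esub> usnd f))\<rparr>"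

definition xmod_hopf :: "'u::infinite xmod \<Rightarrow> ('u scat, 'u sfun) bialg" where
  "xmod_hopf \<chi> =
     \<lparr>carr = xcat \<chi>, mlt = xmult \<chi>, unt = xunit \<chi>, cmlt = xdiag \<chi>, cunt = xcounit \<chi>\<rparr>"


section \<open>Hopf coalgebras over a crossed module\<close>

text \<open>\<open>h_ant A x\<close> is $S_x \colon A_{x^{-1}} \to A_x$.\<close>

record ('u, 'o, 'a) hcoalg =
  h_obj :: "'u \<Rightarrow> 'o"
  h_mlt :: "'u \<Rightarrow> 'a"
  h_unt :: "'u \<Rightarrow> 'a"
  h_cmlt :: "'u \<Rightarrow> 'u \<Rightarrow> 'a"
  h_cunt :: "'a"
  h_ant :: "'u \<Rightarrow> 'a"
  h_phi :: "'u \<Rightarrow> 'u \<Rightarrow> 'a"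

definition hopf_coalgebra ::
  "('o, 'a) smc \<Rightarrow> 'u xmod \<Rightarrow> ('u, 'o, 'a) hcoalg \<Rightarrow> bool" where
  "hopf_coalgebra S \<chi> A \<longleftrightarrow>
     (let G = xE \<chi>; H = xH \<chi>; a = h_obj A; \<mu> = h_mlt A; \<eta> = h_unt A; \<Delta> = h_cmlt A;
          \<epsilon> = h_cunt A; s = h_ant A; \<phi> = h_phi A
      in
        a \<in> extensional (carrier H) \<and> \<mu> \<in> extensional (carrier H) \<and>
        \<eta> \<in> extensional (carrier H) \<and> extensional2 (carrier H) (carrier H) \<Delta> \<and>
        s \<in> extensional (carrier H) \<and> extensional2 (carrier H) (carrier G) \<phi> \<and>
        (\<forall>x \<in> carrier H. algebra_obj S (a x) (\<mu> x) (\<eta> x)) \<and>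
        (\<forall>x \<in> carrier H. \<forall>y \<in> carrier H.
           algebra_hom S (a (x \<otimes>\<^bsub>H\<^esub> y)) (\<mu> (x \<otimes>\<^bsub>H\<^esub> y)) (\<eta> (x \<otimes>\<^bsub>H\<^esub> y))
             (a x \<boxtimes> a y) (tens_mult S (a x) (\<mu> x) (a y) (\<mu> y)) (tens_unit S (\<eta> x) (\<eta> y))
             (\<Delta> x y)) \<and>
        algebra_hom S (a \<one>\<^bsub>H\<^esub>) (\<mu> \<one>\<^bsub>H\<^esub>) (\<eta> \<one>\<^bsub>H\<^esub>)
          (UnitO S) (LUnit S (UnitO S)) (Idn S (UnitO S)) \<epsilon> \<and>
        (\<forall>x \<in> carrier H. s x \<in> Hom S (a (inv\<^bsub>H\<^esub> x)) (a x) \<and> iso_arr S (s x)) \<and>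
        (\<forall>x \<in> carrier H. \<forall>e \<in> carrier G.
           algebra_hom S (a x) (\<mu> x) (\<eta> x) (a (bd \<chi> e \<otimes>\<^bsub>H\<^esub> x)) (\<mu> (bd \<chi> e \<otimes>\<^bsub>H\<^esub> x))
             (\<eta> (bd \<chi> e \<otimes>\<^bsub>H\<^esub> x)) (\<phi> x e) \<and>
           iso_arr S (\<phi> x e)) \<and>
        (\<forall>x \<in> carrier H. \<forall>y \<in> carrier H. \<forall>z \<in> carrier H.
           Assoc S (a x) (a y) (a z) \<cdot> (\<Delta> x y \<boxdot> Idn S (a z)) \<cdot> \<Delta> (x \<otimes>\<^bsub>H\<^esub> y) z =
           (Idn S (a x) \<boxdot> \<Delta> y z) \<cdot> \<Delta> x (y \<otimes>\<^bsub>H\<^esub> z)) \<and>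
        (\<forall>x \<in> carrier H.
           RUnit S (a x) \<cdot> (Idn S (a x) \<boxdot> \<epsilon>) \<cdot> \<Delta> x \<one>\<^bsub>H\<^esub> = Idn S (a x) \<and>
           LUnit S (a x) \<cdot> (\<epsilon> \<boxdot> Idn S (a x)) \<cdot> \<Delta> \<one>\<^bsub>H\<^esub> x = Idn S (a x)) \<and>
        (\<forall>x \<in> carrier H.
           \<mu> x \<cdot> (s x \<boxdot> Idn S (a x)) \<cdot> \<Delta> (inv\<^bsub>H\<^esub> x) x = \<eta> x \<cdot> \<epsilon> \<and>
           \<mu> x \<cdot> (Idn S (a x) \<boxdot> s x) \<cdot> \<Delta> x (inv\<^bsub>H\<^esub> x) = \<eta> x \<cdot> \<epsilon>) \<and>
        (\<forall>x \<in> carrier H. \<phi> x \<one>\<^bsub>G\<^esub> = Idn S (a x)) \<and>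
        (\<forall>x \<in> carrier H. \<forall>e \<in> carrier G. \<forall>f \<in> carrier G.
           \<phi> (bd \<chi> e \<otimes>\<^bsub>H\<^esub> x) f \<cdot> \<phi> x e = \<phi> x (f \<otimes>\<^bsub>G\<^esub> e)) \<and>
        (\<forall>x \<in> carrier H. \<forall>y \<in> carrier H. \<forall>e \<in> carrier G. \<forall>f \<in> carrier G.
           (\<phi> x e \<boxdot> \<phi> y f) \<cdot> \<Delta> x y =
           \<Delta> (bd \<chi> e \<otimes>\<^bsub>H\<^esub> x) (bd \<chi> f \<otimes>\<^bsub>H\<^esub> y) \<cdot> \<phi> (x \<otimes>\<^bsub>H\<^esub> y) (e \<otimes>\<^bsub>G\<^esub> act \<chi> x f)))"
  for S (structure)


section \<open>The correspondence\<close>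

type_synonym ('u, 'o, 'a) xpair = "'u xmod \<times> ('u, 'o, 'a) hcoalg"
type_synonym ('u, 'o, 'a) ebialg = "(('u, 'o, 'a) eobj, ('u, 'o, 'a) earr) bialg"

definition xpairs :: "('o, 'a) smc \<Rightarrow> ('u::infinite, 'o, 'a) xpair set" where
  "xpairs S = {(\<chi>, A). crossed_module \<chi> \<and> hopf_coalgebra S \<chi> A}"

definition hopfs :: "('o, 'a) smc \<Rightarrow> ('u::infinite, 'o, 'a) ebialg set" where
  "hopfs S = {X. hopf_algebra (E S) X}"

definition assoc_obj :: "('u::infinite, 'o, 'a) xpair \<Rightarrow> ('u, 'o, 'a) eobj" where
  "assoc_obj = (\<lambda>(\<chi>, A).
     (xcat \<chi>, \<lparr>FO = h_obj A, FA = \<lambda>f \<in> Ar (xcat \<chi>). h_phi A (ufst f) (usnd f)\<rparr>))"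

definition assoc_hopf :: "('o, 'a) smc \<Rightarrow> ('u::infinite, 'o, 'a) xpair \<Rightarrow> ('u, 'o, 'a) ebialg" where
  "assoc_hopf S = (\<lambda>(\<chi>, A).
     let X = assoc_obj (\<chi>, A); XX = E_TensO S X X; I = E_UnitO S
     in \<lparr>carr = X,
         mlt = \<lparr>e_dom = XX, e_cod = X, e_fun = xdiag \<chi>, e_nat = h_mlt A\<rparr>,
         unt = \<lparr>e_dom = I, e_cod = X, e_fun = xcounit \<chi>, e_nat = h_unt A\<rparr>,
         cmlt = \<lparr>e_dom = X, e_cod = XX, e_fun = xmult \<chi>,
                 e_nat = \<lambda>z \<in> Ob (prod_cat (xcat \<chi>) (xcat \<chi>)). h_cmlt A (ufst z) (usnd z)\<rparr>,
         cunt = \<lparr>e_dom = X, e_cod = I, e_fun = xunit \<chi>, e_nat = \<lambda>z \<in> {upoint}. h_cunt A\<rparr>\<rparr>)"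

definition assoc_antipode :: "('u::infinite, 'o, 'a) xpair \<Rightarrow> ('u, 'o, 'a) earr" where
  "assoc_antipode = (\<lambda>(\<chi>, A).
     \<lparr>e_dom = assoc_obj (\<chi>, A), e_cod = assoc_obj (\<chi>, A), e_fun = xantipode \<chi>, e_nat = h_ant A\<rparr>)"

text \<open>
  A Hopf algebra in small categories is identified with a crossed module along an isomorphism
  of small categories with product.  The next two relations are the resulting identifications.
  Both change names of objects and arrows of the small category only: nothing in \<open>S\<close> is
  changed, since on one side the family is reindexed along an isomorphism of crossed modules
  and on the other side all components in \<open>S\<close> of the isomorphism are identities.
\<close>

definition xpair_ident :: "('o, 'a) smc \<Rightarrow> ('u::infinite, 'o, 'a) xpair rel" where
  "xpair_ident S = {((\<chi>, A), (\<chi>', A')).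
     (\<chi>, A) \<in> xpairs S \<and> (\<chi>', A') \<in> xpairs S \<and>
     (\<exists>k h. xmod_iso \<chi> \<chi>' k h \<and>
        (\<forall>x \<in> carrier (xH \<chi>).
           h_obj A x = h_obj A' (h x) \<and> h_mlt A x = h_mlt A' (h x) \<and>
           h_unt A x = h_unt A' (h x) \<and> h_ant A x = h_ant A' (h x) \<and>
           (\<forall>y \<in> carrier (xH \<chi>). h_cmlt A x y = h_cmlt A' (h x) (h y)) \<and>
           (\<forall>e \<in> carrier (xE \<chi>). h_phi A x e = h_phi A' (h x) (k e))) \<and>
        h_cunt A = h_cunt A')}"

definition hopf_ident :: "('o, 'a) smc \<Rightarrow> ('u::infinite, 'o, 'a) ebialg rel" where
  "hopf_ident S = {(X, Y). X \<in> hopfs S \<and> Y \<in> hopfs S \<and>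
     (\<exists>f. bialgebra_hom (E S) X Y f \<and> iso_arr (E S) f \<and>
        (\<forall>y \<in> Ob (fst (carr Y)). e_nat f y = Idn S (FO (snd (carr Y)) y)))}"

end

theory Submission
  imports Defs
begin

text \<open>
  An equation between arrows of \<open>E S\<close> holds iff it holds for the underlying functors and, object by
  object, for the components in \<open>S\<close>. Since functors point backwards, the algebra axioms make the
  functor under the product the diagonal, so that they hold in \<open>E S\<close> iff they hold degreewise in \<open>S\<close>;
  the coalgebra and antipode axioms split into the axioms of a group object in small categories
  and the axioms of a graded Hopf coalgebra. The axioms involving \<open>\<phi>\<close> are functoriality and
  naturality, except that naturality of the antipode has to be deduced from the uniqueness of
  convolution inverses.

  A group object in small categories is a category object in groups. It is isomorphic to the one
  coming from the crossed module of arrows out of the unit object, on which objects act by conjugation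
  with their identities; an arrow \<open>f\<close> out of \<open>x\<close> corresponds to \<open>x\<close> together with the
  quotient of \<open>f\<close> by the identity of \<open>x\<close> in the group of arrows.
  Transporting a Hopf algebra along this isomorphism, with identities as components in \<open>S\<close>, reduces
  the general case to Hopf algebras lying over the group object of a crossed module.
\<close>

section \<open>Categories and symmetric monoidal categories\<close>

text \<open>Two features of the encoding shape the proof. The record \<open>bialg\<close> stores no
  antipode, whereas a Hopf coalgebra stores the family \<open>h_ant\<close>. Uniqueness of antipodes
  in \<open>E S\<close>, obtained once for an arbitrary symmetric monoidal category, recovers the
  family from the Hopf algebra and shows that identifications respect it. Secondly, a group object
  in small categories determines its crossed module only up to a renaming of arrows. Hence Hopf
  algebras lying over some \<open>xmod_hopf\<close> on the nose are matched strictly, and all others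
  are reached after passing to classes. The Peiffer identity comes from the fact that composition in
  a group object is expressible by its product in two ways: comparing them makes arrows out of the
  unit object commute with arrows into it. The relation \<open>xpair_ident\<close> is not examined
  by itself. It is the pullback of \<open>hopf_ident\<close>, which yields both that it is an
  equivalence and that the classes correspond.\<close>

lemma HomD:
  assumes "f \<in> Hom C x y"
  shows "f \<in> Ar C" "Dom C f = x" "Cod C f = y"
  using assms by (auto simp: Hom_def)

text \<open>
  Typing conditions are phrased with \<open>composable\<close>, which the simplifier decomposes along a
  chain of composites in linear time; checking \<open>Dom C g = Cod C f\<close> instead would take
  exponential time, because \<open>Cod C (g \<cdot> f) = Cod C g\<close> again holds for composable arrows only.
\<close>

context category
begin

lemma Ar_Idn [simp]:
  assumes "x \<in> Ob C"
  shows "Idn C x \<in> Ar C" "Dom C (Idn C x) = x" "Cod C (Idn C x) = x"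
  using Idn_closed [OF assms] by (auto simp: Hom_def)

lemma Ob_Dom_Cod [simp]:
  assumes "f \<in> Ar C"
  shows "Dom C f \<in> Ob C" "Cod C f \<in> Ob C"
  using assms by (auto intro: Dom_closed Cod_closed)

lemma composableI [simp]:
  "\<lbrakk>g \<in> Ar C; f \<in> Ar C; Dom C g = Cod C f\<rbrakk> \<Longrightarrow> composable C g f"
  by (simp add: composable_def)

lemma Ar_Cmp [simp]:
  assumes "composable C g f"
  shows "g \<cdot> f \<in> Ar C" "Dom C (g \<cdot> f) = Dom C f" "Cod C (g \<cdot> f) = Cod C g"
  using Cmp_closed [of f "Dom C f" "Cod C f" g "Cod C g"] assms by (auto simp: composable_def Hom_def)

lemma composable_Cmp [simp]:
  shows "composable C g f \<Longrightarrow> composable C h (g \<cdot> f) \<longleftrightarrow> composable C h g"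
    and "composable C h g \<Longrightarrow> composable C (h \<cdot> g) f \<longleftrightarrow> composable C g f"
  using Ar_Cmp [of g f] Ar_Cmp [of h g] by (auto simp: composable_def)

text \<open>Composites are kept nested to the right. Where a rewrite needs another grouping, it is
  obtained by \<open>flip: Cmp_assoc_simp\<close> or by stating the bracketed composite as an
  intermediate step.\<close>

lemma Cmp_assoc_simp [simp]:
  assumes "composable C g f" "composable C h g"
  shows "(h \<cdot> g) \<cdot> f = h \<cdot> (g \<cdot> f)"
  using Cmp_assoc [of f "Dom C f" "Cod C f" g "Cod C g" h "Cod C h"] assms
  by (auto simp: composable_def Hom_def)

lemma Cmp_Idn_simp [simp]: "\<lbrakk>f \<in> Ar C; Dom C f = x\<rbrakk> \<Longrightarrow> f \<cdot> Idn C x = f"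
  by (rule Cmp_Idn) (auto simp: Hom_def)

lemma Idn_Cmp_simp [simp]: "\<lbrakk>f \<in> Ar C; Cod C f = y\<rbrakk> \<Longrightarrow> Idn C y \<cdot> f = f"
  by (rule Idn_Cmp) (auto simp: Hom_def)

lemma inverse_arrows_unique:
  assumes "inverse_arrows C f g" "inverse_arrows C f g'"
  shows "g = g'"
proof -
  have f: "f \<in> Ar C" and g: "g \<in> Ar C" "Dom C g = Cod C f" "Cod C g = Dom C f"
    and g': "g' \<in> Ar C" "Dom C g' = Cod C f" "Cod C g' = Dom C f"
    and "g' \<cdot> f = Idn C (Dom C f)" "f \<cdot> g = Idn C (Cod C f)"
    using assms by (auto simp: inverse_arrows_def Hom_def)
  moreover have "g' \<cdot> (f \<cdot> g) = (g' \<cdot> f) \<cdot> g"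
    using f g g' by simp
  ultimately show ?thesis
    by simp
qed

lemma inv_arr_eqI: "inverse_arrows C f g \<Longrightarrow> inv_arr C f = g"
  unfolding inv_arr_def using inverse_arrows_unique by blast

lemma inverse_arrows_inv_arr: "iso_arr C f \<Longrightarrow> inverse_arrows C f (inv_arr C f)"
  using inv_arr_eqI by (auto simp: iso_arr_def)

lemma inverse_arrows_sym: "inverse_arrows C f g \<Longrightarrow> inverse_arrows C g f"
  by (auto simp: inverse_arrows_def Hom_def)

lemma inverse_arrows_Idn: "x \<in> Ob C \<Longrightarrow> inverse_arrows C (Idn C x) (Idn C x)"
  by (auto simp: inverse_arrows_def Hom_def)

lemma iso_arr_Idn: "x \<in> Ob C \<Longrightarrow> iso_arr C (Idn C x)"
  using inverse_arrows_Idn by (auto simp: iso_arr_def)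

lemma inverse_arrowsD:
  assumes "inverse_arrows C f g"
  shows "f \<in> Ar C" "g \<in> Ar C" "Dom C g = Cod C f" "Cod C g = Dom C f"
    "g \<cdot> f = Idn C (Dom C f)" "f \<cdot> g = Idn C (Cod C f)"
  using assms by (auto simp: inverse_arrows_def Hom_def)

text \<open>In a right-nested composite the product of \<open>f\<close> with its inverse is not a
  subterm, so cancellation has to carry a tail \<open>h\<close>.\<close>

lemma inverse_arrows_Cmp_cancel:
  assumes "inverse_arrows C f g"
  shows "\<lbrakk>h \<in> Ar C; Cod C h = Dom C f\<rbrakk> \<Longrightarrow> g \<cdot> f \<cdot> h = h"
    and "\<lbrakk>h \<in> Ar C; Cod C h = Cod C f\<rbrakk> \<Longrightarrow> f \<cdot> g \<cdot> h = h"
  using inverse_arrowsD [OF assms] by (simp_all flip: Cmp_assoc_simp)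

lemma inverse_arrows_Cmp:
  assumes "inverse_arrows C f f'" "inverse_arrows C g g'" "Dom C g = Cod C f"
  shows "inverse_arrows C (g \<cdot> f) (f' \<cdot> g')"
  using assms(3) inverse_arrowsD [OF assms(1)] inverse_arrowsD [OF assms(2)]
    inverse_arrows_Cmp_cancel [OF assms(1)] inverse_arrows_Cmp_cancel [OF assms(2)]
  by (auto simp: inverse_arrows_def Hom_def)

end

section \<open>Typing and naturality in a symmetric monoidal category\<close>

context symmetric_monoidal_category
begin

lemma Ob_TensO [simp]: "\<lbrakk>X \<in> Ob M; Y \<in> Ob M\<rbrakk> \<Longrightarrow> X \<boxtimes> Y \<in> Ob M"
  by (rule TensO_closed)

declare UnitO_closed [simp]

lemma Ar_TensA [simp]:
  assumes "f \<in> Ar M" "g \<in> Ar M"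
  shows "f \<boxdot> g \<in> Ar M" "Dom M (f \<boxdot> g) = Dom M f \<boxtimes> Dom M g" "Cod M (f \<boxdot> g) = Cod M f \<boxtimes> Cod M g"
  using TensA_closed [of f "Dom M f" "Cod M f" g "Dom M g" "Cod M g"] assms
  by (auto simp: Hom_def)

declare TensA_Idn [simp]

lemma composable_TensA [simp]:
  "\<lbrakk>composable M f' f; composable M g' g\<rbrakk> \<Longrightarrow> composable M (f' \<boxdot> g') (f \<boxdot> g)"
  by (auto simp: composable_def)

lemma Cmp_TensA [simp]:
  assumes "composable M f' f" "composable M g' g"
  shows "(f' \<boxdot> g') \<cdot> (f \<boxdot> g) = (f' \<cdot> f) \<boxdot> (g' \<cdot> g)"
  by (rule TensA_Cmp [symmetric]) (use assms in \<open>auto simp: composable_def Hom_def\<close>)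

text \<open>The version of \<open>Cmp_TensA\<close> for right-nested chains. Both rules fuse
  tensors; they are removed from the simplifier wherever separate factors must stay visible for a
  naturality square.\<close>

lemma Cmp_TensA' [simp]:
  assumes "composable M f' f" "composable M g' g" "composable M (f \<boxdot> g) h"
  shows "(f' \<boxdot> g') \<cdot> (f \<boxdot> g) \<cdot> h = ((f' \<cdot> f) \<boxdot> (g' \<cdot> g)) \<cdot> h"
  using assms by (simp flip: Cmp_TensA Cmp_assoc_simp)

lemma Ar_constraint [simp]:
  assumes "X \<in> Ob M"
  shows "LUnit M X \<in> Ar M" "Dom M (LUnit M X) = UnitO M \<boxtimes> X" "Cod M (LUnit M X) = X"
    and "RUnit M X \<in> Ar M" "Dom M (RUnit M X) = X \<boxtimes> UnitO M" "Cod M (RUnit M X) = X"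
    and "Y \<in> Ob M \<Longrightarrow> Symm M X Y \<in> Ar M" "Y \<in> Ob M \<Longrightarrow> Dom M (Symm M X Y) = X \<boxtimes> Y"
    and "Y \<in> Ob M \<Longrightarrow> Cod M (Symm M X Y) = Y \<boxtimes> X"
    and "\<lbrakk>Y \<in> Ob M; Z \<in> Ob M\<rbrakk> \<Longrightarrow> Assoc M X Y Z \<in> Ar M"
    and "\<lbrakk>Y \<in> Ob M; Z \<in> Ob M\<rbrakk> \<Longrightarrow> Dom M (Assoc M X Y Z) = (X \<boxtimes> Y) \<boxtimes> Z"
    and "\<lbrakk>Y \<in> Ob M; Z \<in> Ob M\<rbrakk> \<Longrightarrow> Cod M (Assoc M X Y Z) = X \<boxtimes> (Y \<boxtimes> Z)"
  using assms LUnit_closed [of X] RUnit_closed [of X] Symm_closed [of X Y] Assoc_closed [of X Y Z]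
  by (auto simp: Hom_def)

lemma inverse_arrows_Assoc:
  "\<lbrakk>X \<in> Ob M; Y \<in> Ob M; Z \<in> Ob M\<rbrakk>
    \<Longrightarrow> inverse_arrows M (Assoc M X Y Z) (inv_arr M (Assoc M X Y Z))"
  by (rule inverse_arrows_inv_arr) (rule Assoc_iso)

lemma inverse_arrows_LUnit: "X \<in> Ob M \<Longrightarrow> inverse_arrows M (LUnit M X) (inv_arr M (LUnit M X))"
  by (rule inverse_arrows_inv_arr) (rule LUnit_iso)

lemma Ar_inv_constraint [simp]:
  assumes "X \<in> Ob M"
  shows "inv_arr M (LUnit M X) \<in> Ar M"
    "Dom M (inv_arr M (LUnit M X)) = X" "Cod M (inv_arr M (LUnit M X)) = UnitO M \<boxtimes> X"
    and "\<lbrakk>Y \<in> Ob M; Z \<in> Ob M\<rbrakk> \<Longrightarrow> inv_arr M (Assoc M X Y Z) \<in> Ar M"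
    and "\<lbrakk>Y \<in> Ob M; Z \<in> Ob M\<rbrakk> \<Longrightarrow> Dom M (inv_arr M (Assoc M X Y Z)) = X \<boxtimes> (Y \<boxtimes> Z)"
    and "\<lbrakk>Y \<in> Ob M; Z \<in> Ob M\<rbrakk> \<Longrightarrow> Cod M (inv_arr M (Assoc M X Y Z)) = (X \<boxtimes> Y) \<boxtimes> Z"
  using assms inverse_arrowsD [OF inverse_arrows_LUnit [of X]]
    inverse_arrowsD [OF inverse_arrows_Assoc [of X Y Z]] by simp_all

lemma Assoc_nat:
  assumes "f \<in> Ar M" "g \<in> Ar M" "h \<in> Ar M"
  shows "Assoc M (Cod M f) (Cod M g) (Cod M h) \<cdot> ((f \<boxdot> g) \<boxdot> h) =
    (f \<boxdot> (g \<boxdot> h)) \<cdot> Assoc M (Dom M f) (Dom M g) (Dom M h)"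
  by (rule Assoc_natural) (use assms in \<open>auto simp: Hom_def\<close>)

lemma inv_Assoc_nat:
  assumes "f \<in> Ar M" "g \<in> Ar M" "h \<in> Ar M"
  shows "inv_arr M (Assoc M (Cod M f) (Cod M g) (Cod M h)) \<cdot> (f \<boxdot> (g \<boxdot> h)) =
    ((f \<boxdot> g) \<boxdot> h) \<cdot> inv_arr M (Assoc M (Dom M f) (Dom M g) (Dom M h))"
proof -
  let ?a = "Assoc M (Dom M f) (Dom M g) (Dom M h)" and ?b = "Assoc M (Cod M f) (Cod M g) (Cod M h)"
  note a = inverse_arrows_Assoc [of "Dom M f" "Dom M g" "Dom M h"]
  note b = inverse_arrows_Assoc [of "Cod M f" "Cod M g" "Cod M h"]
  \<comment> \<open>The pair consisting of \<open>?a\<close> and its inverse is inserted so that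
    naturality of the associator applies.\<close>
  have "inv_arr M ?b \<cdot> (f \<boxdot> (g \<boxdot> h)) = inv_arr M ?b \<cdot> ((f \<boxdot> (g \<boxdot> h)) \<cdot> ?a) \<cdot> inv_arr M ?a"
    using assms inverse_arrowsD(6) [OF a] by simp
  also have "\<dots> = inv_arr M ?b \<cdot> (?b \<cdot> ((f \<boxdot> g) \<boxdot> h)) \<cdot> inv_arr M ?a"
    by (simp only: Assoc_nat [OF assms])
  also have "\<dots> = ((f \<boxdot> g) \<boxdot> h) \<cdot> inv_arr M ?a"
    using assms inverse_arrows_Cmp_cancel [OF b] by simp
  finally show ?thesis .
qed

lemma LUnit_nat: "f \<in> Ar M \<Longrightarrow> LUnit M (Cod M f) \<cdot> (Idn M (UnitO M) \<boxdot> f) = f \<cdot> LUnit M (Dom M f)"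
  by (rule LUnit_natural) (auto simp: Hom_def)

lemma RUnit_nat: "f \<in> Ar M \<Longrightarrow> RUnit M (Cod M f) \<cdot> (f \<boxdot> Idn M (UnitO M)) = f \<cdot> RUnit M (Dom M f)"
  by (rule RUnit_natural) (auto simp: Hom_def)

lemma Symm_nat:
  "\<lbrakk>f \<in> Ar M; g \<in> Ar M\<rbrakk>
    \<Longrightarrow> Symm M (Cod M f) (Cod M g) \<cdot> (f \<boxdot> g) = (g \<boxdot> f) \<cdot> Symm M (Dom M f) (Dom M g)"
  by (rule Symm_natural) (auto simp: Hom_def)

lemma Ar_middle_four [simp]:
  assumes "W \<in> Ob M" "X \<in> Ob M" "Y \<in> Ob M" "Z \<in> Ob M"
  shows "middle_four M W X Y Z \<in> Ar M"
    "Dom M (middle_four M W X Y Z) = (W \<boxtimes> X) \<boxtimes> (Y \<boxtimes> Z)"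
    "Cod M (middle_four M W X Y Z) = (W \<boxtimes> Y) \<boxtimes> (X \<boxtimes> Z)"
  using assms by (simp_all add: middle_four_def)

lemma middle_four_nat:
  assumes "f \<in> Ar M" "g \<in> Ar M" "h \<in> Ar M" "k \<in> Ar M"
  shows "middle_four M (Cod M f) (Cod M g) (Cod M h) (Cod M k) \<cdot> ((f \<boxdot> g) \<boxdot> (h \<boxdot> k)) =
    ((f \<boxdot> h) \<boxdot> (g \<boxdot> k)) \<cdot> middle_four M (Dom M f) (Dom M g) (Dom M h) (Dom M k)"
proof -
  \<comment> \<open>\<open>?m\<close> exchanges the two middle factors, with its two reassociations.
    Its naturality \<open>m\<close> is proved first; the two outer associators of
    \<open>middle_four\<close> are handled afterwards.\<close>
  let ?m = "\<lambda>W X Y Z. Assoc M Y X Z \<cdot> (Symm M X Y \<boxdot> Idn M Z) \<cdot> inv_arr M (Assoc M X Y Z)"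
  have m: "?m W (Cod M g) (Cod M h) (Cod M k) \<cdot> (g \<boxdot> (h \<boxdot> k)) =
      (h \<boxdot> (g \<boxdot> k)) \<cdot> ?m W (Dom M g) (Dom M h) (Dom M k)" (is "?l = ?r") for W
  proof -
    let ?a = "inv_arr M (Assoc M (Dom M g) (Dom M h) (Dom M k))"
    have "?l = Assoc M (Cod M h) (Cod M g) (Cod M k) \<cdot> (Symm M (Cod M g) (Cod M h) \<boxdot> Idn M (Cod M k))
        \<cdot> ((g \<boxdot> h) \<boxdot> k) \<cdot> ?a"
      using assms inv_Assoc_nat [of g h k] by simp
    also have "\<dots> = Assoc M (Cod M h) (Cod M g) (Cod M k) \<cdot> ((h \<boxdot> g) \<boxdot> k)
        \<cdot> (Symm M (Dom M g) (Dom M h) \<boxdot> Idn M (Dom M k)) \<cdot> ?a"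
      using assms Symm_nat [of g h] by simp
    also have "\<dots> = (Assoc M (Cod M h) (Cod M g) (Cod M k) \<cdot> ((h \<boxdot> g) \<boxdot> k))
        \<cdot> (Symm M (Dom M g) (Dom M h) \<boxdot> Idn M (Dom M k)) \<cdot> ?a"
      using assms by (simp del: Cmp_TensA Cmp_TensA')
    also have "\<dots> = ?r"
      unfolding Assoc_nat [OF assms(3) assms(2) assms(4)] using assms by (simp del: Cmp_TensA Cmp_TensA')
    finally show ?thesis .
  qed
  let ?A = "Assoc M (Dom M f) (Dom M g) (Dom M h \<boxtimes> Dom M k)"
  let ?B = "inv_arr M (Assoc M (Cod M f) (Cod M h) (Cod M g \<boxtimes> Cod M k))"
  have "middle_four M (Cod M f) (Cod M g) (Cod M h) (Cod M k) \<cdot> ((f \<boxdot> g) \<boxdot> (h \<boxdot> k)) =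
    ?B \<cdot> (Idn M (Cod M f) \<boxdot> ?m () (Cod M g) (Cod M h) (Cod M k)) \<cdot> (f \<boxdot> (g \<boxdot> (h \<boxdot> k))) \<cdot> ?A"
    unfolding middle_four_def using assms Assoc_nat [of f g "h \<boxdot> k"] by (simp del: Cmp_TensA Cmp_TensA')
  also have "\<dots> = ?B \<cdot> (f \<boxdot> (?m () (Cod M g) (Cod M h) (Cod M k) \<cdot> (g \<boxdot> (h \<boxdot> k)))) \<cdot> ?A"
    using assms by simp
  also have "\<dots> = ?B \<cdot> (f \<boxdot> (h \<boxdot> (g \<boxdot> k))) \<cdot> (Idn M (Dom M f) \<boxdot> ?m () (Dom M g) (Dom M h) (Dom M k)) \<cdot> ?A"
    unfolding m using assms by simp
  also have "\<dots> = (?B \<cdot> (f \<boxdot> (h \<boxdot> (g \<boxdot> k)))) \<cdot> (Idn M (Dom M f) \<boxdot> ?m () (Dom M g) (Dom M h) (Dom M k)) \<cdot> ?A"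
    using assms by (simp del: Cmp_TensA Cmp_TensA')
  also have "\<dots> = ((f \<boxdot> h) \<boxdot> (g \<boxdot> k)) \<cdot> middle_four M (Dom M f) (Dom M g) (Dom M h) (Dom M k)"
    using inv_Assoc_nat [of f h "g \<boxdot> k"] assms
    by (simp add: middle_four_def del: Cmp_TensA Cmp_TensA')
  finally show ?thesis .
qed

end

section \<open>Uniqueness of antipodes and transport of Hopf algebras\<close>

context symmetric_monoidal_category
begin

text \<open>
  The usual uniqueness of convolution inverses, in a form which also covers the graded
  situation: there \<open>C\<close>, \<open>A\<close> and \<open>U\<close> are the components of degree \<open>x\<^sup>-\<^sup>1\<close>, \<open>x\<close> and \<open>1\<close>.
\<close>

lemma convolution_inverse_unique:
  assumes A: "algebra_obj M A \<mu> \<eta>"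
    and d1: "d1 \<in> Hom M C (U \<boxtimes> C)" and d2: "d2 \<in> Hom M C (C \<boxtimes> U)"
    and dl: "dl \<in> Hom M U (C \<boxtimes> A)" and dr: "dr \<in> Hom M U (A \<boxtimes> C)"
    and \<epsilon>: "\<epsilon> \<in> Hom M U (UnitO M)" and C: "C \<in> Ob M"
    and s: "s \<in> Hom M C A" and s': "s' \<in> Hom M C A"
    and coassoc: "Assoc M C A C \<cdot> (dl \<boxdot> Idn M C) \<cdot> d1 = (Idn M C \<boxdot> dr) \<cdot> d2"
    and counit_r: "RUnit M C \<cdot> (Idn M C \<boxdot> \<epsilon>) \<cdot> d2 = Idn M C"
    and counit_l: "LUnit M C \<cdot> (\<epsilon> \<boxdot> Idn M C) \<cdot> d1 = Idn M C"
    and left: "\<mu> \<cdot> (s \<boxdot> Idn M A) \<cdot> dl = \<eta> \<cdot> \<epsilon>"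
    and right: "\<mu> \<cdot> (Idn M A \<boxdot> s') \<cdot> dr = \<eta> \<cdot> \<epsilon>"
  shows "s = s'"
proof -
  have [simp]: "A \<in> Ob M" "\<mu> \<in> Ar M" "Dom M \<mu> = A \<boxtimes> A" "Cod M \<mu> = A"
    "\<eta> \<in> Ar M" "Dom M \<eta> = UnitO M" "Cod M \<eta> = A"
    and assoc: "\<mu> \<cdot> (\<mu> \<boxdot> Idn M A) = \<mu> \<cdot> (Idn M A \<boxdot> \<mu>) \<cdot> Assoc M A A A"
    and unit_l: "\<mu> \<cdot> (\<eta> \<boxdot> Idn M A) = LUnit M A" and unit_r: "\<mu> \<cdot> (Idn M A \<boxdot> \<eta>) = RUnit M A"
    using A by (auto simp: algebra_obj_def Hom_def)
  note [simp] = HomD [OF d1] HomD [OF d2] HomD [OF dl] HomD [OF dr] HomD [OF \<epsilon>] HomD [OF s] HomD [OF s'] C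
  have [simp]: "U \<in> Ob M"
    using Ob_Dom_Cod(1) [of \<epsilon>] by simp
  have nat: "(s \<boxdot> (Idn M A \<boxdot> s')) \<cdot> Assoc M C A C = Assoc M A A A \<cdot> ((s \<boxdot> Idn M A) \<boxdot> s')"
    using Assoc_nat [of s "Idn M A" s'] by (simp del: Cmp_TensA Cmp_TensA')
  \<comment> \<open>The chain is s = s * (id * s') = (s * id) * s' = s' for the convolution product,
    with units and associativity written out through the constraints.\<close>
  have "s = s \<cdot> RUnit M C \<cdot> (Idn M C \<boxdot> \<epsilon>) \<cdot> d2"
    by (simp add: counit_r)
  also have "\<dots> = (s \<cdot> RUnit M C) \<cdot> (Idn M C \<boxdot> \<epsilon>) \<cdot> d2"
    by simp
  also have "\<dots> = RUnit M A \<cdot> (s \<boxdot> Idn M (UnitO M)) \<cdot> (Idn M C \<boxdot> \<epsilon>) \<cdot> d2"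
    using RUnit_nat [of s] by (simp del: Cmp_TensA Cmp_TensA' Cmp_assoc_simp flip: Cmp_assoc_simp)
  also have "\<dots> = (\<mu> \<cdot> (Idn M A \<boxdot> \<eta>)) \<cdot> (s \<boxdot> \<epsilon>) \<cdot> d2"
    by (simp add: unit_r)
  also have "\<dots> = \<mu> \<cdot> (s \<boxdot> (\<eta> \<cdot> \<epsilon>)) \<cdot> d2"
    by simp
  also have "\<dots> = \<mu> \<cdot> (Idn M A \<boxdot> \<mu>) \<cdot> (s \<boxdot> (Idn M A \<boxdot> s')) \<cdot> ((Idn M C \<boxdot> dr) \<cdot> d2)"
    unfolding right [symmetric] by simp
  also have "\<dots> = \<mu> \<cdot> (Idn M A \<boxdot> \<mu>) \<cdot> ((s \<boxdot> (Idn M A \<boxdot> s')) \<cdot> Assoc M C A C) \<cdot> (dl \<boxdot> Idn M C) \<cdot> d1"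
    unfolding coassoc [symmetric] by (simp del: Cmp_TensA Cmp_TensA')
  also have "\<dots> = (\<mu> \<cdot> (Idn M A \<boxdot> \<mu>) \<cdot> Assoc M A A A) \<cdot> ((s \<boxdot> Idn M A) \<boxdot> s') \<cdot> (dl \<boxdot> Idn M C) \<cdot> d1"
    unfolding nat by (simp del: Cmp_TensA Cmp_TensA')
  also have "\<dots> = \<mu> \<cdot> ((\<mu> \<cdot> (s \<boxdot> Idn M A) \<cdot> dl) \<boxdot> s') \<cdot> d1"
    unfolding assoc [symmetric] by simp
  also have "\<dots> = (\<mu> \<cdot> (\<eta> \<boxdot> Idn M A)) \<cdot> (Idn M (UnitO M) \<boxdot> s') \<cdot> (\<epsilon> \<boxdot> Idn M C) \<cdot> d1"
    unfolding left by simp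
  also have "\<dots> = (LUnit M A \<cdot> (Idn M (UnitO M) \<boxdot> s')) \<cdot> (\<epsilon> \<boxdot> Idn M C) \<cdot> d1"
    unfolding unit_l by (simp del: Cmp_TensA Cmp_TensA')
  also have "\<dots> = s' \<cdot> LUnit M C \<cdot> (\<epsilon> \<boxdot> Idn M C) \<cdot> d1"
    using LUnit_nat [of s'] by simp
  also have "\<dots> = s'"
    by (simp add: counit_l)
  finally show ?thesis .
qed

lemma bialgebra_objD:
  assumes "bialgebra_obj M B"
  shows "carr B \<in> Ob M"
    "mlt B \<in> Ar M" "Dom M (mlt B) = carr B \<boxtimes> carr B" "Cod M (mlt B) = carr B"
    "unt B \<in> Ar M" "Dom M (unt B) = UnitO M" "Cod M (unt B) = carr B"
    "cmlt B \<in> Ar M" "Dom M (cmlt B) = carr B" "Cod M (cmlt B) = carr B \<boxtimes> carr B"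
    "cunt B \<in> Ar M" "Dom M (cunt B) = carr B" "Cod M (cunt B) = UnitO M"
  using assms by (auto simp: bialgebra_obj_def algebra_obj_def coalgebra_obj_def Hom_def)

lemma antipode_unique:
  assumes "bialgebra_obj M B" "antipode M B s" "antipode M B s'"
  shows "s = s'"
  using assms
  by (intro convolution_inverse_unique [of "carr B" "mlt B" "unt B" "cmlt B" "carr B" "carr B"
        "cmlt B" "cmlt B" "cmlt B" "cunt B" s s'])
    (auto simp: bialgebra_obj_def algebra_obj_def coalgebra_obj_def antipode_def)

section \<open>Transport of a Hopf algebra along an isomorphism of its carrier\<close>

definition transport :: "'a \<Rightarrow> 'a \<Rightarrow> ('o, 'a) bialg \<Rightarrow> ('o, 'a) bialg" where
  "transport f g B =
     \<lparr>carr = Cod M f, mlt = f \<cdot> mlt B \<cdot> (g \<boxdot> g), unt = f \<cdot> unt B,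
      cmlt = (f \<boxdot> f) \<cdot> cmlt B \<cdot> g, cunt = cunt B \<cdot> g\<rparr>"

text \<open>Each equation of a bialgebra morphism, composed with \<open>g\<close>, solves for one
  structure map of \<open>B'\<close>. Questions about isomorphic bialgebras thereby become questions
  about conjugates of \<open>B\<close>.\<close>

lemma iso_bialgebra_hom_imp_transport:
  assumes B: "bialgebra_obj M B" and f: "bialgebra_hom M B B' f" and g: "inverse_arrows M f g"
    and B': "mlt B' \<in> Ar M" "cmlt B' \<in> Ar M" "cunt B' \<in> Ar M" "Dom M (mlt B') = carr B' \<boxtimes> carr B'"
      "Dom M (cmlt B') = carr B'" "Dom M (cunt B') = carr B'"
  shows "B' = transport f g B"
proof -
  have [simp]: "f \<in> Ar M" "Dom M f = carr B" "Cod M f = carr B'"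
    and fm: "f \<cdot> mlt B = mlt B' \<cdot> (f \<boxdot> f)" "f \<cdot> unt B = unt B'"
    and fd: "cmlt B' \<cdot> f = (f \<boxdot> f) \<cdot> cmlt B" "cunt B' \<cdot> f = cunt B"
    using f by (auto simp: bialgebra_hom_def algebra_hom_def Hom_def)
  have [simp]: "g \<in> Ar M" "Dom M g = carr B'" "Cod M g = carr B" "f \<cdot> g = Idn M (carr B')"
    using inverse_arrowsD [OF g] by simp_all
  have [simp]: "carr B' \<in> Ob M"
    using Ob_Dom_Cod [of f] by simp
  note [simp] = bialgebra_objD [OF B] B'
  have "f \<cdot> mlt B \<cdot> (g \<boxdot> g) = (f \<cdot> mlt B) \<cdot> (g \<boxdot> g)"
    by simp
  also have "\<dots> = mlt B'"
    unfolding fm by simp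
  finally have 1: "f \<cdot> mlt B \<cdot> (g \<boxdot> g) = mlt B'" .
  have "(f \<boxdot> f) \<cdot> cmlt B \<cdot> g = ((f \<boxdot> f) \<cdot> cmlt B) \<cdot> g"
    by simp
  also have "\<dots> = cmlt B'"
    unfolding fd(1) [symmetric] by simp
  finally have 2: "(f \<boxdot> f) \<cdot> cmlt B \<cdot> g = cmlt B'" .
  have 3: "cunt B \<cdot> g = cunt B'"
    unfolding fd(2) [symmetric] by simp
  show ?thesis
    by (rule bialg.equality) (simp_all add: transport_def 1 2 3 fm(2))
qed

context
  fixes B f g
  assumes B: "bialgebra_obj M B" and fg: "inverse_arrows M f g" and dom_f: "Dom M f = carr B"
begin

private lemma inv:
  "f \<in> Ar M" "g \<in> Ar M" "Dom M f = carr B" "Dom M g = Cod M f" "Cod M g = carr B"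
  "f \<cdot> g = Idn M (Cod M f)" "g \<cdot> f = Idn M (carr B)" "Cod M f \<in> Ob M"
  using inverse_arrowsD [OF fg] dom_f by simp_all

private lemma cancel:
  "\<lbrakk>h \<in> Ar M; Cod M h = carr B\<rbrakk> \<Longrightarrow> g \<cdot> f \<cdot> h = h"
  "\<lbrakk>h \<in> Ar M; Cod M h = Cod M f\<rbrakk> \<Longrightarrow> f \<cdot> g \<cdot> h = h"
  using inverse_arrows_Cmp_cancel [OF fg] dom_f by (simp_all add: inv)

context
  notes [simp] = inv cancel bialgebra_objD [OF B]
begin

private lemma alg:
  "mlt B \<cdot> (mlt B \<boxdot> Idn M (carr B)) = mlt B \<cdot> (Idn M (carr B) \<boxdot> mlt B) \<cdot> Assoc M (carr B) (carr B) (carr B)"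
  "mlt B \<cdot> (unt B \<boxdot> Idn M (carr B)) = LUnit M (carr B)"
  "mlt B \<cdot> (Idn M (carr B) \<boxdot> unt B) = RUnit M (carr B)"
  using B unfolding bialgebra_obj_def algebra_obj_def by blast+

private lemma coalg:
  "Assoc M (carr B) (carr B) (carr B) \<cdot> (cmlt B \<boxdot> Idn M (carr B)) \<cdot> cmlt B = (Idn M (carr B) \<boxdot> cmlt B) \<cdot> cmlt B"
  "LUnit M (carr B) \<cdot> (cunt B \<boxdot> Idn M (carr B)) \<cdot> cmlt B = Idn M (carr B)"
  "RUnit M (carr B) \<cdot> (Idn M (carr B) \<boxdot> cunt B) \<cdot> cmlt B = Idn M (carr B)"
  using B unfolding bialgebra_obj_def coalgebra_obj_def by blast+

text \<open>Adjacent factors \<open>g \<cdot> f\<close> cancel, which leaves the laws of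
  \<open>B\<close> between one \<open>f\<close> and copies of \<open>g\<close>; naturality then
  carries the copies of \<open>g\<close> past the constraints. The coalgebra laws are treated
  dually.\<close>

lemma algebra_obj_transport:
  "algebra_obj M (Cod M f) (f \<cdot> mlt B \<cdot> (g \<boxdot> g)) (f \<cdot> unt B)"
proof -
  let ?A = "carr B" and ?C = "Cod M f" and ?\<mu> = "f \<cdot> mlt B \<cdot> (g \<boxdot> g)" and ?I = "Idn M (UnitO M)"
  have "?\<mu> \<cdot> (?\<mu> \<boxdot> Idn M ?C) = f \<cdot> (mlt B \<cdot> (mlt B \<boxdot> Idn M ?A)) \<cdot> ((g \<boxdot> g) \<boxdot> g)"
    by simp
  also have "\<dots> = f \<cdot> mlt B \<cdot> (Idn M ?A \<boxdot> mlt B) \<cdot> (Assoc M ?A ?A ?A \<cdot> ((g \<boxdot> g) \<boxdot> g))"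
    unfolding alg by (simp del: Cmp_TensA Cmp_TensA')
  also have "\<dots> = ?\<mu> \<cdot> (Idn M ?C \<boxdot> ?\<mu>) \<cdot> Assoc M ?C ?C ?C"
    using Assoc_nat [of g g g] by simp
  finally have 1: "?\<mu> \<cdot> (?\<mu> \<boxdot> Idn M ?C) = \<dots>" .
  have "?\<mu> \<cdot> ((f \<cdot> unt B) \<boxdot> Idn M ?C) = f \<cdot> (mlt B \<cdot> (unt B \<boxdot> Idn M ?A)) \<cdot> (?I \<boxdot> g)"
    by simp
  also have "\<dots> = LUnit M ?C"
    using LUnit_nat [of g] unfolding alg by simp
  finally have 2: "?\<mu> \<cdot> ((f \<cdot> unt B) \<boxdot> Idn M ?C) = LUnit M ?C" .
  have "?\<mu> \<cdot> (Idn M ?C \<boxdot> (f \<cdot> unt B)) = f \<cdot> (mlt B \<cdot> (Idn M ?A \<boxdot> unt B)) \<cdot> (g \<boxdot> ?I)"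
    by simp
  also have "\<dots> = RUnit M ?C"
    using RUnit_nat [of g] unfolding alg by simp
  finally have 3: "?\<mu> \<cdot> (Idn M ?C \<boxdot> (f \<cdot> unt B)) = RUnit M ?C" .
  show ?thesis
    unfolding algebra_obj_def by (intro conjI 1 2 3) (simp_all add: Hom_def)
qed

lemma coalgebra_obj_transport:
  "coalgebra_obj M (Cod M f) ((f \<boxdot> f) \<cdot> cmlt B \<cdot> g) (cunt B \<cdot> g)"
proof -
  let ?A = "carr B" and ?C = "Cod M f" and ?\<Delta> = "(f \<boxdot> f) \<cdot> cmlt B \<cdot> g" and ?I = "Idn M (UnitO M)"
  have "Assoc M ?C ?C ?C \<cdot> (?\<Delta> \<boxdot> Idn M ?C) \<cdot> ?\<Delta> =
      (Assoc M ?C ?C ?C \<cdot> ((f \<boxdot> f) \<boxdot> f)) \<cdot> (cmlt B \<boxdot> Idn M ?A) \<cdot> cmlt B \<cdot> g"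
    by simp
  also have "\<dots> = (f \<boxdot> (f \<boxdot> f)) \<cdot> (Assoc M ?A ?A ?A \<cdot> (cmlt B \<boxdot> Idn M ?A) \<cdot> cmlt B) \<cdot> g"
    using Assoc_nat [of f f f] by (simp del: Cmp_TensA Cmp_TensA')
  also have "\<dots> = (Idn M ?C \<boxdot> ?\<Delta>) \<cdot> ?\<Delta>"
    unfolding coalg by simp
  finally have 1: "Assoc M ?C ?C ?C \<cdot> (?\<Delta> \<boxdot> Idn M ?C) \<cdot> ?\<Delta> = \<dots>" .
  have "LUnit M ?C \<cdot> ((cunt B \<cdot> g) \<boxdot> Idn M ?C) \<cdot> ?\<Delta> =
      (LUnit M ?C \<cdot> (?I \<boxdot> f)) \<cdot> (cunt B \<boxdot> Idn M ?A) \<cdot> cmlt B \<cdot> g"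
    by simp
  also have "\<dots> = f \<cdot> (LUnit M ?A \<cdot> (cunt B \<boxdot> Idn M ?A) \<cdot> cmlt B) \<cdot> g"
    using LUnit_nat [of f] by simp
  also have "\<dots> = Idn M ?C"
    unfolding coalg by simp
  finally have 2: "LUnit M ?C \<cdot> ((cunt B \<cdot> g) \<boxdot> Idn M ?C) \<cdot> ?\<Delta> = Idn M ?C" .
  have "RUnit M ?C \<cdot> (Idn M ?C \<boxdot> (cunt B \<cdot> g)) \<cdot> ?\<Delta> =
      (RUnit M ?C \<cdot> (f \<boxdot> ?I)) \<cdot> (Idn M ?A \<boxdot> cunt B) \<cdot> cmlt B \<cdot> g"
    by simp
  also have "\<dots> = f \<cdot> (RUnit M ?A \<cdot> (Idn M ?A \<boxdot> cunt B) \<cdot> cmlt B) \<cdot> g"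
    using RUnit_nat [of f] by simp
  also have "\<dots> = Idn M ?C"
    unfolding coalg by simp
  finally have 3: "RUnit M ?C \<cdot> (Idn M ?C \<boxdot> (cunt B \<cdot> g)) \<cdot> ?\<Delta> = Idn M ?C" .
  show ?thesis
    unfolding coalgebra_obj_def by (intro conjI 1 2 3) (simp_all add: Hom_def)
qed

lemma bialgebra_obj_transport: "bialgebra_obj M (transport f g B)"
proof -
  let ?A = "carr B" and ?C = "Cod M f" and ?m = "\<lambda>X. middle_four M X X X X" and ?I = "Idn M (UnitO M)"
  let ?\<mu> = "f \<cdot> mlt B \<cdot> (g \<boxdot> g)" and ?\<Delta> = "(f \<boxdot> f) \<cdot> cmlt B \<cdot> g"
  have B1: "cmlt B \<cdot> mlt B = ((mlt B \<boxdot> mlt B) \<cdot> ?m ?A) \<cdot> (cmlt B \<boxdot> cmlt B)"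
    and B2: "cmlt B \<cdot> unt B = (unt B \<boxdot> unt B) \<cdot> inv_arr M (LUnit M (UnitO M))"
    and B3: "cunt B \<cdot> mlt B = LUnit M (UnitO M) \<cdot> (cunt B \<boxdot> cunt B)" "cunt B \<cdot> unt B = ?I"
    using B unfolding bialgebra_obj_def algebra_hom_def tens_mult_def tens_unit_def by blast+
  have "?\<Delta> \<cdot> ?\<mu> = (f \<boxdot> f) \<cdot> (cmlt B \<cdot> mlt B) \<cdot> (g \<boxdot> g)"
    by simp
  \<comment> \<open>The fourfold tensors of \<open>g\<close> and of \<open>f\<close> cancel each
    other. They are inserted so that naturality carries \<open>g\<close> across \<open>?m\<close>
    and each copy of \<open>?\<Delta>\<close> finds its factor \<open>f\<close>.\<close>
  also have "\<dots> = (f \<boxdot> f) \<cdot> (mlt B \<boxdot> mlt B) \<cdot> (?m ?A \<cdot> ((g \<boxdot> g) \<boxdot> (g \<boxdot> g))) \<cdot>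
      ((f \<boxdot> f) \<boxdot> (f \<boxdot> f)) \<cdot> (cmlt B \<boxdot> cmlt B) \<cdot> (g \<boxdot> g)"
    unfolding B1 by simp
  also have "\<dots> = ((?\<mu> \<boxdot> ?\<mu>) \<cdot> ?m ?C) \<cdot> (?\<Delta> \<boxdot> ?\<Delta>)"
    using middle_four_nat [of g g g g] by simp
  finally have 1: "?\<Delta> \<cdot> ?\<mu> = \<dots>" .
  have "?\<Delta> \<cdot> (f \<cdot> unt B) = (f \<boxdot> f) \<cdot> (cmlt B \<cdot> unt B)"
    by simp
  also have "\<dots> = ((f \<cdot> unt B) \<boxdot> (f \<cdot> unt B)) \<cdot> inv_arr M (LUnit M (UnitO M))"
    unfolding B2 by simp
  finally have 2: "?\<Delta> \<cdot> (f \<cdot> unt B) = \<dots>" .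
  have "(cunt B \<cdot> g) \<cdot> ?\<mu> = (cunt B \<cdot> mlt B) \<cdot> (g \<boxdot> g)"
    by simp
  also have "\<dots> = LUnit M (UnitO M) \<cdot> ((cunt B \<cdot> g) \<boxdot> (cunt B \<cdot> g))"
    unfolding B3 by simp
  finally have 3: "(cunt B \<cdot> g) \<cdot> ?\<mu> = \<dots>" .
  have 4: "(cunt B \<cdot> g) \<cdot> (f \<cdot> unt B) = ?I"
    using B3 by simp
  show ?thesis
    using algebra_obj_transport coalgebra_obj_transport
    unfolding bialgebra_obj_def algebra_hom_def tens_mult_def tens_unit_def transport_def bialg.simps
    by (intro conjI 1 2 3 4) (simp_all add: Hom_def)
qed

lemma bialgebra_hom_transport: "bialgebra_hom M B (transport f g B) f"
  by (simp add: bialgebra_hom_def algebra_hom_def transport_def Hom_def)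

lemma antipode_transport:
  assumes "antipode M B s"
  shows "antipode M (transport f g B) (f \<cdot> s \<cdot> g)"
proof -
  let ?A = "carr B" and ?C = "Cod M f"
  let ?\<mu> = "f \<cdot> mlt B \<cdot> (g \<boxdot> g)" and ?\<Delta> = "(f \<boxdot> f) \<cdot> cmlt B \<cdot> g"
  have [simp]: "s \<in> Ar M" "Dom M s = ?A" "Cod M s = ?A"
    and s: "mlt B \<cdot> (s \<boxdot> Idn M ?A) \<cdot> cmlt B = unt B \<cdot> cunt B"
      "mlt B \<cdot> (Idn M ?A \<boxdot> s) \<cdot> cmlt B = unt B \<cdot> cunt B"
    using assms unfolding antipode_def Hom_def by blast+
  have "?\<mu> \<cdot> ((f \<cdot> s \<cdot> g) \<boxdot> Idn M ?C) \<cdot> ?\<Delta> = f \<cdot> (mlt B \<cdot> (s \<boxdot> Idn M ?A) \<cdot> cmlt B) \<cdot> g"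
    by simp
  also have "\<dots> = (f \<cdot> unt B) \<cdot> (cunt B \<cdot> g)"
    unfolding s by simp
  finally have 1: "?\<mu> \<cdot> ((f \<cdot> s \<cdot> g) \<boxdot> Idn M ?C) \<cdot> ?\<Delta> = \<dots>" .
  have "?\<mu> \<cdot> (Idn M ?C \<boxdot> (f \<cdot> s \<cdot> g)) \<cdot> ?\<Delta> = f \<cdot> (mlt B \<cdot> (Idn M ?A \<boxdot> s) \<cdot> cmlt B) \<cdot> g"
    by simp
  also have "\<dots> = (f \<cdot> unt B) \<cdot> (cunt B \<cdot> g)"
    unfolding s by simp
  finally have 2: "?\<mu> \<cdot> (Idn M ?C \<boxdot> (f \<cdot> s \<cdot> g)) \<cdot> ?\<Delta> = \<dots>" .
  show ?thesis
    unfolding antipode_def transport_def bialg.simps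
    by (intro conjI 1 2) (simp add: Hom_def)
qed

lemma hopf_algebra_transport:
  assumes "hopf_algebra M B"
  shows "hopf_algebra M (transport f g B)"
proof -
  obtain s t where s: "antipode M B s" and t: "inverse_arrows M s t"
    using assms by (auto simp: hopf_algebra_def iso_arr_def)
  have [simp]: "s \<in> Ar M" "Dom M s = carr B" "Cod M s = carr B"
    using s by (auto simp: antipode_def Hom_def)
  have "inverse_arrows M (f \<cdot> s \<cdot> g) ((f \<cdot> t) \<cdot> g)"
    by (rule inverse_arrows_Cmp [OF inverse_arrows_Cmp [OF inverse_arrows_sym [OF fg] t] fg]) simp_all
  then show ?thesis
    using bialgebra_obj_transport antipode_transport [OF s] by (auto simp: hopf_algebra_def iso_arr_def)
qed

end

end

text \<open>The conjugate of \<open>s\<close> by \<open>f\<close> is an antipode of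
  \<open>B'\<close>, so it is \<open>s'\<close> by uniqueness. This later compares the families
  \<open>h_ant\<close> of two identified Hopf coalgebras.\<close>

lemma iso_bialgebra_hom_antipode:
  assumes "bialgebra_obj M B" "bialgebra_obj M B'" "bialgebra_hom M B B' f" "iso_arr M f"
    and "antipode M B s" "antipode M B' s'"
  shows "s' \<cdot> f = f \<cdot> s"
proof -
  obtain g where g: "inverse_arrows M f g"
    using assms by (auto simp: iso_arr_def)
  have f: "Dom M f = carr B"
    using assms by (auto simp: bialgebra_hom_def algebra_hom_def Hom_def)
  have B': "B' = transport f g B"
    by (rule iso_bialgebra_hom_imp_transport [OF assms(1,3) g]) (simp_all add: bialgebra_objD [OF assms(2)])
  have "antipode M B' (f \<cdot> s \<cdot> g)"
    using antipode_transport [OF assms(1) g f assms(5)] B' by simp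
  then have "s' = f \<cdot> s \<cdot> g"
    using antipode_unique assms by blast
  moreover have "s \<in> Ar M" "Dom M s = carr B" "Cod M s = carr B"
    using assms(5) by (auto simp: antipode_def Hom_def)
  ultimately show ?thesis
    using inverse_arrowsD [OF g] f by simp
qed

end

section \<open>Small categories, functors and natural transformations\<close>

lemma upair_in_uprod [simp]: "upair x y \<in> uprod A B \<longleftrightarrow> x \<in> A \<and> y \<in> B"
  by (auto simp: uprod_def)

lemma uprodE:
  assumes "z \<in> uprod A B"
  obtains x y where "z = upair x y" "x \<in> A" "y \<in> B"
  using assms by (auto simp: uprod_def)

lemma ball_uprod [simp]: "(\<forall>z \<in> uprod A B. P z) \<longleftrightarrow> (\<forall>x \<in> A. \<forall>y \<in> B. P (upair x y))"
  by (auto simp: uprod_def)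

text \<open>Membership in \<open>Hom\<close> is spelled out as equations for domain and codomain,
  which can serve as rewrite rules.\<close>

lemma is_functor_iff:
  "is_functor C D F \<longleftrightarrow>
     FO F \<in> extensional (Ob C) \<and> FA F \<in> extensional (Ar C) \<and>
     (\<forall>x \<in> Ob C. FO F x \<in> Ob D) \<and>
     (\<forall>f \<in> Ar C. FA F f \<in> Ar D \<and> Dom D (FA F f) = FO F (Dom C f) \<and> Cod D (FA F f) = FO F (Cod C f)) \<and>
     (\<forall>x \<in> Ob C. FA F (Idn C x) = Idn D (FO F x)) \<and>
     (\<forall>g f. composable C g f \<longrightarrow> FA F (g \<cdot>\<^bsub>C\<^esub> f) = FA F g \<cdot>\<^bsub>D\<^esub> FA F f)"
  unfolding is_functor_def Hom_def PiE_def Pi_def by auto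

lemma nat_trans_iff:
  "nat_trans C D F G \<gamma> \<longleftrightarrow>
     \<gamma> \<in> extensional (Ob C) \<and>
     (\<forall>x \<in> Ob C. \<gamma> x \<in> Ar D \<and> Dom D (\<gamma> x) = FO F x \<and> Cod D (\<gamma> x) = FO G x) \<and>
     (\<forall>f \<in> Ar C. \<gamma> (Cod C f) \<cdot>\<^bsub>D\<^esub> FA F f = FA G f \<cdot>\<^bsub>D\<^esub> \<gamma> (Dom C f))"
  unfolding nat_trans_def Hom_def by auto

lemma functor_eqI:
  assumes "is_functor C D F" "is_functor C D G"
    and "\<And>x. x \<in> Ob C \<Longrightarrow> FO F x = FO G x" "\<And>f. f \<in> Ar C \<Longrightarrow> FA F f = FA G f"
  shows "F = G"
proof (rule fctr.equality)
  have "FO F \<in> extensional (Ob C)" "FO G \<in> extensional (Ob C)"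
    "FA F \<in> extensional (Ar C)" "FA G \<in> extensional (Ar C)"
    using assms(1,2) unfolding is_functor_iff by blast+
  then show "FO F = FO G" "FA F = FA G"
    using extensionalityI assms(3,4) by metis+
qed simp

lemma prod_cat_simps [simp]:
  "Ob (prod_cat C D) = uprod (Ob C) (Ob D)"
  "Ar (prod_cat C D) = uprod (Ar C) (Ar D)"
  "\<lbrakk>f \<in> Ar C; g \<in> Ar D\<rbrakk> \<Longrightarrow> Dom (prod_cat C D) (upair f g) = upair (Dom C f) (Dom D g)"
  "\<lbrakk>f \<in> Ar C; g \<in> Ar D\<rbrakk> \<Longrightarrow> Cod (prod_cat C D) (upair f g) = upair (Cod C f) (Cod D g)"
  "\<lbrakk>x \<in> Ob C; y \<in> Ob D\<rbrakk> \<Longrightarrow> Idn (prod_cat C D) (upair x y) = upair (Idn C x) (Idn D y)"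
  "\<lbrakk>composable C g f; composable D g' f'\<rbrakk> \<Longrightarrow>
     upair g g' \<cdot>\<^bsub>prod_cat C D\<^esub> upair f f' = upair (g \<cdot>\<^bsub>C\<^esub> f) (g' \<cdot>\<^bsub>D\<^esub> f')"
  by (auto simp: prod_cat_def composable_def)

lemma composable_prod_cat [simp]:
  "composable (prod_cat C D) (upair g g') (upair f f') \<longleftrightarrow> composable C g f \<and> composable D g' f'"
  by (auto simp: prod_cat_def composable_def)

lemma composable_prod_catE:
  assumes "composable (prod_cat C D) k h"
  obtains g g' f f' where "k = upair g g'" "h = upair f f'" "composable C g f" "composable D g' f'"
    "g \<in> Ar C" "f \<in> Ar C" "g' \<in> Ar D" "f' \<in> Ar D"
proof -
  obtain g g' f f' where "k = upair g g'" "h = upair f f'"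
    using assms by (auto simp: composable_def elim!: uprodE)
  then show ?thesis
    using assms that by (auto simp: composable_def)
qed

lemma one_cat_simps [simp]:
  "Ob one_cat = {upoint}" "Ar one_cat = {upoint}" "Dom one_cat upoint = upoint"
  "Cod one_cat upoint = upoint" "Idn one_cat upoint = upoint"
  "upoint \<cdot>\<^bsub>one_cat\<^esub> upoint = upoint"
  by (auto simp: one_cat_def)

lemma small_category_prod_cat:
  assumes "small_category C" "small_category D"
  shows "small_category (prod_cat C D)"
proof -
  interpret C: category C
    using assms by (simp add: small_category_def)
  interpret D: category D
    using assms by (simp add: small_category_def)
  have "category (prod_cat C D)"
  proof
    fix h :: 'a and w x y z f g
    assume *: "f \<in> Hom (prod_cat C D) w x" "g \<in> Hom (prod_cat C D) x y" "h \<in> Hom (prod_cat C D) y z"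
    then have "composable (prod_cat C D) g f" "composable (prod_cat C D) h g"
      by (auto simp: Hom_def composable_def)
    then show "h \<cdot>\<^bsub>prod_cat C D\<^esub> g \<cdot>\<^bsub>prod_cat C D\<^esub> f = (h \<cdot>\<^bsub>prod_cat C D\<^esub> g) \<cdot>\<^bsub>prod_cat C D\<^esub> f"
      by (auto elim!: composable_prod_catE)
  next
    fix x y z f g
    assume *: "f \<in> Hom (prod_cat C D) x y" "g \<in> Hom (prod_cat C D) y z"
    then have "composable (prod_cat C D) g f"
      by (auto simp: Hom_def composable_def)
    then show "g \<cdot>\<^bsub>prod_cat C D\<^esub> f \<in> Hom (prod_cat C D) x z"
      using * by (auto elim!: composable_prod_catE simp: Hom_def)
  qed (auto simp: Hom_def elim!: uprodE)
  then show ?thesis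
    unfolding small_category_def by (auto simp: prod_cat_def composable_def elim!: uprodE)
qed

lemma small_category_one_cat: "small_category one_cat"
proof -
  have "category one_cat"
    by unfold_locales (auto simp: Hom_def)
  then show ?thesis
    unfolding small_category_def by (auto simp: one_cat_def composable_def)
qed

lemma functor_simps [simp]:
  "x \<in> Ob C \<Longrightarrow> FO (id_functor C) x = x" "f \<in> Ar C \<Longrightarrow> FA (id_functor C) f = f"
  "x \<in> Ob C \<Longrightarrow> FO (comp_functor C G F) x = FO G (FO F x)"
  "f \<in> Ar C \<Longrightarrow> FA (comp_functor C G F) f = FA G (FA F f)"
  "FO (id_functor C) \<in> extensional (Ob C)" "FA (id_functor C) \<in> extensional (Ar C)"
  "FO (comp_functor C G F) \<in> extensional (Ob C)" "FA (comp_functor C G F) \<in> extensional (Ar C)"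
  by (auto simp: id_functor_def comp_functor_def)

lemma prod_functor_simps [simp]:
  "\<lbrakk>x \<in> Ob C; y \<in> Ob D\<rbrakk> \<Longrightarrow> FO (prod_functor C D F G) (upair x y) = upair (FO F x) (FO G y)"
  "\<lbrakk>f \<in> Ar C; g \<in> Ar D\<rbrakk> \<Longrightarrow> FA (prod_functor C D F G) (upair f g) = upair (FA F f) (FA G g)"
  "FO (prod_functor C D F G) \<in> extensional (uprod (Ob C) (Ob D))"
  "FA (prod_functor C D F G) \<in> extensional (uprod (Ar C) (Ar D))"
  by (auto simp: prod_functor_def)

section \<open>The symmetric monoidal category of functors into a symmetric monoidal category\<close>

text \<open>\<open>E\<close> takes an \<open>smc\<close> without record extension; the locale fixes
  this type.\<close>

locale smc_base = symmetric_monoidal_category S for S :: "('o, 'a) smc" (structure)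

lemma E_simps [simp]:
  "Ob (E S) = E_Ob S" "Ar (E S) = E_Ar S" "Dom (E S) = e_dom" "Cod (E S) = e_cod"
  "TensO (E S) = E_TensO S" "UnitO (E S) = E_UnitO S"
  by (simp_all add: E_def)

lemma Idn_E_simps [simp]:
  "e_dom (Idn (E S) X) = X" "e_cod (Idn (E S) X) = X" "e_fun (Idn (E S) X) = id_functor (fst X)"
  "x \<in> Ob (fst X) \<Longrightarrow> e_nat (Idn (E S) X) x = Idn S (FO (snd X) x)"
  "e_nat (Idn (E S) X) \<in> extensional (Ob (fst X))"
  by (simp_all add: E_def)

lemma Cmp_E_simps [simp]:
  "e_dom (g \<cdot>\<^bsub>E S\<^esub> f) = e_dom f" "e_cod (g \<cdot>\<^bsub>E S\<^esub> f) = e_cod g"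
  "e_fun (g \<cdot>\<^bsub>E S\<^esub> f) = comp_functor (fst (e_cod g)) (e_fun f) (e_fun g)"
  "z \<in> Ob (fst (e_cod g)) \<Longrightarrow> e_nat (g \<cdot>\<^bsub>E S\<^esub> f) z = e_nat g z \<cdot>\<^bsub>S\<^esub> e_nat f (FO (e_fun g) z)"
  "e_cod g = Z \<Longrightarrow> e_nat (g \<cdot>\<^bsub>E S\<^esub> f) \<in> extensional (Ob (fst Z))"
  by (simp_all add: E_def)

lemma TensA_E_simps [simp]:
  "e_dom (f \<boxdot>\<^bsub>E S\<^esub> g) = E_TensO S (e_dom f) (e_dom g)"
  "e_cod (f \<boxdot>\<^bsub>E S\<^esub> g) = E_TensO S (e_cod f) (e_cod g)"
  "e_fun (f \<boxdot>\<^bsub>E S\<^esub> g) = prod_functor (fst (e_cod f)) (fst (e_cod g)) (e_fun f) (e_fun g)"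
  "\<lbrakk>x \<in> Ob (fst (e_cod f)); y \<in> Ob (fst (e_cod g))\<rbrakk>
    \<Longrightarrow> e_nat (f \<boxdot>\<^bsub>E S\<^esub> g) (upair x y) = e_nat f x \<boxdot>\<^bsub>S\<^esub> e_nat g y"
  "\<lbrakk>e_cod f = X; e_cod g = Y\<rbrakk>
    \<Longrightarrow> e_nat (f \<boxdot>\<^bsub>E S\<^esub> g) \<in> extensional (uprod (Ob (fst X)) (Ob (fst Y)))"
  by (simp_all add: E_def)

lemma E_TensO_simps [simp]:
  "fst (E_TensO S X Y) = prod_cat (fst X) (fst Y)"
  "\<lbrakk>x \<in> Ob (fst X); y \<in> Ob (fst Y)\<rbrakk>
    \<Longrightarrow> FO (snd (E_TensO S X Y)) (upair x y) = FO (snd X) x \<boxtimes>\<^bsub>S\<^esub> FO (snd Y) y"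
  "\<lbrakk>f \<in> Ar (fst X); g \<in> Ar (fst Y)\<rbrakk>
    \<Longrightarrow> FA (snd (E_TensO S X Y)) (upair f g) = FA (snd X) f \<boxdot>\<^bsub>S\<^esub> FA (snd Y) g"
  by (simp_all add: E_TensO_def)

lemma E_UnitO_simps [simp]:
  "fst (E_UnitO S) = one_cat" "FO (snd (E_UnitO S)) upoint = UnitO S"
  "FA (snd (E_UnitO S)) upoint = Idn S (UnitO S)"
  by (simp_all add: E_UnitO_def)

lemma Assoc_E_simps [simp]:
  fixes S :: "('o, 'a) smc" and X Y Z :: "('u::infinite, 'o, 'a) eobj"
  shows "e_dom (Assoc (E S) X Y Z) = E_TensO S (E_TensO S X Y) Z"
  "e_cod (Assoc (E S) X Y Z) = E_TensO S X (E_TensO S Y Z)"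
  "\<lbrakk>x \<in> Ob (fst X); y \<in> Ob (fst Y); z \<in> Ob (fst Z)\<rbrakk>
    \<Longrightarrow> FO (e_fun (Assoc (E S) X Y Z)) (upair x (upair y z)) = upair (upair x y) z"
  "\<lbrakk>f \<in> Ar (fst X); g \<in> Ar (fst Y); h \<in> Ar (fst Z)\<rbrakk>
    \<Longrightarrow> FA (e_fun (Assoc (E S) X Y Z)) (upair f (upair g h)) = upair (upair f g) h"
  "\<lbrakk>x \<in> Ob (fst X); y \<in> Ob (fst Y); z \<in> Ob (fst Z)\<rbrakk>
    \<Longrightarrow> e_nat (Assoc (E S) X Y Z) (upair x (upair y z)) =
      Assoc S (FO (snd X) x) (FO (snd Y) y) (FO (snd Z) z)"
  "FO (e_fun (Assoc (E S) X Y Z)) \<in> extensional (uprod (Ob (fst X)) (uprod (Ob (fst Y)) (Ob (fst Z))))"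
  "FA (e_fun (Assoc (E S) X Y Z)) \<in> extensional (uprod (Ar (fst X)) (uprod (Ar (fst Y)) (Ar (fst Z))))"
  "e_nat (Assoc (E S) X Y Z) \<in> extensional (uprod (Ob (fst X)) (uprod (Ob (fst Y)) (Ob (fst Z))))"
  by (simp_all add: E_def Let_def)

lemma LUnit_E_simps [simp]:
  "e_dom (LUnit (E S) X) = E_TensO S (E_UnitO S) X"  "e_cod (LUnit (E S) X) = X"
  "x \<in> Ob (fst X) \<Longrightarrow> FO (e_fun (LUnit (E S) X)) x = upair upoint x"
  "f \<in> Ar (fst X) \<Longrightarrow> FA (e_fun (LUnit (E S) X)) f = upair upoint f"
  "x \<in> Ob (fst X) \<Longrightarrow> e_nat (LUnit (E S) X) x = LUnit S (FO (snd X) x)"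
  "FO (e_fun (LUnit (E S) X)) \<in> extensional (Ob (fst X))"
  "FA (e_fun (LUnit (E S) X)) \<in> extensional (Ar (fst X))"
  "e_nat (LUnit (E S) X) \<in> extensional (Ob (fst X))"
  by (simp_all add: E_def)

lemma RUnit_E_simps [simp]:
  "e_dom (RUnit (E S) X) = E_TensO S X (E_UnitO S)"  "e_cod (RUnit (E S) X) = X"
  "x \<in> Ob (fst X) \<Longrightarrow> FO (e_fun (RUnit (E S) X)) x = upair x upoint"
  "f \<in> Ar (fst X) \<Longrightarrow> FA (e_fun (RUnit (E S) X)) f = upair f upoint"
  "x \<in> Ob (fst X) \<Longrightarrow> e_nat (RUnit (E S) X) x = RUnit S (FO (snd X) x)"
  "FO (e_fun (RUnit (E S) X)) \<in> extensional (Ob (fst X))"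
  "FA (e_fun (RUnit (E S) X)) \<in> extensional (Ar (fst X))"
  "e_nat (RUnit (E S) X) \<in> extensional (Ob (fst X))"
  by (simp_all add: E_def)

lemma Symm_E_simps [simp]:
  "e_dom (Symm (E S) X Y) = E_TensO S X Y" "e_cod (Symm (E S) X Y) = E_TensO S Y X"
  "\<lbrakk>x \<in> Ob (fst X); y \<in> Ob (fst Y)\<rbrakk> \<Longrightarrow> FO (e_fun (Symm (E S) X Y)) (upair y x) = upair x y"
  "\<lbrakk>f \<in> Ar (fst X); g \<in> Ar (fst Y)\<rbrakk> \<Longrightarrow> FA (e_fun (Symm (E S) X Y)) (upair g f) = upair f g"
  "\<lbrakk>x \<in> Ob (fst X); y \<in> Ob (fst Y)\<rbrakk>
    \<Longrightarrow> e_nat (Symm (E S) X Y) (upair y x) = Symm S (FO (snd X) x) (FO (snd Y) y)"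
  "FO (e_fun (Symm (E S) X Y)) \<in> extensional (uprod (Ob (fst Y)) (Ob (fst X)))"
  "FA (e_fun (Symm (E S) X Y)) \<in> extensional (uprod (Ar (fst Y)) (Ar (fst X)))"
  "e_nat (Symm (E S) X Y) \<in> extensional (uprod (Ob (fst Y)) (Ob (fst X)))"
  by (simp_all add: E_def Let_def)

section \<open>Arrows of \<open>E S\<close> and the category they form\<close>

context smc_base
begin

lemma E_ObD:
  assumes "X \<in> E_Ob S"
  shows "small_category (fst X)" "category (fst X)" "is_functor (fst X) S (snd X)"
  using assms by (auto simp: E_Ob_def small_category_def)

lemma E_Ob_simps [simp]:
  assumes "X \<in> E_Ob S"
  shows "x \<in> Ob (fst X) \<Longrightarrow> FO (snd X) x \<in> Ob S"
    and "f \<in> Ar (fst X) \<Longrightarrow> FA (snd X) f \<in> Ar S"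
    and "f \<in> Ar (fst X) \<Longrightarrow> Dom S (FA (snd X) f) = FO (snd X) (Dom (fst X) f)"
    and "f \<in> Ar (fst X) \<Longrightarrow> Cod S (FA (snd X) f) = FO (snd X) (Cod (fst X) f)"
    and "x \<in> Ob (fst X) \<Longrightarrow> FA (snd X) (Idn (fst X) x) = Idn S (FO (snd X) x)"
    and "composable (fst X) g f \<Longrightarrow> FA (snd X) (g \<cdot>\<^bsub>fst X\<^esub> f) = FA (snd X) g \<cdot> FA (snd X) f"
  using E_ObD(3) [OF assms] by (simp_all add: is_functor_iff)

lemma E_Ob_cat_simps [simp]:
  assumes "X \<in> E_Ob S"
  shows "f \<in> Ar (fst X) \<Longrightarrow> Dom (fst X) f \<in> Ob (fst X)"
    and "f \<in> Ar (fst X) \<Longrightarrow> Cod (fst X) f \<in> Ob (fst X)"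
    and "x \<in> Ob (fst X) \<Longrightarrow> Idn (fst X) x \<in> Ar (fst X)"
    and "x \<in> Ob (fst X) \<Longrightarrow> Dom (fst X) (Idn (fst X) x) = x"
    and "x \<in> Ob (fst X) \<Longrightarrow> Cod (fst X) (Idn (fst X) x) = x"
    and "composable (fst X) g f \<Longrightarrow> g \<cdot>\<^bsub>fst X\<^esub> f \<in> Ar (fst X)"
    and "composable (fst X) g f \<Longrightarrow> Dom (fst X) (g \<cdot>\<^bsub>fst X\<^esub> f) = Dom (fst X) f"
    and "composable (fst X) g f \<Longrightarrow> Cod (fst X) (g \<cdot>\<^bsub>fst X\<^esub> f) = Cod (fst X) g"
  using E_ObD(2) [OF assms]
  by (simp_all add: category.Ob_Dom_Cod category.Ar_Idn category.Ar_Cmp)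

lemma E_ArI_functor:
  assumes "e_dom f = X" "e_cod f = Y" "X \<in> E_Ob S" "Y \<in> E_Ob S" "is_functor (fst Y) (fst X) (e_fun f)"
    and "e_nat f \<in> extensional (Ob (fst Y))"
    and "\<And>y. y \<in> Ob (fst Y) \<Longrightarrow> e_nat f y \<in> Ar S \<and> Dom S (e_nat f y) = FO (snd X) (FO (e_fun f) y) \<and>
        Cod S (e_nat f y) = FO (snd Y) y"
    and "\<And>h. h \<in> Ar (fst Y) \<Longrightarrow> e_nat f (Cod (fst Y) h) \<cdot> FA (snd X) (FA (e_fun f) h) =
        FA (snd Y) h \<cdot> e_nat f (Dom (fst Y) h)"
  shows "f \<in> E_Ar S"
proof -
  have "nat_trans (fst Y) S (comp_functor (fst Y) (snd X) (e_fun f)) (snd Y) (e_nat f)"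
    using assms(6-8) unfolding nat_trans_iff by simp
  then show ?thesis
    using assms(1-5) unfolding E_Ar_def by simp
qed

lemma E_ArI:
  assumes "e_dom f = X" "e_cod f = Y" "X \<in> E_Ob S" "Y \<in> E_Ob S"
    and "FO (e_fun f) \<in> extensional (Ob (fst Y))" "FA (e_fun f) \<in> extensional (Ar (fst Y))"
      "e_nat f \<in> extensional (Ob (fst Y))"
    and "\<And>y. y \<in> Ob (fst Y) \<Longrightarrow> FO (e_fun f) y \<in> Ob (fst X)"
    and "\<And>h. h \<in> Ar (fst Y) \<Longrightarrow> FA (e_fun f) h \<in> Ar (fst X) \<and>
        Dom (fst X) (FA (e_fun f) h) = FO (e_fun f) (Dom (fst Y) h) \<and>
        Cod (fst X) (FA (e_fun f) h) = FO (e_fun f) (Cod (fst Y) h)"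
    and "\<And>y. y \<in> Ob (fst Y) \<Longrightarrow> FA (e_fun f) (Idn (fst Y) y) = Idn (fst X) (FO (e_fun f) y)"
    and "\<And>k h. \<lbrakk>composable (fst Y) k h; k \<in> Ar (fst Y); h \<in> Ar (fst Y);
          Dom (fst Y) k = Cod (fst Y) h\<rbrakk> \<Longrightarrow>
        FA (e_fun f) (k \<cdot>\<^bsub>fst Y\<^esub> h) = FA (e_fun f) k \<cdot>\<^bsub>fst X\<^esub> FA (e_fun f) h"
    and "\<And>y. y \<in> Ob (fst Y) \<Longrightarrow> e_nat f y \<in> Ar S \<and> Dom S (e_nat f y) = FO (snd X) (FO (e_fun f) y) \<and>
        Cod S (e_nat f y) = FO (snd Y) y"
    and "\<And>h. h \<in> Ar (fst Y) \<Longrightarrow> e_nat f (Cod (fst Y) h) \<cdot> FA (snd X) (FA (e_fun f) h) =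
        FA (snd Y) h \<cdot> e_nat f (Dom (fst Y) h)"
  shows "f \<in> E_Ar S"
proof -
  have "is_functor (fst Y) (fst X) (e_fun f)"
    using assms(5,6,8-11) unfolding is_functor_iff composable_def by blast
  then show ?thesis
    by (rule E_ArI_functor [OF assms(1-4) _ assms(7,12,13)])
qed

lemma E_Ar_simps [simp]:
  assumes "f \<in> E_Ar S"
  shows "e_dom f \<in> E_Ob S" "e_cod f \<in> E_Ob S"
    and "FO (e_fun f) \<in> extensional (Ob (fst (e_cod f)))"
    and "FA (e_fun f) \<in> extensional (Ar (fst (e_cod f)))"
    and "e_nat f \<in> extensional (Ob (fst (e_cod f)))"
    and "y \<in> Ob (fst (e_cod f)) \<Longrightarrow> e_nat f y \<in> Ar S"
    and "y \<in> Ob (fst (e_cod f)) \<Longrightarrow> Dom S (e_nat f y) = FO (snd (e_dom f)) (FO (e_fun f) y)"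
    and "y \<in> Ob (fst (e_cod f)) \<Longrightarrow> Cod S (e_nat f y) = FO (snd (e_cod f)) y"
  using assms unfolding E_Ar_def mem_Collect_eq nat_trans_iff is_functor_iff by (metis functor_simps(3))+

text \<open>The premises \<open>e_dom f = X\<close> and \<open>e_cod f = Y\<close> let these rules
  apply after the domain or codomain has been rewritten to an explicit object.\<close>

lemma E_Ar_functor_simps [simp]:
  assumes "f \<in> E_Ar S"
  shows "\<lbrakk>e_dom f = X; y \<in> Ob (fst (e_cod f))\<rbrakk> \<Longrightarrow> FO (e_fun f) y \<in> Ob (fst X)"
    and "\<lbrakk>e_dom f = X; h \<in> Ar (fst (e_cod f))\<rbrakk> \<Longrightarrow> FA (e_fun f) h \<in> Ar (fst X)"
    and "\<lbrakk>e_dom f = X; h \<in> Ar (fst (e_cod f))\<rbrakk>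
      \<Longrightarrow> Dom (fst X) (FA (e_fun f) h) = FO (e_fun f) (Dom (fst (e_cod f)) h)"
    and "\<lbrakk>e_dom f = X; h \<in> Ar (fst (e_cod f))\<rbrakk>
      \<Longrightarrow> Cod (fst X) (FA (e_fun f) h) = FO (e_fun f) (Cod (fst (e_cod f)) h)"
    and "\<lbrakk>e_cod f = Y; y \<in> Ob (fst Y)\<rbrakk>
      \<Longrightarrow> FA (e_fun f) (Idn (fst Y) y) = Idn (fst (e_dom f)) (FO (e_fun f) y)"
    and "\<lbrakk>e_cod f = Y; composable (fst Y) k h\<rbrakk>
      \<Longrightarrow> FA (e_fun f) (k \<cdot>\<^bsub>fst Y\<^esub> h) = FA (e_fun f) k \<cdot>\<^bsub>fst (e_dom f)\<^esub> FA (e_fun f) h"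
  using assms unfolding E_Ar_def mem_Collect_eq is_functor_iff by metis+

lemma composable_E_fun [simp]:
  assumes "f \<in> E_Ar S" "e_dom f = X" "composable (fst (e_cod f)) k h"
  shows "composable (fst X) (FA (e_fun f) k) (FA (e_fun f) h)"
  using assms by (auto simp: composable_def)

lemma E_Ar_nat:
  assumes "f \<in> E_Ar S" "h \<in> Ar (fst (e_cod f))"
  shows "e_nat f (Cod (fst (e_cod f)) h) \<cdot> FA (snd (e_dom f)) (FA (e_fun f) h) =
    FA (snd (e_cod f)) h \<cdot> e_nat f (Dom (fst (e_cod f)) h)"
  using assms unfolding E_Ar_def nat_trans_iff by simp

lemma E_Ar_eqI:
  assumes f: "f \<in> E_Ar S" and g: "g \<in> E_Ar S" and XY: "e_dom f = e_dom g" "e_cod f = e_cod g"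
    and "\<And>y. y \<in> Ob (fst (e_cod g)) \<Longrightarrow> FO (e_fun f) y = FO (e_fun g) y"
    and "\<And>h. h \<in> Ar (fst (e_cod g)) \<Longrightarrow> FA (e_fun f) h = FA (e_fun g) h"
    and "\<And>y. y \<in> Ob (fst (e_cod g)) \<Longrightarrow> e_nat f y = e_nat g y"
  shows "f = g"
proof (rule earr.equality)
  have "is_functor (fst (e_cod g)) (fst (e_dom g)) (e_fun f)"
    "is_functor (fst (e_cod g)) (fst (e_dom g)) (e_fun g)"
    using f g unfolding E_Ar_def mem_Collect_eq XY by blast+
  then show "e_fun f = e_fun g"
    by (rule functor_eqI) (fact assms(5,6))+
  have "e_nat f \<in> extensional (Ob (fst (e_cod g)))" "e_nat g \<in> extensional (Ob (fst (e_cod g)))"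
    using E_Ar_simps(5) [OF f] E_Ar_simps(5) [OF g] unfolding XY .
  then show "e_nat f = e_nat g"
    by (rule extensionalityI) (fact assms(7))
qed (use XY in simp_all)

lemma E_Ar_eq_iff:
  assumes "f \<in> E_Ar S" "g \<in> E_Ar S" "e_dom f = e_dom g" "e_cod f = e_cod g"
  shows "f = g \<longleftrightarrow> (\<forall>y \<in> Ob (fst (e_cod g)). FO (e_fun f) y = FO (e_fun g) y) \<and>
    (\<forall>h \<in> Ar (fst (e_cod g)). FA (e_fun f) h = FA (e_fun g) h) \<and>
    (\<forall>y \<in> Ob (fst (e_cod g)). e_nat f y = e_nat g y)"
  using E_Ar_eqI [OF assms] by blast

lemma Idn_E:
  assumes "X \<in> E_Ob S"
  shows "Idn (E S) X \<in> E_Ar S"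
  by (rule E_ArI [where X = X and Y = X]) (use assms in simp_all)

lemma Cmp_E:
  assumes f [simp]: "f \<in> E_Ar S" and g [simp]: "g \<in> E_Ar S" and [simp]: "e_dom g = e_cod f"
  shows "g \<cdot>\<^bsub>E S\<^esub> f \<in> E_Ar S"
proof -
  define X Y Z where XYZ: "X = e_dom f" "Y = e_cod f" "Z = e_cod g"
  note [simp] = XYZ [symmetric]
  have [simp]: "X \<in> E_Ob S" "Y \<in> E_Ob S" "Z \<in> E_Ob S"
    using E_Ar_simps(1,2) [OF f] E_Ar_simps(1,2) [OF g] by simp_all
  have comp: "composable (fst Y) (FA (e_fun g) k) (FA (e_fun g) h)" if "composable (fst Z) k h" for k h
    using that by (auto simp: composable_def)
  have nat: "e_nat g (Cod (fst Z) h) \<cdot> e_nat f (FO (e_fun g) (Cod (fst Z) h)) \<cdot>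
        FA (snd X) (FA (e_fun f) (FA (e_fun g) h)) =
      FA (snd Z) h \<cdot> e_nat g (Dom (fst Z) h) \<cdot> e_nat f (FO (e_fun g) (Dom (fst Z) h))"
    if [simp]: "h \<in> Ar (fst Z)" for h
  proof -
    \<comment> \<open>Two naturality squares are pasted: that of \<open>f\<close> at the image of
      \<open>h\<close> under \<open>e_fun g\<close>, and that of \<open>g\<close> at
      \<open>h\<close>.\<close>
    have 1: "e_nat f (FO (e_fun g) (Cod (fst Z) h)) \<cdot> FA (snd X) (FA (e_fun f) (FA (e_fun g) h)) =
        FA (snd Y) (FA (e_fun g) h) \<cdot> e_nat f (FO (e_fun g) (Dom (fst Z) h))"
      using E_Ar_nat [of f "FA (e_fun g) h"] by simp
    have 2: "e_nat g (Cod (fst Z) h) \<cdot> FA (snd Y) (FA (e_fun g) h) = FA (snd Z) h \<cdot> e_nat g (Dom (fst Z) h)"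
      using E_Ar_nat [of g h] by simp
    show ?thesis
      unfolding 1 by (simp flip: Cmp_assoc_simp add: 2)
  qed
  show ?thesis
    by (rule E_ArI [where X = X and Y = Z]) (simp_all add: comp nat)
qed

lemma category_E: "category (E S :: (('u::infinite, 'o, 'a) eobj, ('u, 'o, 'a) earr) smc)"
proof (unfold_locales, goal_cases)
  case (3 X)
  then show ?case
    by (simp add: Hom_def Idn_E)
next
  case (4 f X Y g Z)
  then show ?case
    by (simp add: Hom_def Cmp_E)
next
  case (5 f W X g Y h Z)
  have [simp]: "f \<in> E_Ar S" "e_dom f = W" "e_cod f = X" "g \<in> E_Ar S" "e_dom g = X" "e_cod g = Y"
    "h \<in> E_Ar S" "e_dom h = Y" "e_cod h = Z"
    using 5 by (auto simp: Hom_def)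
  have [simp]: "g \<cdot>\<^bsub>E S\<^esub> f \<in> E_Ar S" "h \<cdot>\<^bsub>E S\<^esub> g \<in> E_Ar S"
    "h \<cdot>\<^bsub>E S\<^esub> g \<cdot>\<^bsub>E S\<^esub> f \<in> E_Ar S" "(h \<cdot>\<^bsub>E S\<^esub> g) \<cdot>\<^bsub>E S\<^esub> f \<in> E_Ar S"
    by (simp_all add: Cmp_E)
  show ?case
    by (rule E_Ar_eqI) simp_all
next
  case (6 f X Y)
  then have [simp]: "f \<in> E_Ar S" "e_dom f = X" "e_cod f = Y"
    by (auto simp: Hom_def)
  then have [simp]: "X \<in> E_Ob S" "f \<cdot>\<^bsub>E S\<^esub> Idn (E S) X \<in> E_Ar S"
    using E_Ar_simps(1,2) [of f] by (simp_all add: Cmp_E Idn_E)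
  show ?case
    by (rule E_Ar_eqI) simp_all
next
  case (7 f X Y)
  then have [simp]: "f \<in> E_Ar S" "e_dom f = X" "e_cod f = Y"
    by (auto simp: Hom_def)
  then have [simp]: "Y \<in> E_Ob S" "Idn (E S) Y \<cdot>\<^bsub>E S\<^esub> f \<in> E_Ar S"
    using E_Ar_simps(1,2) [of f] by (simp_all add: Cmp_E Idn_E)
  show ?case
    by (rule E_Ar_eqI) simp_all
qed simp_all

text \<open>Invertibility splits into a functor inverse to \<open>e_fun f\<close> and invertible
  components. Naturality of the inverse is the square of \<open>f\<close> at \<open>FA K h\<close>,
  with both components moved to the other side. The constraints, the antipode and the isomorphisms
  of Hopf algebras below are all inverted in this way.\<close>

lemma inverse_arrows_E:
  assumes f [simp]: "f \<in> E_Ar S" and [simp]: "e_dom f = X" "e_cod f = Y"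
    and K: "is_functor (fst X) (fst Y) K"
    and K1: "\<And>x. x \<in> Ob (fst X) \<Longrightarrow> FO (e_fun f) (FO K x) = x"
    and K2: "\<And>h. h \<in> Ar (fst X) \<Longrightarrow> FA (e_fun f) (FA K h) = h"
    and K3: "\<And>y. y \<in> Ob (fst Y) \<Longrightarrow> FO K (FO (e_fun f) y) = y"
    and K4: "\<And>h. h \<in> Ar (fst Y) \<Longrightarrow> FA K (FA (e_fun f) h) = h"
    and iso: "\<And>y. y \<in> Ob (fst Y) \<Longrightarrow> iso_arr S (e_nat f y)"
  shows "inverse_arrows (E S) f
    \<lparr>e_dom = Y, e_cod = X, e_fun = K, e_nat = \<lambda>x \<in> Ob (fst X). inv_arr S (e_nat f (FO K x))\<rparr>"
    (is "inverse_arrows _ _ ?g")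
proof -
  have XY [simp]: "X \<in> E_Ob S" "Y \<in> E_Ob S"
    using E_Ar_simps(1,2) [OF f] by simp_all
  note [simp] = K1 K2 K3 K4
  have KO [simp]: "FO K x \<in> Ob (fst Y)" if "x \<in> Ob (fst X)" for x
    using K that unfolding is_functor_iff by blast
  have KA [simp]: "FA K h \<in> Ar (fst Y)" "Dom (fst Y) (FA K h) = FO K (Dom (fst X) h)"
      "Cod (fst Y) (FA K h) = FO K (Cod (fst X) h)" if "h \<in> Ar (fst X)" for h
    using K that unfolding is_functor_iff by blast+
  have inv: "inverse_arrows S (e_nat f y) (inv_arr S (e_nat f y))" if "y \<in> Ob (fst Y)" for y
    using iso [OF that] by (rule inverse_arrows_inv_arr)
  have inv_simps [simp]: "inv_arr S (e_nat f y) \<in> Ar S" "Dom S (inv_arr S (e_nat f y)) = FO (snd Y) y"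
      "Cod S (inv_arr S (e_nat f y)) = FO (snd X) (FO (e_fun f) y)"
      "inv_arr S (e_nat f y) \<cdot> e_nat f y = Idn S (FO (snd X) (FO (e_fun f) y))"
      "e_nat f y \<cdot> inv_arr S (e_nat f y) = Idn S (FO (snd Y) y)" if "y \<in> Ob (fst Y)" for y
    using inverse_arrowsD [OF inv [OF that]] that by simp_all
  have nat: "inv_arr S (e_nat f (FO K (Cod (fst X) h))) \<cdot> FA (snd Y) (FA K h) =
      FA (snd X) h \<cdot> inv_arr S (e_nat f (FO K (Dom (fst X) h)))" if h [simp]: "h \<in> Ar (fst X)" for h
  proof -
    let ?d = "FO K (Dom (fst X) h)" and ?c = "FO K (Cod (fst X) h)"
    have "e_nat f ?c \<cdot> FA (snd X) h = FA (snd Y) (FA K h) \<cdot> e_nat f ?d"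
      using E_Ar_nat [OF f, of "FA K h"] by simp
    then have "inv_arr S (e_nat f ?c) \<cdot> (e_nat f ?c \<cdot> FA (snd X) h) \<cdot> inv_arr S (e_nat f ?d) =
        inv_arr S (e_nat f ?c) \<cdot> (FA (snd Y) (FA K h) \<cdot> e_nat f ?d) \<cdot> inv_arr S (e_nat f ?d)"
      by simp
    then show ?thesis
      using inverse_arrows_Cmp_cancel(1) [OF inv, of ?c "FA (snd X) h \<cdot> inv_arr S (e_nat f ?d)"] by simp
  qed
  have g [simp]: "?g \<in> E_Ar S"
    by (rule E_ArI [where X = Y and Y = X])
      (use K nat in \<open>simp_all add: is_functor_iff\<close>)
  have "?g \<cdot>\<^bsub>E S\<^esub> f = Idn (E S) X"
    by (rule E_Ar_eqI) (simp_all add: Cmp_E Idn_E)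
  moreover have "f \<cdot>\<^bsub>E S\<^esub> ?g = Idn (E S) Y"
    by (rule E_Ar_eqI) (simp_all add: Cmp_E Idn_E)
  ultimately show ?thesis
    by (simp add: inverse_arrows_def Hom_def)
qed

section \<open>Tensor product and constraints of \<open>E S\<close>\<close>

lemma E_TensO_Ob [simp]:
  assumes [simp]: "X \<in> E_Ob S" "Y \<in> E_Ob S"
  shows "E_TensO S X Y \<in> E_Ob S"
proof -
  have "FA (snd (E_TensO S X Y)) (k \<cdot>\<^bsub>prod_cat (fst X) (fst Y)\<^esub> h) =
      FA (snd (E_TensO S X Y)) k \<cdot> FA (snd (E_TensO S X Y)) h"
    if "composable (prod_cat (fst X) (fst Y)) k h" for k h
  proof -
    obtain g g' f f' where [simp]: "k = upair g g'" "h = upair f f'"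
      and c [simp]: "composable (fst X) g f" "composable (fst Y) g' f'"
      using \<open>composable _ k h\<close> by (rule composable_prod_catE)
    have [simp]: "g \<in> Ar (fst X)" "f \<in> Ar (fst X)" "g' \<in> Ar (fst Y)" "f' \<in> Ar (fst Y)"
      "Dom (fst X) g = Cod (fst X) f" "Dom (fst Y) g' = Cod (fst Y) f'"
      using c by (auto simp: composable_def)
    show ?thesis
      by simp
  qed
  moreover have "FO (snd (E_TensO S X Y)) \<in> extensional (uprod (Ob (fst X)) (Ob (fst Y)))"
    "FA (snd (E_TensO S X Y)) \<in> extensional (uprod (Ar (fst X)) (Ar (fst Y)))"
    by (simp_all add: E_TensO_def)
  ultimately have "is_functor (prod_cat (fst X) (fst Y)) S (snd (E_TensO S X Y))"
    unfolding is_functor_iff by simp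
  moreover have "small_category (prod_cat (fst X) (fst Y))"
    by (intro small_category_prod_cat E_ObD assms)
  ultimately show ?thesis
    by (auto simp: E_Ob_def split: prod.split) (metis E_TensO_simps(1) fst_conv snd_conv)+
qed

lemma E_UnitO_Ob [simp]: "E_UnitO S \<in> E_Ob S"
  using small_category_one_cat by (auto simp: E_Ob_def E_UnitO_def is_functor_iff composable_def)

lemma TensA_E:
  assumes f [simp]: "f \<in> E_Ar S" and g [simp]: "g \<in> E_Ar S"
  shows "f \<boxdot>\<^bsub>E S\<^esub> g \<in> E_Ar S"
proof (rule E_ArI [OF TensA_E_simps(1,2)])
  fix h assume "h \<in> Ar (fst (E_TensO S (e_cod f) (e_cod g)))"
  then obtain a b where [simp]: "h = upair a b" "a \<in> Ar (fst (e_cod f))" "b \<in> Ar (fst (e_cod g))"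
    by (auto elim: uprodE)
  show "e_nat (f \<boxdot>\<^bsub>E S\<^esub> g) (Cod (fst (E_TensO S (e_cod f) (e_cod g))) h) \<cdot>
      FA (snd (E_TensO S (e_dom f) (e_dom g))) (FA (e_fun (f \<boxdot>\<^bsub>E S\<^esub> g)) h) =
      FA (snd (E_TensO S (e_cod f) (e_cod g))) h \<cdot>
      e_nat (f \<boxdot>\<^bsub>E S\<^esub> g) (Dom (fst (E_TensO S (e_cod f) (e_cod g))) h)"
    using E_Ar_nat [OF f, of a] E_Ar_nat [OF g, of b] by simp
next
  fix k h assume "composable (fst (E_TensO S (e_cod f) (e_cod g))) k h"
  then show "FA (e_fun (f \<boxdot>\<^bsub>E S\<^esub> g)) (k \<cdot>\<^bsub>fst (E_TensO S (e_cod f) (e_cod g))\<^esub> h) =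
      FA (e_fun (f \<boxdot>\<^bsub>E S\<^esub> g)) k \<cdot>\<^bsub>fst (E_TensO S (e_dom f) (e_dom g))\<^esub> FA (e_fun (f \<boxdot>\<^bsub>E S\<^esub> g)) h"
    by (auto elim!: composable_prod_catE)
qed (auto elim!: uprodE)

lemma Assoc_E:
  assumes [simp]: "X \<in> E_Ob S" "Y \<in> E_Ob S" "Z \<in> E_Ob S"
  shows "Assoc (E S) X Y Z \<in> E_Ar S"
proof (rule E_ArI [OF Assoc_E_simps(1,2)])
  fix h assume "h \<in> Ar (fst (E_TensO S X (E_TensO S Y Z)))"
  then obtain a b c where [simp]: "h = upair a (upair b c)" "a \<in> Ar (fst X)" "b \<in> Ar (fst Y)" "c \<in> Ar (fst Z)"
    by (auto elim!: uprodE)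
  show "e_nat (Assoc (E S) X Y Z) (Cod (fst (E_TensO S X (E_TensO S Y Z))) h) \<cdot>
      FA (snd (E_TensO S (E_TensO S X Y) Z)) (FA (e_fun (Assoc (E S) X Y Z)) h) =
      FA (snd (E_TensO S X (E_TensO S Y Z))) h \<cdot>
      e_nat (Assoc (E S) X Y Z) (Dom (fst (E_TensO S X (E_TensO S Y Z))) h)"
    using Assoc_nat [of "FA (snd X) a" "FA (snd Y) b" "FA (snd Z) c"] by simp
next
  fix k h assume "composable (fst (E_TensO S X (E_TensO S Y Z))) k h"
  then show "FA (e_fun (Assoc (E S) X Y Z)) (k \<cdot>\<^bsub>fst (E_TensO S X (E_TensO S Y Z))\<^esub> h) =
      FA (e_fun (Assoc (E S) X Y Z)) k \<cdot>\<^bsub>fst (E_TensO S (E_TensO S X Y) Z)\<^esub> FA (e_fun (Assoc (E S) X Y Z)) h"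
    by (auto elim!: composable_prod_catE)
qed (auto elim!: uprodE)

lemma LUnit_E:
  assumes [simp]: "X \<in> E_Ob S"
  shows "LUnit (E S) X \<in> E_Ar S"
proof (rule E_ArI [OF LUnit_E_simps(1,2)])
  fix h assume h [simp]: "h \<in> Ar (fst X)"
  show "e_nat (LUnit (E S) X) (Cod (fst X) h) \<cdot>
      FA (snd (E_TensO S (E_UnitO S) X)) (FA (e_fun (LUnit (E S) X)) h) =
      FA (snd X) h \<cdot> e_nat (LUnit (E S) X) (Dom (fst X) h)"
    using LUnit_nat [of "FA (snd X) h"] by simp
qed (auto simp: composable_def)

lemma RUnit_E:
  assumes [simp]: "X \<in> E_Ob S"
  shows "RUnit (E S) X \<in> E_Ar S"
proof (rule E_ArI [OF RUnit_E_simps(1,2)])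
  fix h assume h [simp]: "h \<in> Ar (fst X)"
  show "e_nat (RUnit (E S) X) (Cod (fst X) h) \<cdot>
      FA (snd (E_TensO S X (E_UnitO S))) (FA (e_fun (RUnit (E S) X)) h) =
      FA (snd X) h \<cdot> e_nat (RUnit (E S) X) (Dom (fst X) h)"
    using RUnit_nat [of "FA (snd X) h"] by simp
qed (auto simp: composable_def)

lemma Symm_E:
  assumes [simp]: "X \<in> E_Ob S" "Y \<in> E_Ob S"
  shows "Symm (E S) X Y \<in> E_Ar S"
proof (rule E_ArI [OF Symm_E_simps(1,2)])
  fix h assume "h \<in> Ar (fst (E_TensO S Y X))"
  then obtain a b where [simp]: "h = upair a b" "a \<in> Ar (fst Y)" "b \<in> Ar (fst X)"
    by (auto elim!: uprodE)
  show "e_nat (Symm (E S) X Y) (Cod (fst (E_TensO S Y X)) h) \<cdot>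
      FA (snd (E_TensO S X Y)) (FA (e_fun (Symm (E S) X Y)) h) =
      FA (snd (E_TensO S Y X)) h \<cdot> e_nat (Symm (E S) X Y) (Dom (fst (E_TensO S Y X)) h)"
    using Symm_nat [of "FA (snd X) b" "FA (snd Y) a"] by simp
next
  fix k h assume "composable (fst (E_TensO S Y X)) k h"
  then show "FA (e_fun (Symm (E S) X Y)) (k \<cdot>\<^bsub>fst (E_TensO S Y X)\<^esub> h) =
      FA (e_fun (Symm (E S) X Y)) k \<cdot>\<^bsub>fst (E_TensO S X Y)\<^esub> FA (e_fun (Symm (E S) X Y)) h"
    by (auto elim!: composable_prod_catE)
qed (auto elim!: uprodE)

text \<open>The inverse is made explicit because \<open>middle_four\<close> contains it and its
  components must be known later. For the same reason the inverse of \<open>LUnit\<close>, which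
  occurs in \<open>tens_unit\<close>, is written out below.\<close>

lemma inverse_Assoc_E:
  assumes [simp]: "X \<in> E_Ob S" "Y \<in> E_Ob S" "Z \<in> E_Ob S"
  defines "r \<equiv> \<lambda>z. upair (ufst (ufst z)) (upair (usnd (ufst z)) (usnd z))"
  defines "K \<equiv> \<lparr>FO = restrict r (uprod (uprod (Ob (fst X)) (Ob (fst Y))) (Ob (fst Z))),
    FA = restrict r (uprod (uprod (Ar (fst X)) (Ar (fst Y))) (Ar (fst Z)))\<rparr>"
  shows "inverse_arrows (E S) (Assoc (E S) X Y Z)
    \<lparr>e_dom = E_TensO S X (E_TensO S Y Z), e_cod = E_TensO S (E_TensO S X Y) Z, e_fun = K,
     e_nat = \<lambda>z \<in> Ob (fst (E_TensO S (E_TensO S X Y) Z)). inv_arr S (e_nat (Assoc (E S) X Y Z) (FO K z))\<rparr>"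
proof (rule inverse_arrows_E [OF Assoc_E Assoc_E_simps(1,2)])
  have "composable (prod_cat (prod_cat (fst X) (fst Y)) (fst Z)) k h \<Longrightarrow>
      FA K (k \<cdot>\<^bsub>prod_cat (prod_cat (fst X) (fst Y)) (fst Z)\<^esub> h) =
      FA K k \<cdot>\<^bsub>prod_cat (fst X) (prod_cat (fst Y) (fst Z))\<^esub> FA K h" for k h
    by (auto simp: K_def r_def elim!: composable_prod_catE)
  then show "is_functor (fst (E_TensO S (E_TensO S X Y) Z)) (fst (E_TensO S X (E_TensO S Y Z))) K"
    unfolding is_functor_iff by (auto simp: K_def r_def elim!: uprodE)
qed (auto simp: K_def r_def elim!: uprodE intro!: Assoc_iso)

lemma inverse_LUnit_E:
  assumes [simp]: "X \<in> E_Ob S"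
  defines "K \<equiv> \<lparr>FO = restrict usnd (uprod {upoint} (Ob (fst X))), FA = restrict usnd (uprod {upoint} (Ar (fst X)))\<rparr>"
  shows "inverse_arrows (E S) (LUnit (E S) X)
    \<lparr>e_dom = X, e_cod = E_TensO S (E_UnitO S) X, e_fun = K,
     e_nat = \<lambda>z \<in> Ob (fst (E_TensO S (E_UnitO S) X)). inv_arr S (e_nat (LUnit (E S) X) (FO K z))\<rparr>"
proof (rule inverse_arrows_E [OF LUnit_E LUnit_E_simps(1,2)])
  have "composable (prod_cat one_cat (fst X)) k h \<Longrightarrow>
      FA K (k \<cdot>\<^bsub>prod_cat one_cat (fst X)\<^esub> h) = FA K k \<cdot>\<^bsub>fst X\<^esub> FA K h" for k h
    by (auto simp: K_def elim!: composable_prod_catE)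
  then show "is_functor (fst (E_TensO S (E_UnitO S) X)) (fst X) K"
    unfolding is_functor_iff by (auto simp: K_def elim!: uprodE)
qed (auto simp: K_def elim!: uprodE intro!: LUnit_iso)

lemma iso_RUnit_E:
  assumes [simp]: "X \<in> E_Ob S"
  shows "iso_arr (E S) (RUnit (E S) X)"
proof -
  define K where "K = \<lparr>FO = restrict ufst (uprod (Ob (fst X)) {upoint}),
    FA = restrict ufst (uprod (Ar (fst X)) {upoint})\<rparr>"
  have "composable (prod_cat (fst X) one_cat) k h \<Longrightarrow>
      FA K (k \<cdot>\<^bsub>prod_cat (fst X) one_cat\<^esub> h) = FA K k \<cdot>\<^bsub>fst X\<^esub> FA K h" for k h
    by (auto simp: K_def elim!: composable_prod_catE)
  then have "is_functor (fst (E_TensO S X (E_UnitO S))) (fst X) K"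
    unfolding is_functor_iff by (auto simp: K_def elim!: uprodE)
  then show ?thesis
    unfolding iso_arr_def
    by (intro exI) (rule inverse_arrows_E [OF RUnit_E RUnit_E_simps(1,2)],
      auto simp: K_def elim!: uprodE intro!: RUnit_iso)
qed

lemma e_nat_inv_Assoc:
  assumes [simp]: "X \<in> E_Ob S" "Y \<in> E_Ob S" "Z \<in> E_Ob S"
  shows "e_dom (inv_arr (E S) (Assoc (E S) X Y Z)) = E_TensO S X (E_TensO S Y Z)"
    "e_cod (inv_arr (E S) (Assoc (E S) X Y Z)) = E_TensO S (E_TensO S X Y) Z"
    "\<lbrakk>x \<in> Ob (fst X); y \<in> Ob (fst Y); z \<in> Ob (fst Z)\<rbrakk> \<Longrightarrow>
      FO (e_fun (inv_arr (E S) (Assoc (E S) X Y Z))) (upair (upair x y) z) = upair x (upair y z)"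
    "\<lbrakk>f \<in> Ar (fst X); g \<in> Ar (fst Y); h \<in> Ar (fst Z)\<rbrakk> \<Longrightarrow>
      FA (e_fun (inv_arr (E S) (Assoc (E S) X Y Z))) (upair (upair f g) h) = upair f (upair g h)"
    "\<lbrakk>x \<in> Ob (fst X); y \<in> Ob (fst Y); z \<in> Ob (fst Z)\<rbrakk> \<Longrightarrow>
      e_nat (inv_arr (E S) (Assoc (E S) X Y Z)) (upair (upair x y) z) =
        inv_arr S (Assoc S (FO (snd X) x) (FO (snd Y) y) (FO (snd Z) z))"
  by (simp_all add: category.inv_arr_eqI [OF category_E inverse_Assoc_E])

lemma e_nat_inv_LUnit:
  assumes [simp]: "X \<in> E_Ob S"
  shows "e_dom (inv_arr (E S) (LUnit (E S) X)) = X"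
    "e_cod (inv_arr (E S) (LUnit (E S) X)) = E_TensO S (E_UnitO S) X"
    "x \<in> Ob (fst X) \<Longrightarrow> FO (e_fun (inv_arr (E S) (LUnit (E S) X))) (upair upoint x) = x"
    "f \<in> Ar (fst X) \<Longrightarrow> FA (e_fun (inv_arr (E S) (LUnit (E S) X))) (upair upoint f) = f"
    "x \<in> Ob (fst X) \<Longrightarrow>
      e_nat (inv_arr (E S) (LUnit (E S) X)) (upair upoint x) = inv_arr S (LUnit S (FO (snd X) x))"
  by (simp_all add: category.inv_arr_eqI [OF category_E inverse_LUnit_E])

text \<open>For the equational axioms the functors are a bookkeeping of nested pairs, while each
  component is an instance of the corresponding axiom of \<open>S\<close>.\<close>

lemma symmetric_monoidal_category_E:
  "symmetric_monoidal_category (E S :: (('u::infinite, 'o, 'a) eobj, ('u, 'o, 'a) earr) smc)"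
proof -
  interpret E: category "E S :: (('u, 'o, 'a) eobj, ('u, 'o, 'a) earr) smc"
    by (rule category_E)
  note [simp] = Cmp_E Idn_E TensA_E Assoc_E LUnit_E RUnit_E Symm_E
  show ?thesis
  proof (unfold_locales, goal_cases)
    case (1 X Y)
    then show ?case by simp
  next
    case (2 f X X' g Y Y')
    then show ?case by (simp add: Hom_def)
  next
    case (3 X Y)
    then have [simp]: "X \<in> E_Ob S" "Y \<in> E_Ob S" by simp_all
    show ?case
      by (rule E_Ar_eqI) (auto elim!: uprodE)
  next
    case (4 f X X' f' X'' g Y Y' g' Y'')
    then have [simp]: "f \<in> E_Ar S" "e_dom f = X" "e_cod f = X'" "f' \<in> E_Ar S" "e_dom f' = X'" "e_cod f' = X''"
      "g \<in> E_Ar S" "e_dom g = Y" "e_cod g = Y'" "g' \<in> E_Ar S" "e_dom g' = Y'" "e_cod g' = Y''"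
      by (simp_all add: Hom_def)
    show ?case
      by (rule E_Ar_eqI) (auto elim!: uprodE)
  next
    case 5
    show ?case by simp
  next
    case (6 X Y Z)
    then show ?case by (simp add: Hom_def)
  next
    case (7 X Y Z)
    then show ?case
      using inverse_Assoc_E [of X Y Z] by (auto simp: iso_arr_def)
  next
    case (8 f X X' g Y Y' h Z Z')
    then have [simp]: "f \<in> E_Ar S" "e_dom f = X" "e_cod f = X'" "g \<in> E_Ar S" "e_dom g = Y" "e_cod g = Y'"
      "h \<in> E_Ar S" "e_dom h = Z" "e_cod h = Z'"
      by (simp_all add: Hom_def)
    have [simp]: "X \<in> E_Ob S" "X' \<in> E_Ob S" "Y \<in> E_Ob S" "Y' \<in> E_Ob S" "Z \<in> E_Ob S" "Z' \<in> E_Ob S"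
      using E_Ar_simps(1,2) [of f] E_Ar_simps(1,2) [of g] E_Ar_simps(1,2) [of h] by simp_all
    have "Assoc S (FO (snd X') x) (FO (snd Y') y) (FO (snd Z') z) \<cdot> ((e_nat f x \<boxdot> e_nat g y) \<boxdot> e_nat h z) =
        (e_nat f x \<boxdot> (e_nat g y \<boxdot> e_nat h z)) \<cdot> Assoc S (FO (snd X) (FO (e_fun f) x))
          (FO (snd Y) (FO (e_fun g) y)) (FO (snd Z) (FO (e_fun h) z))"
      if "x \<in> Ob (fst X')" "y \<in> Ob (fst Y')" "z \<in> Ob (fst Z')" for x y z
      using Assoc_nat [of "e_nat f x" "e_nat g y" "e_nat h z"] that by simp
    then show ?case
      by (intro E_Ar_eqI) (auto elim!: uprodE)
  next
    case (9 X)
    then show ?case by (simp add: Hom_def)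
  next
    case (10 X)
    then show ?case
      using inverse_LUnit_E [of X] by (auto simp: iso_arr_def)
  next
    case (11 f X X')
    then have [simp]: "f \<in> E_Ar S" "e_dom f = X" "e_cod f = X'"
      by (simp_all add: Hom_def)
    have [simp]: "X \<in> E_Ob S" "X' \<in> E_Ob S"
      using E_Ar_simps(1,2) [of f] by simp_all
    have "LUnit S (FO (snd X') x) \<cdot> (Idn S (UnitO S) \<boxdot> e_nat f x) =
        e_nat f x \<cdot> LUnit S (FO (snd X) (FO (e_fun f) x))" if "x \<in> Ob (fst X')" for x
      using LUnit_nat [of "e_nat f x"] that by simp
    then show ?case
      by (intro E_Ar_eqI) auto
  next
    case (12 X)
    then show ?case by (simp add: Hom_def)
  next
    case (13 X)
    then show ?case by (simp add: iso_RUnit_E)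
  next
    case (14 f X X')
    then have [simp]: "f \<in> E_Ar S" "e_dom f = X" "e_cod f = X'"
      by (simp_all add: Hom_def)
    have [simp]: "X \<in> E_Ob S" "X' \<in> E_Ob S"
      using E_Ar_simps(1,2) [of f] by simp_all
    have "RUnit S (FO (snd X') x) \<cdot> (e_nat f x \<boxdot> Idn S (UnitO S)) =
        e_nat f x \<cdot> RUnit S (FO (snd X) (FO (e_fun f) x))" if "x \<in> Ob (fst X')" for x
      using RUnit_nat [of "e_nat f x"] that by simp
    then show ?case
      by (intro E_Ar_eqI) auto
  next
    case (15 X Y)
    then show ?case by (simp add: Hom_def)
  next
    case (16 f X X' g Y Y')
    then have [simp]: "f \<in> E_Ar S" "e_dom f = X" "e_cod f = X'" "g \<in> E_Ar S" "e_dom g = Y" "e_cod g = Y'"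
      by (simp_all add: Hom_def)
    have [simp]: "X \<in> E_Ob S" "X' \<in> E_Ob S" "Y \<in> E_Ob S" "Y' \<in> E_Ob S"
      using E_Ar_simps(1,2) [of f] E_Ar_simps(1,2) [of g] by simp_all
    have "Symm S (FO (snd X') x) (FO (snd Y') y) \<cdot> (e_nat f x \<boxdot> e_nat g y) =
        (e_nat g y \<boxdot> e_nat f x) \<cdot> Symm S (FO (snd X) (FO (e_fun f) x)) (FO (snd Y) (FO (e_fun g) y))"
      if "x \<in> Ob (fst X')" "y \<in> Ob (fst Y')" for x y
      using Symm_nat [of "e_nat f x" "e_nat g y"] that by simp
    then show ?case
      by (intro E_Ar_eqI) (auto elim!: uprodE)
  next
    case (17 X Y)
    then have [simp]: "X \<in> E_Ob S" "Y \<in> E_Ob S" by simp_all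
    show ?case
      by (rule E_Ar_eqI) (auto elim!: uprodE simp: Symm_Symm)
  next
    case (18 W X Y Z)
    then have [simp]: "W \<in> E_Ob S" "X \<in> E_Ob S" "Y \<in> E_Ob S" "Z \<in> E_Ob S" by simp_all
    show ?case
      by (rule E_Ar_eqI) (auto elim!: uprodE simp: pentagon)
  next
    case (19 X Y)
    then have [simp]: "X \<in> E_Ob S" "Y \<in> E_Ob S" by simp_all
    show ?case
      by (rule E_Ar_eqI) (auto elim!: uprodE simp: triangle)
  next
    case (20 X Y Z)
    then have [simp]: "X \<in> E_Ob S" "Y \<in> E_Ob S" "Z \<in> E_Ob S" by simp_all
    show ?case
      by (rule E_Ar_eqI) (auto elim!: uprodE simp: hexagon)
  qed
qed

end

section \<open>Hopf algebras of functors, pointwise\<close>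

text \<open>The part of \<open>coalgebra_obj\<close> that lives in small categories, written on
  elements. Functoriality of \<open>m\<close> and \<open>u\<close> is supplied by their being the
  functors of arrows of \<open>E S\<close>. The next definition plays the same role for the
  antipode.\<close>

definition functor_monoid :: "'u::infinite scat \<Rightarrow> 'u sfun \<Rightarrow> 'u sfun \<Rightarrow> bool" where
  "functor_monoid C m u \<longleftrightarrow>
     (\<forall>x \<in> Ob C. \<forall>y \<in> Ob C. \<forall>z \<in> Ob C.
        FO m (upair (FO m (upair x y)) z) = FO m (upair x (FO m (upair y z)))) \<and>
     (\<forall>f \<in> Ar C. \<forall>g \<in> Ar C. \<forall>h \<in> Ar C.
        FA m (upair (FA m (upair f g)) h) = FA m (upair f (FA m (upair g h)))) \<and>
     (\<forall>x \<in> Ob C. FO m (upair (FO u upoint) x) = x \<and> FO m (upair x (FO u upoint)) = x) \<and>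
     (\<forall>f \<in> Ar C. FA m (upair (FA u upoint) f) = f \<and> FA m (upair f (FA u upoint)) = f)"

definition functor_inverse :: "'u::infinite scat \<Rightarrow> 'u sfun \<Rightarrow> 'u sfun \<Rightarrow> 'u sfun \<Rightarrow> bool" where
  "functor_inverse C m u i \<longleftrightarrow>
     (\<forall>x \<in> Ob C. FO m (upair (FO i x) x) = FO u upoint \<and> FO m (upair x (FO i x)) = FO u upoint) \<and>
     (\<forall>f \<in> Ar C. FA m (upair (FA i f) f) = FA u upoint \<and> FA m (upair f (FA i f)) = FA u upoint)"

context smc_base
begin

lemma inv_constraint_E:
  assumes "X \<in> E_Ob S"
  shows "inv_arr (E S) (LUnit (E S) X) \<in> E_Ar S"
    "\<lbrakk>Y \<in> E_Ob S; Z \<in> E_Ob S\<rbrakk> \<Longrightarrow> inv_arr (E S) (Assoc (E S) X Y Z) \<in> E_Ar S"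
  using assms symmetric_monoidal_category.Ar_inv_constraint [OF symmetric_monoidal_category_E]
  by simp_all

lemmas E_arrows = Cmp_E Idn_E TensA_E Assoc_E LUnit_E RUnit_E Symm_E inv_constraint_E
lemmas E_inv_simps = e_nat_inv_Assoc e_nat_inv_LUnit

text \<open>The functor of \<open>f\<close> moves objects, so the component of \<open>g\<close> that
  inverts the one of \<open>f\<close> at \<open>y\<close> sits at the image of
  \<open>y\<close>.\<close>

lemma iso_arr_E_imp_iso_arr:
  assumes g: "inverse_arrows (E S) f g" and y [simp]: "y \<in> Ob (fst (e_cod f))"
  shows "inverse_arrows S (e_nat f y) (e_nat g (FO (e_fun f) y))"
    "FO (e_fun g) (FO (e_fun f) y) = y"
proof -
  have [simp]: "f \<in> E_Ar S" "g \<in> E_Ar S" "e_dom g = e_cod f" "e_cod g = e_dom f"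
    and gf: "g \<cdot>\<^bsub>E S\<^esub> f = Idn (E S) (e_dom f)" and fg: "f \<cdot>\<^bsub>E S\<^esub> g = Idn (E S) (e_cod f)"
    using category.inverse_arrowsD [OF category_E g] by simp_all
  show [simp]: "FO (e_fun g) (FO (e_fun f) y) = y"
    using arg_cong [OF fg, of "\<lambda>h. FO (e_fun h) y"] by simp
  have "e_nat f y \<cdot> e_nat g (FO (e_fun f) y) = Idn S (FO (snd (e_cod f)) y)"
    using arg_cong [OF fg, of "\<lambda>h. e_nat h y"] by simp
  moreover have "e_nat g (FO (e_fun f) y) \<cdot> e_nat f y = Idn S (FO (snd (e_dom f)) (FO (e_fun f) y))"
    using arg_cong [OF gf, of "\<lambda>h. e_nat h (FO (e_fun f) y)"] by simp
  ultimately show "inverse_arrows S (e_nat f y) (e_nat g (FO (e_fun f) y))"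
    by (simp add: inverse_arrows_def Hom_def)
qed

section \<open>The Hopf algebra axioms of \<open>E S\<close>, degree by degree\<close>

context
  fixes X :: "('u::infinite, 'o, 'a) eobj" and p q d e :: "('u, 'o, 'a) earr"
  assumes X [simp]: "X \<in> E_Ob S"
    and p [simp]: "p \<in> E_Ar S" "e_dom p = E_TensO S X X" "e_cod p = X"
    and q [simp]: "q \<in> E_Ar S" "e_dom q = E_UnitO S" "e_cod q = X"
begin

lemma e_fun_unit:
  "x \<in> Ob (fst X) \<Longrightarrow> FO (e_fun q) x = upoint"
  "f \<in> Ar (fst X) \<Longrightarrow> FA (e_fun q) f = upoint"
  using E_Ar_functor_simps(1,2) [of q "E_UnitO S"] by simp_all

text \<open>In a cartesian category a counital coproduct is the diagonal. The functor under the unit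
  goes to \<open>one_cat\<close>, so the left unit law fixes the second coordinate of
  \<open>e_fun p\<close> and the right unit law the first.\<close>

lemma e_fun_mult_eq_diagonal:
  assumes "algebra_obj (E S) X p q"
  shows "x \<in> Ob (fst X) \<Longrightarrow> FO (e_fun p) x = upair x x"
    "f \<in> Ar (fst X) \<Longrightarrow> FA (e_fun p) f = upair f f"
proof -
  have l: "p \<cdot>\<^bsub>E S\<^esub> (q \<boxdot>\<^bsub>E S\<^esub> Idn (E S) X) = LUnit (E S) X"
    and r: "p \<cdot>\<^bsub>E S\<^esub> (Idn (E S) X \<boxdot>\<^bsub>E S\<^esub> q) = RUnit (E S) X"
    using assms by (simp_all add: algebra_obj_def)
  note [simp] = e_fun_unit
  show "FO (e_fun p) x = upair x x" if [simp]: "x \<in> Ob (fst X)"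
  proof -
    have "FO (e_fun p) x \<in> uprod (Ob (fst X)) (Ob (fst X))"
      using E_Ar_functor_simps(1) [of p "E_TensO S X X" x] by simp
    then obtain a b where ab [simp]: "FO (e_fun p) x = upair a b" "a \<in> Ob (fst X)" "b \<in> Ob (fst X)"
      by (rule uprodE)
    show ?thesis
      using arg_cong [OF l, of "\<lambda>h. FO (e_fun h) x"] arg_cong [OF r, of "\<lambda>h. FO (e_fun h) x"] by simp
  qed
  show "FA (e_fun p) f = upair f f" if [simp]: "f \<in> Ar (fst X)"
  proof -
    have "FA (e_fun p) f \<in> uprod (Ar (fst X)) (Ar (fst X))"
      using E_Ar_functor_simps(2) [of p "E_TensO S X X" f] by simp
    then obtain a b where ab [simp]: "FA (e_fun p) f = upair a b" "a \<in> Ar (fst X)" "b \<in> Ar (fst X)"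
      by (rule uprodE)
    show ?thesis
      using arg_cong [OF l, of "\<lambda>h. FA (e_fun h) f"] arg_cong [OF r, of "\<lambda>h. FA (e_fun h) f"] by simp
  qed
qed

context
  notes [simp] = e_fun_unit
  assumes diag [simp]: "\<And>x. x \<in> Ob (fst X) \<Longrightarrow> FO (e_fun p) x = upair x x"
      "\<And>f. f \<in> Ar (fst X) \<Longrightarrow> FA (e_fun p) f = upair f f"
begin

text \<open>Over the diagonal both sides of each algebra axiom have the same functor, and only
  components remain. The diagonal is an assumption of this context because it holds by definition
  for \<open>assoc_hopf\<close> and by the unit laws for a given Hopf algebra.\<close>

lemma algebra_obj_E_iff:
  "algebra_obj (E S) X p q \<longleftrightarrow>
     (\<forall>x \<in> Ob (fst X). algebra_obj S (FO (snd X) x) (e_nat p x) (e_nat q x))"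
proof -
  have "p \<cdot>\<^bsub>E S\<^esub> (p \<boxdot>\<^bsub>E S\<^esub> Idn (E S) X) = p \<cdot>\<^bsub>E S\<^esub> (Idn (E S) X \<boxdot>\<^bsub>E S\<^esub> p) \<cdot>\<^bsub>E S\<^esub> Assoc (E S) X X X \<longleftrightarrow>
    (\<forall>x \<in> Ob (fst X). e_nat p x \<cdot> (e_nat p x \<boxdot> Idn S (FO (snd X) x)) =
      e_nat p x \<cdot> (Idn S (FO (snd X) x) \<boxdot> e_nat p x) \<cdot> Assoc S (FO (snd X) x) (FO (snd X) x) (FO (snd X) x))"
    by (subst E_Ar_eq_iff) (simp_all add: E_arrows)
  moreover have "p \<cdot>\<^bsub>E S\<^esub> (q \<boxdot>\<^bsub>E S\<^esub> Idn (E S) X) = LUnit (E S) X \<longleftrightarrow>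
    (\<forall>x \<in> Ob (fst X). e_nat p x \<cdot> (e_nat q x \<boxdot> Idn S (FO (snd X) x)) = LUnit S (FO (snd X) x))"
    by (subst E_Ar_eq_iff) (simp_all add: E_arrows)
  moreover have "p \<cdot>\<^bsub>E S\<^esub> (Idn (E S) X \<boxdot>\<^bsub>E S\<^esub> q) = RUnit (E S) X \<longleftrightarrow>
    (\<forall>x \<in> Ob (fst X). e_nat p x \<cdot> (Idn S (FO (snd X) x) \<boxdot> e_nat q x) = RUnit S (FO (snd X) x))"
    by (subst E_Ar_eq_iff) (simp_all add: E_arrows)
  ultimately show ?thesis
    unfolding algebra_obj_def by (auto simp: Hom_def)
qed

context
  assumes d [simp]: "d \<in> E_Ar S" "e_dom d = X" "e_cod d = E_TensO S X X"
    and e [simp]: "e \<in> E_Ar S" "e_dom e = X" "e_cod e = E_UnitO S"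
begin

text \<open>Here the functor half is a genuine condition: coproduct and counit make the small
  category a strict monoid.\<close>

lemma coalgebra_obj_E_iff:
  "coalgebra_obj (E S) X d e \<longleftrightarrow>
     functor_monoid (fst X) (e_fun d) (e_fun e) \<and>
     (\<forall>x \<in> Ob (fst X). \<forall>y \<in> Ob (fst X). \<forall>z \<in> Ob (fst X).
       Assoc S (FO (snd X) x) (FO (snd X) y) (FO (snd X) z) \<cdot>
         (e_nat d (upair x y) \<boxdot> Idn S (FO (snd X) z)) \<cdot> e_nat d (upair (FO (e_fun d) (upair x y)) z) =
       (Idn S (FO (snd X) x) \<boxdot> e_nat d (upair y z)) \<cdot> e_nat d (upair x (FO (e_fun d) (upair y z)))) \<and>
     (\<forall>x \<in> Ob (fst X).
       LUnit S (FO (snd X) x) \<cdot> (e_nat e upoint \<boxdot> Idn S (FO (snd X) x)) \<cdot>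
         e_nat d (upair (FO (e_fun e) upoint) x) = Idn S (FO (snd X) x) \<and>
       RUnit S (FO (snd X) x) \<cdot> (Idn S (FO (snd X) x) \<boxdot> e_nat e upoint) \<cdot>
         e_nat d (upair x (FO (e_fun e) upoint)) = Idn S (FO (snd X) x))"
proof -
  note 1 = E_Ar_eq_iff [of "Assoc (E S) X X X \<cdot>\<^bsub>E S\<^esub> (d \<boxdot>\<^bsub>E S\<^esub> Idn (E S) X) \<cdot>\<^bsub>E S\<^esub> d"
    "(Idn (E S) X \<boxdot>\<^bsub>E S\<^esub> d) \<cdot>\<^bsub>E S\<^esub> d"]
  note 2 = E_Ar_eq_iff [of "LUnit (E S) X \<cdot>\<^bsub>E S\<^esub> (e \<boxdot>\<^bsub>E S\<^esub> Idn (E S) X) \<cdot>\<^bsub>E S\<^esub> d" "Idn (E S) X"]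
  note 3 = E_Ar_eq_iff [of "RUnit (E S) X \<cdot>\<^bsub>E S\<^esub> (Idn (E S) X \<boxdot>\<^bsub>E S\<^esub> e) \<cdot>\<^bsub>E S\<^esub> d" "Idn (E S) X"]
  show ?thesis
    unfolding coalgebra_obj_def functor_monoid_def
    by (simp add: 1 2 3 E_arrows Hom_def del: Cmp_TensA Cmp_TensA' cong: conj_cong) blast
qed

text \<open>Every functor commutes with diagonals and with the functors to \<open>one_cat\<close>,
  so compatibility of coproduct and product leaves a condition on components alone.\<close>

lemma algebra_hom_comult_E_iff:
  "algebra_hom (E S) X p q (E_TensO S X X) (tens_mult (E S) X p X p) (tens_unit (E S) q q) d \<longleftrightarrow>
     (\<forall>x \<in> Ob (fst X). \<forall>y \<in> Ob (fst X).
       algebra_hom S (FO (snd X) (FO (e_fun d) (upair x y))) (e_nat p (FO (e_fun d) (upair x y)))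
         (e_nat q (FO (e_fun d) (upair x y))) (FO (snd X) x \<boxtimes> FO (snd X) y)
         (tens_mult S (FO (snd X) x) (e_nat p x) (FO (snd X) y) (e_nat p y))
         (tens_unit S (e_nat q x) (e_nat q y)) (e_nat d (upair x y)))"
proof -
  have "d \<cdot>\<^bsub>E S\<^esub> p = tens_mult (E S) X p X p \<cdot>\<^bsub>E S\<^esub> (d \<boxdot>\<^bsub>E S\<^esub> d) \<longleftrightarrow>
      (\<forall>x \<in> Ob (fst X). \<forall>y \<in> Ob (fst X). e_nat d (upair x y) \<cdot> e_nat p (FO (e_fun d) (upair x y)) =
        tens_mult S (FO (snd X) x) (e_nat p x) (FO (snd X) y) (e_nat p y) \<cdot>
          (e_nat d (upair x y) \<boxdot> e_nat d (upair x y)))"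
    unfolding tens_mult_def middle_four_def
    by (subst E_Ar_eq_iff)
      (simp_all add: E_arrows E_inv_simps del: Cmp_TensA Cmp_TensA' Cmp_assoc_simp)
  moreover have "d \<cdot>\<^bsub>E S\<^esub> q = tens_unit (E S) q q \<longleftrightarrow>
      (\<forall>x \<in> Ob (fst X). \<forall>y \<in> Ob (fst X). e_nat d (upair x y) \<cdot> e_nat q (FO (e_fun d) (upair x y)) =
        tens_unit S (e_nat q x) (e_nat q y))"
    unfolding tens_unit_def by (subst E_Ar_eq_iff) (simp_all add: E_arrows E_inv_simps)
  ultimately show ?thesis
    unfolding algebra_hom_def by (auto simp: Hom_def)
qed

lemma algebra_hom_counit_E_iff:
  "algebra_hom (E S) X p q (E_UnitO S) (LUnit (E S) (E_UnitO S)) (Idn (E S) (E_UnitO S)) e \<longleftrightarrow>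
     algebra_hom S (FO (snd X) (FO (e_fun e) upoint)) (e_nat p (FO (e_fun e) upoint))
       (e_nat q (FO (e_fun e) upoint)) (UnitO S) (LUnit S (UnitO S)) (Idn S (UnitO S)) (e_nat e upoint)"
proof -
  note 1 = E_Ar_eq_iff [of "e \<cdot>\<^bsub>E S\<^esub> p" "LUnit (E S) (E_UnitO S) \<cdot>\<^bsub>E S\<^esub> (e \<boxdot>\<^bsub>E S\<^esub> e)"]
  note 2 = E_Ar_eq_iff [of "e \<cdot>\<^bsub>E S\<^esub> q" "Idn (E S) (E_UnitO S)"]
  show ?thesis
    unfolding algebra_hom_def by (simp add: 1 2 E_arrows Hom_def del: Cmp_TensA Cmp_TensA')
qed

lemma antipode_E_iff:
  assumes s [simp]: "s \<in> E_Ar S" "e_dom s = X" "e_cod s = X"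
  shows "antipode (E S) \<lparr>carr = X, mlt = p, unt = q, cmlt = d, cunt = e\<rparr> s \<longleftrightarrow>
     functor_inverse (fst X) (e_fun d) (e_fun e) (e_fun s) \<and>
     (\<forall>x \<in> Ob (fst X).
       e_nat p x \<cdot> (e_nat s x \<boxdot> Idn S (FO (snd X) x)) \<cdot> e_nat d (upair (FO (e_fun s) x) x) =
         e_nat q x \<cdot> e_nat e upoint \<and>
       e_nat p x \<cdot> (Idn S (FO (snd X) x) \<boxdot> e_nat s x) \<cdot> e_nat d (upair x (FO (e_fun s) x)) =
         e_nat q x \<cdot> e_nat e upoint)"
proof -
  note 1 = E_Ar_eq_iff [of "p \<cdot>\<^bsub>E S\<^esub> (s \<boxdot>\<^bsub>E S\<^esub> Idn (E S) X) \<cdot>\<^bsub>E S\<^esub> d" "q \<cdot>\<^bsub>E S\<^esub> e"]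
  note 2 = E_Ar_eq_iff [of "p \<cdot>\<^bsub>E S\<^esub> (Idn (E S) X \<boxdot>\<^bsub>E S\<^esub> s) \<cdot>\<^bsub>E S\<^esub> d" "q \<cdot>\<^bsub>E S\<^esub> e"]
  show ?thesis
    unfolding antipode_def functor_inverse_def
    by (simp add: 1 2 E_arrows Hom_def del: Cmp_TensA Cmp_TensA') blast
qed

end
end
end
end

section \<open>The group object of a crossed module\<close>

locale crossed_mod =
  fixes \<chi> :: "'u::infinite xmod"
  assumes crossed_module: "crossed_module \<chi>"
begin

abbreviation "G \<equiv> xE \<chi>"
abbreviation "H \<equiv> xH \<chi>"

sublocale G: group G
  using crossed_module by (simp add: crossed_module_def)

sublocale H: group H
  using crossed_module by (simp add: crossed_module_def)

sublocale bd: group_hom G H "bd \<chi>"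
  using crossed_module by unfold_locales (simp add: crossed_module_def)

lemma act_hom: "act \<chi> \<in> hom H (AutoGroup G)"
  using crossed_module by (simp add: crossed_module_def)

lemma act_auto:
  assumes "x \<in> carrier H"
  shows "act \<chi> x \<in> hom G G" "bij_betw (act \<chi> x) (carrier G) (carrier G)"
    "act \<chi> x \<in> extensional (carrier G)"
  using assms hom_in_carrier [OF act_hom, of x] by (auto simp: AutoGroup_def auto_def Bij_def)

lemma act_closed [simp]: "\<lbrakk>x \<in> carrier H; e \<in> carrier G\<rbrakk> \<Longrightarrow> act \<chi> x e \<in> carrier G"
  by (rule hom_in_carrier [OF act_auto(1)])

lemma act_mult [simp]:
  "\<lbrakk>x \<in> carrier H; e \<in> carrier G; f \<in> carrier G\<rbrakk>
    \<Longrightarrow> act \<chi> x (e \<otimes>\<^bsub>G\<^esub> f) = act \<chi> x e \<otimes>\<^bsub>G\<^esub> act \<chi> x f"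
  by (rule hom_mult [OF act_auto(1)])

lemma act_one [simp]: "x \<in> carrier H \<Longrightarrow> act \<chi> x \<one>\<^bsub>G\<^esub> = \<one>\<^bsub>G\<^esub>"
  by (rule hom_one [OF act_auto(1) G.group_axioms G.group_axioms])

lemma mult_act:
  assumes "x \<in> carrier H" "y \<in> carrier H" "e \<in> carrier G"
  shows "act \<chi> (x \<otimes>\<^bsub>H\<^esub> y) e = act \<chi> x (act \<chi> y e)"
proof -
  have "act \<chi> x \<in> Bij (carrier G)" "act \<chi> y \<in> Bij (carrier G)"
    using act_auto assms by (auto simp: Bij_def)
  then have "act \<chi> (x \<otimes>\<^bsub>H\<^esub> y) = compose (carrier G) (act \<chi> x) (act \<chi> y)"
    using hom_mult [OF act_hom assms(1,2)] by (simp add: AutoGroup_def BijGroup_def)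
  then show ?thesis
    using assms by (simp add: compose_def)
qed

lemma one_act [simp]:
  assumes "e \<in> carrier G"
  shows "act \<chi> \<one>\<^bsub>H\<^esub> e = e"
proof -
  \<comment> \<open>The action of the unit is idempotent and injective, hence the identity.\<close>
  have "act \<chi> \<one>\<^bsub>H\<^esub> (act \<chi> \<one>\<^bsub>H\<^esub> e) = act \<chi> \<one>\<^bsub>H\<^esub> e"
    using mult_act [of "\<one>\<^bsub>H\<^esub>" "\<one>\<^bsub>H\<^esub>" e] assms by simp
  then show ?thesis
    using act_auto(2) [of "\<one>\<^bsub>H\<^esub>"] assms by (auto simp: bij_betw_def dest: inj_onD)
qed

lemma act_inv [simp]:
  assumes "x \<in> carrier H" "e \<in> carrier G"
  shows "act \<chi> x (inv\<^bsub>G\<^esub> e) = inv\<^bsub>G\<^esub> (act \<chi> x e)"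
  using G.inv_equality [of "act \<chi> x (inv\<^bsub>G\<^esub> e)" "act \<chi> x e"] assms by (simp flip: act_mult)

lemma act_act_inv [simp]:
  assumes "x \<in> carrier H" "e \<in> carrier G"
  shows "act \<chi> x (act \<chi> (inv\<^bsub>H\<^esub> x) e) = e" "act \<chi> (inv\<^bsub>H\<^esub> x) (act \<chi> x e) = e"
  using assms by (simp_all flip: mult_act)

lemma bd_act:
  "\<lbrakk>x \<in> carrier H; e \<in> carrier G\<rbrakk> \<Longrightarrow> bd \<chi> (act \<chi> x e) = x \<otimes>\<^bsub>H\<^esub> bd \<chi> e \<otimes>\<^bsub>H\<^esub> inv\<^bsub>H\<^esub> x"
  using crossed_module by (simp add: crossed_module_def)

lemma act_bd:
  "\<lbrakk>e \<in> carrier G; f \<in> carrier G\<rbrakk> \<Longrightarrow> act \<chi> (bd \<chi> e) f = e \<otimes>\<^bsub>G\<^esub> f \<otimes>\<^bsub>G\<^esub> inv\<^bsub>G\<^esub> e"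
  using crossed_module by (simp add: crossed_module_def)

lemma extensional_xmod:
  "extensional2 (carrier G) (carrier G) (mult G)" "extensional2 (carrier H) (carrier H) (mult H)"
  "bd \<chi> \<in> extensional (carrier G)" "extensional2 (carrier H) (carrier G) (act \<chi>)"
  using crossed_module by (simp_all add: crossed_module_def)

section \<open>The category of a crossed module and its structure functors\<close>

lemma xcat_simps [simp]:
  "Ob (xcat \<chi>) = carrier H" "Ar (xcat \<chi>) = uprod (carrier H) (carrier G)"
  "\<lbrakk>x \<in> carrier H; e \<in> carrier G\<rbrakk> \<Longrightarrow> Dom (xcat \<chi>) (upair x e) = x"
  "\<lbrakk>x \<in> carrier H; e \<in> carrier G\<rbrakk> \<Longrightarrow> Cod (xcat \<chi>) (upair x e) = bd \<chi> e \<otimes>\<^bsub>H\<^esub> x"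
  "x \<in> carrier H \<Longrightarrow> Idn (xcat \<chi>) x = upair x \<one>\<^bsub>G\<^esub>"
  "\<lbrakk>x \<in> carrier H; e \<in> carrier G; f \<in> carrier G; y = bd \<chi> e \<otimes>\<^bsub>H\<^esub> x\<rbrakk>
    \<Longrightarrow> upair y f \<cdot>\<^bsub>xcat \<chi>\<^esub> upair x e = upair x (f \<otimes>\<^bsub>G\<^esub> e)"
  by (simp_all add: xcat_def Let_def)

lemma composable_xcatE:
  assumes "composable (xcat \<chi>) k h"
  obtains x e f where "h = upair x e" "k = upair (bd \<chi> e \<otimes>\<^bsub>H\<^esub> x) f"
    "x \<in> carrier H" "e \<in> carrier G" "f \<in> carrier G"
  using assms by (auto simp: composable_def elim!: uprodE)

lemma composable_xcat [simp]:
  "\<lbrakk>x \<in> carrier H; e \<in> carrier G; f \<in> carrier G; y = bd \<chi> e \<otimes>\<^bsub>H\<^esub> x\<rbrakk>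
    \<Longrightarrow> composable (xcat \<chi>) (upair y f) (upair x e)"
  by (simp add: composable_def)

lemma small_category_xcat: "small_category (xcat \<chi>)"
proof -
  have "category (xcat \<chi>)"
    by unfold_locales (auto simp: Hom_def H.m_assoc G.m_assoc elim!: uprodE)
  moreover have "Dom (xcat \<chi>) \<in> extensional (Ar (xcat \<chi>))" "Cod (xcat \<chi>) \<in> extensional (Ar (xcat \<chi>))"
    "Idn (xcat \<chi>) \<in> extensional (Ob (xcat \<chi>))"
    by (auto simp: xcat_def Let_def)
  moreover have "k \<cdot>\<^bsub>xcat \<chi>\<^esub> h = undefined" if "\<not> composable (xcat \<chi>) k h" for k h
    using that by (auto simp: xcat_def Let_def composable_def)
  ultimately show ?thesis
    unfolding small_category_def by blast
qed

lemma xfun_simps [simp]: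
  "\<lbrakk>x \<in> carrier H; y \<in> carrier H\<rbrakk> \<Longrightarrow> FO (xmult \<chi>) (upair x y) = x \<otimes>\<^bsub>H\<^esub> y"
  "\<lbrakk>x \<in> carrier H; z \<in> carrier H; e \<in> carrier G; f \<in> carrier G\<rbrakk>
    \<Longrightarrow> FA (xmult \<chi>) (upair (upair x e) (upair z f)) = upair (x \<otimes>\<^bsub>H\<^esub> z) (e \<otimes>\<^bsub>G\<^esub> act \<chi> x f)"
  "FO (xunit \<chi>) upoint = \<one>\<^bsub>H\<^esub>" "FA (xunit \<chi>) upoint = upair \<one>\<^bsub>H\<^esub> \<one>\<^bsub>G\<^esub>"
  "x \<in> carrier H \<Longrightarrow> FO (xdiag \<chi>) x = upair x x"
  "f \<in> uprod (carrier H) (carrier G) \<Longrightarrow> FA (xdiag \<chi>) f = upair f f"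
  "x \<in> carrier H \<Longrightarrow> FO (xcounit \<chi>) x = upoint"
  "f \<in> uprod (carrier H) (carrier G) \<Longrightarrow> FA (xcounit \<chi>) f = upoint"
  "x \<in> carrier H \<Longrightarrow> FO (xantipode \<chi>) x = inv\<^bsub>H\<^esub> x"
  "\<lbrakk>x \<in> carrier H; e \<in> carrier G\<rbrakk>
    \<Longrightarrow> FA (xantipode \<chi>) (upair x e) = upair (inv\<^bsub>H\<^esub> x) (act \<chi> (inv\<^bsub>H\<^esub> x) (inv\<^bsub>G\<^esub> e))"
  by (simp_all add: xmult_def xunit_def xdiag_def xcounit_def xantipode_def)

lemma xfun_extensional [simp]:
  "FO (xmult \<chi>) \<in> extensional (uprod (carrier H) (carrier H))"
  "FA (xmult \<chi>) \<in> extensional (uprod (uprod (carrier H) (carrier G)) (uprod (carrier H) (carrier G)))"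
  "FO (xunit \<chi>) \<in> extensional {upoint}" "FA (xunit \<chi>) \<in> extensional {upoint}"
  "FO (xdiag \<chi>) \<in> extensional (carrier H)" "FA (xdiag \<chi>) \<in> extensional (uprod (carrier H) (carrier G))"
  "FO (xcounit \<chi>) \<in> extensional (carrier H)" "FA (xcounit \<chi>) \<in> extensional (uprod (carrier H) (carrier G))"
  "FO (xantipode \<chi>) \<in> extensional (carrier H)"
  "FA (xantipode \<chi>) \<in> extensional (uprod (carrier H) (carrier G))"
  by (simp_all add: xmult_def xunit_def xdiag_def xcounit_def xantipode_def)

lemma H_cancel [simp]:
  assumes "x \<in> carrier H" "y \<in> carrier H"
  shows "inv\<^bsub>H\<^esub> x \<otimes>\<^bsub>H\<^esub> (x \<otimes>\<^bsub>H\<^esub> y) = y" "x \<otimes>\<^bsub>H\<^esub> (inv\<^bsub>H\<^esub> x \<otimes>\<^bsub>H\<^esub> y) = y"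
  using assms by (simp_all flip: H.m_assoc)

lemma G_cancel [simp]:
  assumes "x \<in> carrier G" "y \<in> carrier G"
  shows "inv\<^bsub>G\<^esub> x \<otimes>\<^bsub>G\<^esub> (x \<otimes>\<^bsub>G\<^esub> y) = y" "x \<otimes>\<^bsub>G\<^esub> (inv\<^bsub>G\<^esub> x \<otimes>\<^bsub>G\<^esub> y) = y"
  using assms by (simp_all flip: G.m_assoc)

text \<open>Equivariance of \<open>bd\<close> is what gives the product of two arrows the right
  codomain.\<close>

lemma cod_xmult:
  assumes "x \<in> carrier H" "z \<in> carrier H" "e \<in> carrier G" "f \<in> carrier G"
  shows "bd \<chi> (e \<otimes>\<^bsub>G\<^esub> act \<chi> x f) \<otimes>\<^bsub>H\<^esub> (x \<otimes>\<^bsub>H\<^esub> z) =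
    (bd \<chi> e \<otimes>\<^bsub>H\<^esub> x) \<otimes>\<^bsub>H\<^esub> (bd \<chi> f \<otimes>\<^bsub>H\<^esub> z)"
  using assms by (simp add: bd_act H.m_assoc)

text \<open>Preservation of composition is the Peiffer identity: in the product of the two later
  arrows, \<open>f'\<close> is acted on by the codomain of \<open>e\<close>, which amounts to acting
  by \<open>x\<close> and conjugating by \<open>e\<close>.\<close>

lemma functor_xmult: "is_functor (prod_cat (xcat \<chi>) (xcat \<chi>)) (xcat \<chi>) (xmult \<chi>)"
proof -
  have comp: "FA (xmult \<chi>) (k \<cdot>\<^bsub>prod_cat (xcat \<chi>) (xcat \<chi>)\<^esub> h) = FA (xmult \<chi>) k \<cdot>\<^bsub>xcat \<chi>\<^esub> FA (xmult \<chi>) h"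
    if "composable (prod_cat (xcat \<chi>) (xcat \<chi>)) k h" for k h
    using that
  proof (elim composable_prod_catE composable_xcatE)
    fix k' l' k'' l'' x e f x' e' f'
    assume *: "k = upair k' l'" "h = upair k'' l''" "k'' = upair x e" "k' = upair (bd \<chi> e \<otimes>\<^bsub>H\<^esub> x) f"
      "l'' = upair x' e'" "l' = upair (bd \<chi> e' \<otimes>\<^bsub>H\<^esub> x') f'"
      and [simp]: "x \<in> carrier H" "e \<in> carrier G" "f \<in> carrier G" "x' \<in> carrier H" "e' \<in> carrier G" "f' \<in> carrier G"
    have "act \<chi> (bd \<chi> e \<otimes>\<^bsub>H\<^esub> x) f' = e \<otimes>\<^bsub>G\<^esub> act \<chi> x f' \<otimes>\<^bsub>G\<^esub> inv\<^bsub>G\<^esub> e"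
      by (simp add: mult_act act_bd)
    then show ?thesis
      unfolding * using cod_xmult [of x x' e e'] by (simp add: G.m_assoc)
  qed
  then show ?thesis
    unfolding is_functor_iff by (auto simp: bd_act H.m_assoc elim!: uprodE)
qed

lemma functor_xunit: "is_functor one_cat (xcat \<chi>) (xunit \<chi>)"
  unfolding is_functor_iff by (simp add: composable_def)

lemma functor_xdiag: "is_functor (xcat \<chi>) (prod_cat (xcat \<chi>) (xcat \<chi>)) (xdiag \<chi>)"
  unfolding is_functor_iff by (auto elim!: uprodE composable_xcatE)

lemma functor_xcounit: "is_functor (xcat \<chi>) one_cat (xcounit \<chi>)"
  unfolding is_functor_iff by (auto elim!: uprodE composable_xcatE)

lemma cod_xantipode:
  assumes "x \<in> carrier H" "e \<in> carrier G"
  shows "bd \<chi> (act \<chi> (inv\<^bsub>H\<^esub> x) (inv\<^bsub>G\<^esub> e)) \<otimes>\<^bsub>H\<^esub> inv\<^bsub>H\<^esub> x = inv\<^bsub>H\<^esub> (bd \<chi> e \<otimes>\<^bsub>H\<^esub> x)"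
  using assms by (simp add: bd_act H.m_assoc H.inv_mult_group del: act_inv)

lemma functor_xantipode: "is_functor (xcat \<chi>) (xcat \<chi>) (xantipode \<chi>)"
proof -
  have comp: "FA (xantipode \<chi>) (k \<cdot>\<^bsub>xcat \<chi>\<^esub> h) = FA (xantipode \<chi>) k \<cdot>\<^bsub>xcat \<chi>\<^esub> FA (xantipode \<chi>) h"
    if "composable (xcat \<chi>) k h" for k h
    using that
  proof (elim composable_xcatE)
    fix x e f
    assume *: "h = upair x e" "k = upair (bd \<chi> e \<otimes>\<^bsub>H\<^esub> x) f"
      and [simp]: "x \<in> carrier H" "e \<in> carrier G" "f \<in> carrier G"
    \<comment> \<open>The Peiffer identity again, now with conjugation by the inverse of
      \<open>e\<close>.\<close>
    have "act \<chi> (inv\<^bsub>H\<^esub> (bd \<chi> e \<otimes>\<^bsub>H\<^esub> x)) f = act \<chi> (inv\<^bsub>H\<^esub> x) (act \<chi> (bd \<chi> (inv\<^bsub>G\<^esub> e)) f)"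
      by (simp add: H.inv_mult_group mult_act)
    also have "\<dots> = act \<chi> (inv\<^bsub>H\<^esub> x) (inv\<^bsub>G\<^esub> e \<otimes>\<^bsub>G\<^esub> f \<otimes>\<^bsub>G\<^esub> e)"
      by (subst act_bd) simp_all
    finally show ?thesis
      unfolding * using cod_xantipode [of x e]
      by (simp add: G.m_assoc G.inv_mult_group)
  qed
  then show ?thesis
    unfolding is_functor_iff using cod_xantipode by (auto elim!: uprodE)
qed

lemma functor_monoid_xcat: "functor_monoid (xcat \<chi>) (xmult \<chi>) (xunit \<chi>)"
  by (simp add: functor_monoid_def H.m_assoc G.m_assoc mult_act)

lemma functor_inverse_xcat: "functor_inverse (xcat \<chi>) (xmult \<chi>) (xunit \<chi>) (xantipode \<chi>)"
  by (simp add: functor_inverse_def)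

text \<open>Supplies the inverse functor from which the antipode is seen to be an isomorphism of
  \<open>E S\<close>.\<close>

lemma xantipode_xantipode:
  "x \<in> carrier H \<Longrightarrow> FO (xantipode \<chi>) (FO (xantipode \<chi>) x) = x"
  "f \<in> uprod (carrier H) (carrier G) \<Longrightarrow> FA (xantipode \<chi>) (FA (xantipode \<chi>) f) = f"
  by (auto elim!: uprodE)

end

section \<open>From Hopf coalgebras over crossed modules to Hopf algebras\<close>

locale hopf_coalg = smc_base S + crossed_mod \<chi>
  for S :: "('o, 'a) smc" (structure) and \<chi> :: "'u::infinite xmod" +
  fixes A :: "('u, 'o, 'a) hcoalg"
  assumes A: "hopf_coalgebra S \<chi> A"
begin

lemma extensional_A:
  "h_obj A \<in> extensional (carrier H)" "h_mlt A \<in> extensional (carrier H)"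
  "h_unt A \<in> extensional (carrier H)" "extensional2 (carrier H) (carrier H) (h_cmlt A)"
  "h_ant A \<in> extensional (carrier H)" "extensional2 (carrier H) (carrier G) (h_phi A)"
  using A unfolding hopf_coalgebra_def Let_def by blast+

lemma alg: "x \<in> carrier H \<Longrightarrow> algebra_obj S (h_obj A x) (h_mlt A x) (h_unt A x)"
  using A unfolding hopf_coalgebra_def Let_def by blast

lemma comult_hom:
  "\<lbrakk>x \<in> carrier H; y \<in> carrier H\<rbrakk> \<Longrightarrow>
    algebra_hom S (h_obj A (x \<otimes>\<^bsub>H\<^esub> y)) (h_mlt A (x \<otimes>\<^bsub>H\<^esub> y)) (h_unt A (x \<otimes>\<^bsub>H\<^esub> y))
      (h_obj A x \<boxtimes> h_obj A y) (tens_mult S (h_obj A x) (h_mlt A x) (h_obj A y) (h_mlt A y))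
      (tens_unit S (h_unt A x) (h_unt A y)) (h_cmlt A x y)"
  using A unfolding hopf_coalgebra_def Let_def by blast

lemma counit_hom:
  "algebra_hom S (h_obj A \<one>\<^bsub>H\<^esub>) (h_mlt A \<one>\<^bsub>H\<^esub>) (h_unt A \<one>\<^bsub>H\<^esub>)
     (UnitO S) (LUnit S (UnitO S)) (Idn S (UnitO S)) (h_cunt A)"
  using A unfolding hopf_coalgebra_def Let_def by blast

lemma ant:
  assumes "x \<in> carrier H"
  shows "h_ant A x \<in> Hom S (h_obj A (inv\<^bsub>H\<^esub> x)) (h_obj A x)" "iso_arr S (h_ant A x)"
  using A assms unfolding hopf_coalgebra_def Let_def by blast+

lemma phi_hom:
  assumes "x \<in> carrier H" "e \<in> carrier G"
  shows "algebra_hom S (h_obj A x) (h_mlt A x) (h_unt A x) (h_obj A (bd \<chi> e \<otimes>\<^bsub>H\<^esub> x))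
      (h_mlt A (bd \<chi> e \<otimes>\<^bsub>H\<^esub> x)) (h_unt A (bd \<chi> e \<otimes>\<^bsub>H\<^esub> x)) (h_phi A x e)"
    "iso_arr S (h_phi A x e)"
  using A assms unfolding hopf_coalgebra_def Let_def by blast+

lemma coassoc:
  "\<lbrakk>x \<in> carrier H; y \<in> carrier H; z \<in> carrier H\<rbrakk> \<Longrightarrow>
    Assoc S (h_obj A x) (h_obj A y) (h_obj A z) \<cdot> (h_cmlt A x y \<boxdot> Idn S (h_obj A z)) \<cdot> h_cmlt A (x \<otimes>\<^bsub>H\<^esub> y) z =
    (Idn S (h_obj A x) \<boxdot> h_cmlt A y z) \<cdot> h_cmlt A x (y \<otimes>\<^bsub>H\<^esub> z)"
  using A unfolding hopf_coalgebra_def Let_def by blast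

lemma counit:
  assumes "x \<in> carrier H"
  shows "RUnit S (h_obj A x) \<cdot> (Idn S (h_obj A x) \<boxdot> h_cunt A) \<cdot> h_cmlt A x \<one>\<^bsub>H\<^esub> = Idn S (h_obj A x)"
    "LUnit S (h_obj A x) \<cdot> (h_cunt A \<boxdot> Idn S (h_obj A x)) \<cdot> h_cmlt A \<one>\<^bsub>H\<^esub> x = Idn S (h_obj A x)"
  using A assms unfolding hopf_coalgebra_def Let_def by blast+

lemma ant_eq:
  assumes "x \<in> carrier H"
  shows "h_mlt A x \<cdot> (h_ant A x \<boxdot> Idn S (h_obj A x)) \<cdot> h_cmlt A (inv\<^bsub>H\<^esub> x) x = h_unt A x \<cdot> h_cunt A"
    "h_mlt A x \<cdot> (Idn S (h_obj A x) \<boxdot> h_ant A x) \<cdot> h_cmlt A x (inv\<^bsub>H\<^esub> x) = h_unt A x \<cdot> h_cunt A"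
  using A assms unfolding hopf_coalgebra_def Let_def by blast+

lemma phi_one: "x \<in> carrier H \<Longrightarrow> h_phi A x \<one>\<^bsub>G\<^esub> = Idn S (h_obj A x)"
  using A unfolding hopf_coalgebra_def Let_def by blast

lemma phi_mult:
  "\<lbrakk>x \<in> carrier H; e \<in> carrier G; f \<in> carrier G\<rbrakk> \<Longrightarrow>
    h_phi A (bd \<chi> e \<otimes>\<^bsub>H\<^esub> x) f \<cdot> h_phi A x e = h_phi A x (f \<otimes>\<^bsub>G\<^esub> e)"
  using A unfolding hopf_coalgebra_def Let_def by blast

lemma phi_comult:
  "\<lbrakk>x \<in> carrier H; y \<in> carrier H; e \<in> carrier G; f \<in> carrier G\<rbrakk> \<Longrightarrow>
    (h_phi A x e \<boxdot> h_phi A y f) \<cdot> h_cmlt A x y =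
    h_cmlt A (bd \<chi> e \<otimes>\<^bsub>H\<^esub> x) (bd \<chi> f \<otimes>\<^bsub>H\<^esub> y) \<cdot> h_phi A (x \<otimes>\<^bsub>H\<^esub> y) (e \<otimes>\<^bsub>G\<^esub> act \<chi> x f)"
  using A unfolding hopf_coalgebra_def Let_def by blast

lemma typing [simp]:
  assumes "x \<in> carrier H"
  shows "h_obj A x \<in> Ob S" "h_mlt A x \<in> Ar S" "Dom S (h_mlt A x) = h_obj A x \<boxtimes> h_obj A x"
    "Cod S (h_mlt A x) = h_obj A x" "h_unt A x \<in> Ar S" "Dom S (h_unt A x) = UnitO S"
    "Cod S (h_unt A x) = h_obj A x"
    "h_ant A x \<in> Ar S" "Dom S (h_ant A x) = h_obj A (inv\<^bsub>H\<^esub> x)" "Cod S (h_ant A x) = h_obj A x"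
  using alg [OF assms] ant(1) [OF assms] by (simp_all add: algebra_obj_def Hom_def)

lemma typing_comult [simp]:
  assumes "x \<in> carrier H" "y \<in> carrier H"
  shows "h_cmlt A x y \<in> Ar S" "Dom S (h_cmlt A x y) = h_obj A (x \<otimes>\<^bsub>H\<^esub> y)"
    "Cod S (h_cmlt A x y) = h_obj A x \<boxtimes> h_obj A y"
  using comult_hom [OF assms] by (simp_all add: algebra_hom_def Hom_def)

lemma typing_counit [simp]:
  "h_cunt A \<in> Ar S" "Dom S (h_cunt A) = h_obj A \<one>\<^bsub>H\<^esub>" "Cod S (h_cunt A) = UnitO S"
  using counit_hom by (simp_all add: algebra_hom_def Hom_def)

lemma typing_phi [simp]:
  assumes "x \<in> carrier H" "e \<in> carrier G"
  shows "h_phi A x e \<in> Ar S" "Dom S (h_phi A x e) = h_obj A x"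
    "Cod S (h_phi A x e) = h_obj A (bd \<chi> e \<otimes>\<^bsub>H\<^esub> x)"
  using phi_hom(1) [OF assms] by (simp_all add: algebra_hom_def Hom_def)

text \<open>
  Compatibility of the antipode with \<open>\<phi>\<close> is not an axiom: both sides of the equation are
  convolution inverses.
\<close>

lemma ant_natural:
  assumes x [simp]: "x \<in> carrier H" and e [simp]: "e \<in> carrier G"
  shows "h_ant A (bd \<chi> e \<otimes>\<^bsub>H\<^esub> x) \<cdot> h_phi A (inv\<^bsub>H\<^esub> x) (act \<chi> (inv\<^bsub>H\<^esub> x) (inv\<^bsub>G\<^esub> e)) =
    h_phi A x e \<cdot> h_ant A x"
proof -
  \<comment> \<open>\<open>y\<close> is the target of the arrow \<open>e\<close> out of
    \<open>x\<close>. The antipode functor sends this arrow to \<open>e'\<close>, which runs from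
    the inverse of \<open>x\<close> to the inverse of \<open>y\<close>.\<close>
  define y where "y = bd \<chi> e \<otimes>\<^bsub>H\<^esub> x"
  define e' where "e' = act \<chi> (inv\<^bsub>H\<^esub> x) (inv\<^bsub>G\<^esub> e)"
  have [simp]: "y \<in> carrier H" "e' \<in> carrier G"
    by (simp_all add: y_def e'_def del: act_inv)
  have y': "bd \<chi> e' \<otimes>\<^bsub>H\<^esub> inv\<^bsub>H\<^esub> x = inv\<^bsub>H\<^esub> y"
    using cod_xantipode [OF x e] by (simp add: y_def e'_def del: act_inv)
  let ?\<phi> = "h_phi A x e" and ?\<phi>' = "h_phi A (inv\<^bsub>H\<^esub> x) e'"
  have [simp]: "Cod S ?\<phi> = h_obj A y" "Cod S ?\<phi>' = h_obj A (inv\<^bsub>H\<^esub> y)"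
    by (simp add: y_def) (simp add: y')
  obtain g where g: "inverse_arrows S ?\<phi>' g"
    using phi_hom(2) [of "inv\<^bsub>H\<^esub> x" e'] by (auto simp: iso_arr_def)
  have [simp]: "g \<in> Ar S" "Dom S g = h_obj A (inv\<^bsub>H\<^esub> y)" "Cod S g = h_obj A (inv\<^bsub>H\<^esub> x)"
    "g \<cdot> ?\<phi>' = Idn S (h_obj A (inv\<^bsub>H\<^esub> x))"
    using inverse_arrowsD [OF g] by simp_all
  \<comment> \<open>The arrow on the left of the product and the one on the right multiply to the
    identity of the unit object, so \<open>phi_comult\<close> compares the coproducts in degrees
    \<open>x\<close> and \<open>y\<close> with no correction on the component of degree 1.\<close>
  have "e' \<otimes>\<^bsub>G\<^esub> act \<chi> (inv\<^bsub>H\<^esub> x) e = \<one>\<^bsub>G\<^esub>"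
    by (simp add: e'_def)
  then have comult: "h_cmlt A (inv\<^bsub>H\<^esub> y) y = (?\<phi>' \<boxdot> ?\<phi>) \<cdot> h_cmlt A (inv\<^bsub>H\<^esub> x) x"
    using phi_comult [of "inv\<^bsub>H\<^esub> x" x e' e] by (simp add: y' phi_one flip: y_def)
  have \<phi>: "?\<phi> \<cdot> h_mlt A x = h_mlt A y \<cdot> (?\<phi> \<boxdot> ?\<phi>)" "?\<phi> \<cdot> h_unt A x = h_unt A y"
    using phi_hom(1) [OF x e] by (simp_all add: algebra_hom_def flip: y_def)
  \<comment> \<open>The conjugate of the antipode in degree \<open>x\<close> is a left convolution
    inverse in degree \<open>y\<close>, where \<open>h_ant A y\<close> is a right one.\<close>
  have "h_mlt A y \<cdot> ((?\<phi> \<cdot> h_ant A x \<cdot> g) \<boxdot> Idn S (h_obj A y)) \<cdot> h_cmlt A (inv\<^bsub>H\<^esub> y) y =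
      (h_mlt A y \<cdot> (?\<phi> \<boxdot> ?\<phi>)) \<cdot> (h_ant A x \<boxdot> Idn S (h_obj A x)) \<cdot> h_cmlt A (inv\<^bsub>H\<^esub> x) x"
    by (simp add: comult)
  also have "\<dots> = ?\<phi> \<cdot> (h_mlt A x \<cdot> (h_ant A x \<boxdot> Idn S (h_obj A x)) \<cdot> h_cmlt A (inv\<^bsub>H\<^esub> x) x)"
    unfolding \<phi>(1) [symmetric] by simp
  also have "\<dots> = (?\<phi> \<cdot> h_unt A x) \<cdot> h_cunt A"
    unfolding ant_eq(1) [OF x] by simp
  finally have left: "h_mlt A y \<cdot> ((?\<phi> \<cdot> h_ant A x \<cdot> g) \<boxdot> Idn S (h_obj A y)) \<cdot> h_cmlt A (inv\<^bsub>H\<^esub> y) y =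
      h_unt A y \<cdot> h_cunt A"
    unfolding \<phi>(2) .
  have eq: "?\<phi> \<cdot> h_ant A x \<cdot> g = h_ant A y"
    by (rule convolution_inverse_unique [of "h_obj A y" "h_mlt A y" "h_unt A y"
          "h_cmlt A \<one>\<^bsub>H\<^esub> (inv\<^bsub>H\<^esub> y)" "h_obj A (inv\<^bsub>H\<^esub> y)" "h_obj A \<one>\<^bsub>H\<^esub>"
          "h_cmlt A (inv\<^bsub>H\<^esub> y) \<one>\<^bsub>H\<^esub>" "h_cmlt A (inv\<^bsub>H\<^esub> y) y" "h_cmlt A y (inv\<^bsub>H\<^esub> y)" "h_cunt A"])
      (use left ant_eq(2) [of y] counit [of "inv\<^bsub>H\<^esub> y"] alg [of y] coassoc [of "inv\<^bsub>H\<^esub> y" y "inv\<^bsub>H\<^esub> y"]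
        in \<open>simp_all add: Hom_def\<close>)
  have "h_ant A y \<cdot> ?\<phi>' = ?\<phi> \<cdot> h_ant A x"
    unfolding eq [symmetric] by simp
  then show ?thesis
    unfolding y_def e'_def .
qed

section \<open>The Hopf algebra of a Hopf coalgebra\<close>

abbreviation "X \<equiv> assoc_obj (\<chi>, A)"
abbreviation "B \<equiv> assoc_hopf S (\<chi>, A)"

lemma X_simps [simp]:
  "fst X = xcat \<chi>" "FO (snd X) = h_obj A"
  "\<lbrakk>x \<in> carrier H; e \<in> carrier G\<rbrakk> \<Longrightarrow> FA (snd X) (upair x e) = h_phi A x e"
  by (simp_all add: assoc_obj_def)

lemma X_Ob [simp]: "X \<in> E_Ob S"
proof -
  have "FA (snd X) \<in> extensional (uprod (carrier H) (carrier G))"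
    by (simp add: assoc_obj_def)
  then have "is_functor (xcat \<chi>) S (snd X)"
    unfolding is_functor_iff using extensional_A(1)
    by (auto simp: phi_one phi_mult elim!: uprodE composable_xcatE)
  then show ?thesis
    using small_category_xcat by (simp add: E_Ob_def assoc_obj_def)
qed

lemma B_simps [simp]:
  "carr B = X"
  "e_dom (mlt B) = E_TensO S X X" "e_cod (mlt B) = X" "e_fun (mlt B) = xdiag \<chi>" "e_nat (mlt B) = h_mlt A"
  "e_dom (unt B) = E_UnitO S" "e_cod (unt B) = X" "e_fun (unt B) = xcounit \<chi>" "e_nat (unt B) = h_unt A"
  "e_dom (cmlt B) = X" "e_cod (cmlt B) = E_TensO S X X" "e_fun (cmlt B) = xmult \<chi>"
  "\<lbrakk>x \<in> carrier H; y \<in> carrier H\<rbrakk> \<Longrightarrow> e_nat (cmlt B) (upair x y) = h_cmlt A x y"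
  "e_dom (cunt B) = X" "e_cod (cunt B) = E_UnitO S" "e_fun (cunt B) = xunit \<chi>"
  "e_nat (cunt B) upoint = h_cunt A"
  "e_nat (cmlt B) \<in> extensional (uprod (carrier H) (carrier H))" "e_nat (cunt B) \<in> extensional {upoint}"
  by (simp_all add: assoc_hopf_def Let_def)

text \<open>Naturality of product and unit says that the \<open>h_phi A x e\<close> are algebra
  morphisms. That of the coproduct is \<open>phi_comult\<close>, and that of the counit concerns the
  identity arrow of the unit object.\<close>

lemma B_arrows [simp]:
  "mlt B \<in> E_Ar S" "unt B \<in> E_Ar S" "cmlt B \<in> E_Ar S" "cunt B \<in> E_Ar S"
proof -
  have phi_alg: "h_phi A x e \<cdot> h_mlt A x = h_mlt A (bd \<chi> e \<otimes>\<^bsub>H\<^esub> x) \<cdot> (h_phi A x e \<boxdot> h_phi A x e)"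
    "h_phi A x e \<cdot> h_unt A x = h_unt A (bd \<chi> e \<otimes>\<^bsub>H\<^esub> x)"
    if "x \<in> carrier H" "e \<in> carrier G" for x e
    using phi_hom(1) [OF that] by (simp_all add: algebra_hom_def)
  show "mlt B \<in> E_Ar S"
    by (rule E_ArI_functor [where X = "E_TensO S X X" and Y = X])
      (use functor_xdiag extensional_A(2) in \<open>auto simp: phi_alg elim!: uprodE\<close>)
  show "unt B \<in> E_Ar S"
    by (rule E_ArI_functor [where X = "E_UnitO S" and Y = X])
      (use functor_xcounit extensional_A(3) in \<open>auto simp: phi_alg elim!: uprodE\<close>)
  show "cmlt B \<in> E_Ar S"
    by (rule E_ArI_functor [where X = X and Y = "E_TensO S X X"])
      (use functor_xmult in \<open>auto simp: phi_comult elim!: uprodE\<close>)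
  show "cunt B \<in> E_Ar S"
    by (rule E_ArI_functor [where X = X and Y = "E_UnitO S"])
      (use functor_xunit in \<open>auto simp: phi_one\<close>)
qed

lemma antipode_arrow_simps [simp]:
  "e_dom (assoc_antipode (\<chi>, A)) = X" "e_cod (assoc_antipode (\<chi>, A)) = X"
  "e_fun (assoc_antipode (\<chi>, A)) = xantipode \<chi>" "e_nat (assoc_antipode (\<chi>, A)) = h_ant A"
  by (simp_all add: assoc_antipode_def)

lemma antipode_arrow [simp]: "assoc_antipode (\<chi>, A) \<in> E_Ar S"
  by (rule E_ArI_functor [where X = X and Y = X])
    (use functor_xantipode extensional_A(5) ant_natural in \<open>auto elim!: uprodE simp del: act_inv\<close>)

lemma diag_B:
  "x \<in> Ob (fst X) \<Longrightarrow> FO (e_fun (mlt B)) x = upair x x"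
  "f \<in> Ar (fst X) \<Longrightarrow> FA (e_fun (mlt B)) f = upair f f"
  by simp_all

lemma bialgebra_obj_B: "bialgebra_obj (E S) B"
proof -
  note assms = X_Ob B_arrows(1) B_simps(2,3) B_arrows(2) B_simps(6,7) diag_B
  note assms' = assms B_arrows(3) B_simps(10,11) B_arrows(4) B_simps(14,15)
  have "algebra_obj (E S) X (mlt B) (unt B)"
    by (subst algebra_obj_E_iff [OF assms]) (simp_all add: alg)
  moreover have "coalgebra_obj (E S) X (cmlt B) (cunt B)"
    by (subst coalgebra_obj_E_iff [OF assms'])
      (simp_all add: functor_monoid_xcat coassoc counit del: Cmp_TensA Cmp_TensA')
  moreover have "algebra_hom (E S) X (mlt B) (unt B) (E_TensO S X X)
      (tens_mult (E S) X (mlt B) X (mlt B)) (tens_unit (E S) (unt B) (unt B)) (cmlt B)"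
    by (subst algebra_hom_comult_E_iff [OF assms']) (simp_all add: comult_hom)
  moreover have "algebra_hom (E S) X (mlt B) (unt B) (E_UnitO S) (LUnit (E S) (E_UnitO S))
      (Idn (E S) (E_UnitO S)) (cunt B)"
    by (subst algebra_hom_counit_E_iff [OF assms']) (simp_all add: counit_hom)
  ultimately show ?thesis
    by (simp add: bialgebra_obj_def)
qed

lemma antipode_B: "antipode (E S) B (assoc_antipode (\<chi>, A))"
proof -
  note assms = X_Ob B_arrows(1) B_simps(2,3) B_arrows(2) B_simps(6,7) diag_B
    B_arrows(3) B_simps(10,11) B_arrows(4) B_simps(14,15) antipode_arrow antipode_arrow_simps(1,2)
  have "antipode (E S) \<lparr>carr = X, mlt = mlt B, unt = unt B, cmlt = cmlt B, cunt = cunt B\<rparr> (assoc_antipode (\<chi>, A))"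
    by (subst antipode_E_iff [OF assms])
      (simp_all add: functor_inverse_xcat ant_eq del: Cmp_TensA Cmp_TensA')
  then show ?thesis
    by (simp add: antipode_def)
qed

lemma iso_antipode: "iso_arr (E S) (assoc_antipode (\<chi>, A))"
proof -
  have "FO (xantipode \<chi>) (FO (xantipode \<chi>) x) = x" if "x \<in> Ob (fst X)" for x
    using that xantipode_xantipode by simp
  moreover have "FA (xantipode \<chi>) (FA (xantipode \<chi>) f) = f" if "f \<in> Ar (fst X)" for f
    using that xantipode_xantipode by simp
  ultimately show ?thesis
    unfolding iso_arr_def
    by (intro exI) (rule inverse_arrows_E [where X = X and Y = X and K = "xantipode \<chi>"],
      simp_all only: antipode_arrow antipode_arrow_simps X_simps functor_xantipode, auto simp: ant(2))
qed

lemma hopf_algebra_B: "hopf_algebra (E S) B"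
  using bialgebra_obj_B antipode_B iso_antipode by (auto simp: hopf_algebra_def)

lemma cat_part_B: "cat_part B = xmod_hopf \<chi>"
  by (simp add: cat_part_def xmod_hopf_def)

end

section \<open>From Hopf algebras to Hopf coalgebras over crossed modules\<close>

text \<open>The antipode is fixed as a parameter, since its components are going to be the family
  \<open>h_ant\<close>.\<close>

locale hopf_E = smc_base S for S :: "('o, 'a) smc" (structure) +
  fixes B :: "('u::infinite, 'o, 'a) ebialg" and s :: "('u, 'o, 'a) earr"
  assumes bialg: "bialgebra_obj (E S) B" and antipode: "antipode (E S) B s"
begin

abbreviation "C \<equiv> fst (carr B)"
abbreviation "F \<equiv> snd (carr B)"
abbreviation "m \<equiv> e_fun (cmlt B)"
abbreviation "u \<equiv> e_fun (cunt B)"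

lemma arrows [simp]:
  "carr B \<in> E_Ob S"
  "mlt B \<in> E_Ar S" "e_dom (mlt B) = E_TensO S (carr B) (carr B)" "e_cod (mlt B) = carr B"
  "unt B \<in> E_Ar S" "e_dom (unt B) = E_UnitO S" "e_cod (unt B) = carr B"
  "cmlt B \<in> E_Ar S" "e_dom (cmlt B) = carr B" "e_cod (cmlt B) = E_TensO S (carr B) (carr B)"
  "cunt B \<in> E_Ar S" "e_dom (cunt B) = carr B" "e_cod (cunt B) = E_UnitO S"
  "s \<in> E_Ar S" "e_dom s = carr B" "e_cod s = carr B"
  using symmetric_monoidal_category.bialgebra_objD [OF symmetric_monoidal_category_E bialg] antipode
  by (simp_all add: antipode_def Hom_def)

lemma diag:
  "x \<in> Ob C \<Longrightarrow> FO (e_fun (mlt B)) x = upair x x"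
  "f \<in> Ar C \<Longrightarrow> FA (e_fun (mlt B)) f = upair f f"
  using bialg e_fun_mult_eq_diagonal [OF arrows(1-7)] by (simp_all add: bialgebra_obj_def)

lemma alg: "x \<in> Ob C \<Longrightarrow> algebra_obj S (FO F x) (e_nat (mlt B) x) (e_nat (unt B) x)"
  using bialg algebra_obj_E_iff [OF arrows(1-7) diag] by (simp add: bialgebra_obj_def)

lemma coalgebra: "coalgebra_obj (E S) (carr B) (cmlt B) (cunt B)"
  using bialg by (simp add: bialgebra_obj_def)

lemma coalg:
  shows monoid: "functor_monoid C m u"
    and coassoc: "\<lbrakk>x \<in> Ob C; y \<in> Ob C; z \<in> Ob C\<rbrakk> \<Longrightarrow>
       Assoc S (FO F x) (FO F y) (FO F z) \<cdot>
         (e_nat (cmlt B) (upair x y) \<boxdot> Idn S (FO F z)) \<cdot> e_nat (cmlt B) (upair (FO m (upair x y)) z) =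
       (Idn S (FO F x) \<boxdot> e_nat (cmlt B) (upair y z)) \<cdot> e_nat (cmlt B) (upair x (FO m (upair y z)))"
    and counit_l: "x \<in> Ob C \<Longrightarrow> LUnit S (FO F x) \<cdot> (e_nat (cunt B) upoint \<boxdot> Idn S (FO F x)) \<cdot>
         e_nat (cmlt B) (upair (FO u upoint) x) = Idn S (FO F x)"
    and counit_r: "x \<in> Ob C \<Longrightarrow> RUnit S (FO F x) \<cdot> (Idn S (FO F x) \<boxdot> e_nat (cunt B) upoint) \<cdot>
         e_nat (cmlt B) (upair x (FO u upoint)) = Idn S (FO F x)"
  using coalgebra [simplified coalgebra_obj_E_iff [OF arrows(1-7) diag arrows(8-13)]] by blast+

lemma comult_hom:
  "\<lbrakk>x \<in> Ob C; y \<in> Ob C\<rbrakk> \<Longrightarrow>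
     algebra_hom S (FO F (FO m (upair x y))) (e_nat (mlt B) (FO m (upair x y)))
       (e_nat (unt B) (FO m (upair x y))) (FO F x \<boxtimes> FO F y)
       (tens_mult S (FO F x) (e_nat (mlt B) x) (FO F y) (e_nat (mlt B) y))
       (tens_unit S (e_nat (unt B) x) (e_nat (unt B) y)) (e_nat (cmlt B) (upair x y))"
  using bialg algebra_hom_comult_E_iff [OF arrows(1-7) diag arrows(8-13)] by (simp add: bialgebra_obj_def)

lemma counit_hom:
  "algebra_hom S (FO F (FO u upoint)) (e_nat (mlt B) (FO u upoint)) (e_nat (unt B) (FO u upoint))
     (UnitO S) (LUnit S (UnitO S)) (Idn S (UnitO S)) (e_nat (cunt B) upoint)"
  using bialg algebra_hom_counit_E_iff [OF arrows(1-7) diag arrows(8-13)] by (simp add: bialgebra_obj_def)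

lemma antipode':
  "antipode (E S) \<lparr>carr = carr B, mlt = mlt B, unt = unt B, cmlt = cmlt B, cunt = cunt B\<rparr> s"
  using antipode by (simp add: antipode_def)

lemma ant:
  shows inverse: "functor_inverse C m u (e_fun s)"
    and ant_l: "x \<in> Ob C \<Longrightarrow> e_nat (mlt B) x \<cdot> (e_nat s x \<boxdot> Idn S (FO F x)) \<cdot>
        e_nat (cmlt B) (upair (FO (e_fun s) x) x) = e_nat (unt B) x \<cdot> e_nat (cunt B) upoint"
    and ant_r: "x \<in> Ob C \<Longrightarrow> e_nat (mlt B) x \<cdot> (Idn S (FO F x) \<boxdot> e_nat s x) \<cdot>
        e_nat (cmlt B) (upair x (FO (e_fun s) x)) = e_nat (unt B) x \<cdot> e_nat (cunt B) upoint"
  using antipode' [simplified antipode_E_iff [OF arrows(1-7) diag arrows(8-16)]] by blast+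

lemma left_inverse:
  "x \<in> Ob C \<Longrightarrow> FO m (upair (FO (e_fun s) x) x) = FO u upoint"
  "f \<in> Ar C \<Longrightarrow> FA m (upair (FA (e_fun s) f) f) = FA u upoint"
  using inverse unfolding functor_inverse_def by blast+

end

locale hopf_over_xmod = hopf_E S B s + crossed_mod \<chi>
  for S :: "('o, 'a) smc" (structure) and B :: "('u::infinite, 'o, 'a) ebialg" and s
    and \<chi> :: "'u xmod" +
  assumes iso_s: "iso_arr (E S) s" and cat_part: "cat_part B = xmod_hopf \<chi>"
begin

lemma funs [simp]:
  "C = xcat \<chi>" "m = xmult \<chi>" "u = xunit \<chi>" "e_fun (mlt B) = xdiag \<chi>" "e_fun (unt B) = xcounit \<chi>"
  using cat_part by (simp_all add: cat_part_def xmod_hopf_def)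

text \<open>\<open>cat_part\<close> keeps no antipode, so the functor of \<open>s\<close> has to be
  computed. It is forced by uniqueness of left inverses, for arrows coordinate by
  coordinate.\<close>

lemma e_fun_antipode:
  "x \<in> carrier H \<Longrightarrow> FO (e_fun s) x = inv\<^bsub>H\<^esub> x"
  "\<lbrakk>x \<in> carrier H; e \<in> carrier G\<rbrakk>
    \<Longrightarrow> FA (e_fun s) (upair x e) = upair (inv\<^bsub>H\<^esub> x) (act \<chi> (inv\<^bsub>H\<^esub> x) (inv\<^bsub>G\<^esub> e))"
proof -
  show FO: "FO (e_fun s) x = inv\<^bsub>H\<^esub> x" if [simp]: "x \<in> carrier H" for x
  proof -
    have [simp]: "FO (e_fun s) x \<in> carrier H"
      using E_Ar_functor_simps(1) [OF arrows(14,15)] by simp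
    have "FO (e_fun s) x \<otimes>\<^bsub>H\<^esub> x = \<one>\<^bsub>H\<^esub>"
      using left_inverse(1) [of x] by simp
    then show ?thesis
      by (intro H.inv_equality [symmetric]) simp_all
  qed
  show "FA (e_fun s) (upair x e) = upair (inv\<^bsub>H\<^esub> x) (act \<chi> (inv\<^bsub>H\<^esub> x) (inv\<^bsub>G\<^esub> e))"
    if [simp]: "x \<in> carrier H" "e \<in> carrier G"
  proof -
    have "FA (e_fun s) (upair x e) \<in> Ar (xcat \<chi>)"
      using E_Ar_functor_simps(2) [OF arrows(14,15), of "upair x e"] by simp
    then obtain y f where yf: "FA (e_fun s) (upair x e) = upair y f" and [simp]: "y \<in> carrier H" "f \<in> carrier G"
      by (auto elim!: uprodE)
    have "y \<otimes>\<^bsub>H\<^esub> x = \<one>\<^bsub>H\<^esub>" "f \<otimes>\<^bsub>G\<^esub> act \<chi> y e = \<one>\<^bsub>G\<^esub>"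
      using left_inverse(2) [of "upair x e"] by (simp_all add: yf)
    then have "inv\<^bsub>H\<^esub> x = y" "inv\<^bsub>G\<^esub> (act \<chi> y e) = f"
      by (simp_all add: H.inv_equality G.inv_equality)
    then show ?thesis
      using yf by simp
  qed
qed

section \<open>The Hopf coalgebra read off from a Hopf algebra\<close>

definition A :: "('u, 'o, 'a) hcoalg" where
  "A = \<lparr>h_obj = FO F, h_mlt = e_nat (mlt B), h_unt = e_nat (unt B),
     h_cmlt = (\<lambda>x y. if x \<in> carrier H \<and> y \<in> carrier H then e_nat (cmlt B) (upair x y) else undefined),
     h_cunt = e_nat (cunt B) upoint, h_ant = e_nat s,
     h_phi = (\<lambda>x e. if x \<in> carrier H \<and> e \<in> carrier G then FA F (upair x e) else undefined)\<rparr>"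

lemma A_simps [simp]:
  "h_obj A = FO F" "h_mlt A = e_nat (mlt B)" "h_unt A = e_nat (unt B)" "h_ant A = e_nat s"
  "\<lbrakk>x \<in> carrier H; y \<in> carrier H\<rbrakk> \<Longrightarrow> h_cmlt A x y = e_nat (cmlt B) (upair x y)"
  "h_cunt A = e_nat (cunt B) upoint"
  "\<lbrakk>x \<in> carrier H; e \<in> carrier G\<rbrakk> \<Longrightarrow> h_phi A x e = FA F (upair x e)"
  by (simp_all add: A_def)

lemma F_comp:
  assumes "x \<in> carrier H" "e \<in> carrier G" "f \<in> carrier G" "y = bd \<chi> e \<otimes>\<^bsub>H\<^esub> x"
  shows "FA F (upair y f) \<cdot> FA F (upair x e) = FA F (upair x (f \<otimes>\<^bsub>G\<^esub> e))"
  using E_Ob_simps(6) [OF arrows(1), of "upair y f" "upair x e"] assms by simp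

lemma F_one: "x \<in> carrier H \<Longrightarrow> FA F (upair x \<one>\<^bsub>G\<^esub>) = Idn S (FO F x)"
  using E_Ob_simps(5) [OF arrows(1), of x] by simp

text \<open>\<open>xcat\<close> is a groupoid, and functors preserve inverses.\<close>

lemma iso_F:
  assumes [simp]: "x \<in> carrier H" "e \<in> carrier G"
  shows "iso_arr S (FA F (upair x e))"
proof -
  have [simp]: "inv\<^bsub>H\<^esub> (bd \<chi> e) \<otimes>\<^bsub>H\<^esub> (bd \<chi> e \<otimes>\<^bsub>H\<^esub> x) = x"
    by simp
  have "inverse_arrows S (FA F (upair x e)) (FA F (upair (bd \<chi> e \<otimes>\<^bsub>H\<^esub> x) (inv\<^bsub>G\<^esub> e)))"
    by (simp add: inverse_arrows_def Hom_def F_comp F_one)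
  then show ?thesis
    by (auto simp: iso_arr_def)
qed

text \<open>These are the naturality squares of product and unit at the arrow
  \<open>upair x e\<close>.\<close>

lemma F_alg_hom:
  assumes [simp]: "x \<in> carrier H" "e \<in> carrier G"
  shows "algebra_hom S (FO F x) (e_nat (mlt B) x) (e_nat (unt B) x) (FO F (bd \<chi> e \<otimes>\<^bsub>H\<^esub> x))
    (e_nat (mlt B) (bd \<chi> e \<otimes>\<^bsub>H\<^esub> x)) (e_nat (unt B) (bd \<chi> e \<otimes>\<^bsub>H\<^esub> x)) (FA F (upair x e))"
proof -
  \<comment> \<open>The square of the unit has an identity of the unit object on one side; this
    typing removes it.\<close>
  have "e_nat (unt B) (bd \<chi> e \<otimes>\<^bsub>H\<^esub> x) \<in> Ar S" "Dom S (e_nat (unt B) (bd \<chi> e \<otimes>\<^bsub>H\<^esub> x)) = UnitO S"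
    using alg [of "bd \<chi> e \<otimes>\<^bsub>H\<^esub> x"] by (simp_all add: algebra_obj_def Hom_def)
  then show ?thesis
    using E_Ar_nat [OF arrows(2), of "upair x e"] E_Ar_nat [OF arrows(5), of "upair x e"]
    by (simp add: algebra_hom_def Hom_def)
qed

lemma F_comult:
  assumes [simp]: "x \<in> carrier H" "y \<in> carrier H" "e \<in> carrier G" "f \<in> carrier G"
  shows "(FA F (upair x e) \<boxdot> FA F (upair y f)) \<cdot> e_nat (cmlt B) (upair x y) =
    e_nat (cmlt B) (upair (bd \<chi> e \<otimes>\<^bsub>H\<^esub> x) (bd \<chi> f \<otimes>\<^bsub>H\<^esub> y)) \<cdot>
      FA F (upair (x \<otimes>\<^bsub>H\<^esub> y) (e \<otimes>\<^bsub>G\<^esub> act \<chi> x f))"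
  using E_Ar_nat [OF arrows(8), of "upair (upair x e) (upair y f)"] by simp

lemma ant_typing:
  assumes [simp]: "x \<in> carrier H"
  shows "e_nat s x \<in> Hom S (FO F (inv\<^bsub>H\<^esub> x)) (FO F x)" "iso_arr S (e_nat s x)"
proof -
  show "e_nat s x \<in> Hom S (FO F (inv\<^bsub>H\<^esub> x)) (FO F x)"
    using E_Ar_simps(6-8) [OF arrows(14), of x] by (simp add: Hom_def e_fun_antipode)
  show "iso_arr S (e_nat s x)"
    using iso_s iso_arr_E_imp_iso_arr(1) [of s _ x] by (auto simp: iso_arr_def)
qed

lemma hopf_coalgebra_A: "hopf_coalgebra S \<chi> A"
proof -
  have ext: "FO F \<in> extensional (carrier H)" "e_nat (mlt B) \<in> extensional (carrier H)"
    "e_nat (unt B) \<in> extensional (carrier H)" "e_nat s \<in> extensional (carrier H)"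
    using E_ObD(3) [OF arrows(1)] E_Ar_simps(5) [OF arrows(2)] E_Ar_simps(5) [OF arrows(5)]
      E_Ar_simps(5) [OF arrows(14)] by (simp_all add: is_functor_iff)
  have ext2: "extensional2 (carrier H) (carrier H) (h_cmlt A)" "extensional2 (carrier H) (carrier G) (h_phi A)"
    by (auto simp: A_def extensional2_def)
  show ?thesis
    unfolding hopf_coalgebra_def Let_def
    using ext ext2 alg comult_hom counit_hom ant_typing F_alg_hom iso_F coassoc counit_l counit_r
      ant_l ant_r F_one F_comp F_comult
    by (simp add: e_fun_antipode del: Cmp_TensA Cmp_TensA' Cmp_assoc_simp)
qed

lemma assoc_hopf_A: "assoc_hopf S (\<chi>, A) = B"
proof -
  interpret A: hopf_coalg S \<chi> A
    by unfold_locales (rule hopf_coalgebra_A)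
  \<comment> \<open>Every arrow of \<open>xcat\<close> is an encoded pair, so \<open>F\<close> is
    recovered from \<open>h_obj\<close> and \<open>h_phi\<close>.\<close>
  have "snd (assoc_obj (\<chi>, A)) = F"
    by (rule functor_eqI [of "xcat \<chi>" S])
      (use E_ObD(3) [OF A.X_Ob] E_ObD(3) [OF arrows(1)] in \<open>auto elim!: uprodE\<close>)
  then have X: "assoc_obj (\<chi>, A) = carr B"
    by (simp add: prod_eq_iff)
  show ?thesis
  proof (rule bialg.equality)
    show "carr (assoc_hopf S (\<chi>, A)) = carr B"
      using X by simp
    show "mlt (assoc_hopf S (\<chi>, A)) = mlt B"
      by (rule E_Ar_eqI) (use A.B_arrows A.B_simps X in simp_all)
    show "unt (assoc_hopf S (\<chi>, A)) = unt B"
      by (rule E_Ar_eqI) (use A.B_arrows A.B_simps X in simp_all)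
    show "cmlt (assoc_hopf S (\<chi>, A)) = cmlt B"
      by (rule E_Ar_eqI) (use A.B_arrows A.B_simps X in \<open>auto elim!: uprodE\<close>)
    show "cunt (assoc_hopf S (\<chi>, A)) = cunt B"
      by (rule E_Ar_eqI) (use A.B_arrows A.B_simps X in simp_all)
  qed simp
qed

end

section \<open>The crossed module of a group object in small categories\<close>

locale group_object = category C
  for C :: "'u::infinite scat" +
  fixes m u i :: "'u sfun"
  assumes m: "is_functor (prod_cat C C) C m" and u: "is_functor one_cat C u" and i: "is_functor C C i"
    and monoid: "functor_monoid C m u" and inverse: "functor_inverse C m u i"
begin

text \<open>The product is \<open>undefined\<close> off the carrier because \<open>GO\<close>
  becomes the group \<open>xH\<close> of a crossed module, which is required to be extensional.
  \<open>GA\<close> is only an auxiliary group and is left unguarded.\<close>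

definition GO :: "'u monoid" where
  "GO = \<lparr>carrier = Ob C, mult = \<lambda>x y. if x \<in> Ob C \<and> y \<in> Ob C then FO m (upair x y) else undefined,
     one = FO u upoint\<rparr>"

definition GA :: "'u monoid" where
  "GA = \<lparr>carrier = Ar C, mult = \<lambda>x y. FA m (upair x y), one = FA u upoint\<rparr>"

lemma carrier_simps [simp]: "carrier GO = Ob C" "carrier GA = Ar C"
  by (simp_all add: GO_def GA_def)

lemma FO_m: "\<lbrakk>x \<in> Ob C; y \<in> Ob C\<rbrakk> \<Longrightarrow> FO m (upair x y) = x \<otimes>\<^bsub>GO\<^esub> y"
  by (simp add: GO_def)

lemma FA_m: "FA m (upair f g) = f \<otimes>\<^bsub>GA\<^esub> g"
  by (simp add: GA_def)

lemma u_eq: "FO u upoint = \<one>\<^bsub>GO\<^esub>" "FA u upoint = \<one>\<^bsub>GA\<^esub>"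
  by (simp_all add: GO_def GA_def)

sublocale GO: group GO
proof (rule groupI)
  show "\<one>\<^bsub>GO\<^esub> \<in> carrier GO"
    using u by (simp add: GO_def is_functor_iff)
  show closed: "x \<otimes>\<^bsub>GO\<^esub> y \<in> carrier GO" if "x \<in> carrier GO" "y \<in> carrier GO" for x y
    using that m by (simp add: GO_def is_functor_iff)
  show "x \<otimes>\<^bsub>GO\<^esub> y \<otimes>\<^bsub>GO\<^esub> z = x \<otimes>\<^bsub>GO\<^esub> (y \<otimes>\<^bsub>GO\<^esub> z)"
    if "x \<in> carrier GO" "y \<in> carrier GO" "z \<in> carrier GO" for x y z
    using that monoid closed [of x y] closed [of y z] by (simp add: GO_def functor_monoid_def)
  show "\<one>\<^bsub>GO\<^esub> \<otimes>\<^bsub>GO\<^esub> x = x" if "x \<in> carrier GO" for x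
    using that monoid \<open>\<one>\<^bsub>GO\<^esub> \<in> carrier GO\<close> by (simp add: GO_def functor_monoid_def)
  show "\<exists>y \<in> carrier GO. y \<otimes>\<^bsub>GO\<^esub> x = \<one>\<^bsub>GO\<^esub>" if "x \<in> carrier GO" for x
    using that inverse i by (intro bexI [of _ "FO i x"]) (simp_all add: GO_def functor_inverse_def is_functor_iff)
qed

sublocale GA: group GA
proof (rule groupI)
  show "\<one>\<^bsub>GA\<^esub> \<in> carrier GA"
    using u by (simp add: GA_def is_functor_iff)
  show "x \<otimes>\<^bsub>GA\<^esub> y \<in> carrier GA" if "x \<in> carrier GA" "y \<in> carrier GA" for x y
    using that m by (simp add: GA_def is_functor_iff)
  show "x \<otimes>\<^bsub>GA\<^esub> y \<otimes>\<^bsub>GA\<^esub> z = x \<otimes>\<^bsub>GA\<^esub> (y \<otimes>\<^bsub>GA\<^esub> z)"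
    if "x \<in> carrier GA" "y \<in> carrier GA" "z \<in> carrier GA" for x y z
    using that monoid by (simp add: GA_def functor_monoid_def)
  show "\<one>\<^bsub>GA\<^esub> \<otimes>\<^bsub>GA\<^esub> x = x" if "x \<in> carrier GA" for x
    using that monoid by (simp add: GA_def functor_monoid_def)
  show "\<exists>y \<in> carrier GA. y \<otimes>\<^bsub>GA\<^esub> x = \<one>\<^bsub>GA\<^esub>" if "x \<in> carrier GA" for x
    using that inverse i by (intro bexI [of _ "FA i x"]) (simp_all add: GA_def functor_inverse_def is_functor_iff)
qed

lemma Dom_Cod_mult [simp]:
  assumes "f \<in> Ar C" "g \<in> Ar C"
  shows "Dom C (f \<otimes>\<^bsub>GA\<^esub> g) = Dom C f \<otimes>\<^bsub>GO\<^esub> Dom C g" "Cod C (f \<otimes>\<^bsub>GA\<^esub> g) = Cod C f \<otimes>\<^bsub>GO\<^esub> Cod C g"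
  using assms m by (simp_all add: is_functor_iff FO_m flip: FA_m)

lemma Idn_mult [simp]:
  assumes "x \<in> Ob C" "y \<in> Ob C"
  shows "Idn C (x \<otimes>\<^bsub>GO\<^esub> y) = Idn C x \<otimes>\<^bsub>GA\<^esub> Idn C y"
  using assms m by (simp add: is_functor_iff FO_m flip: FA_m)

sublocale Dom: group_hom GA GO "Dom C"
  by unfold_locales (auto simp: hom_def)

sublocale Cod: group_hom GA GO "Cod C"
  by unfold_locales (auto simp: hom_def)

sublocale Idn: group_hom GO GA "Idn C"
  by unfold_locales (auto simp: hom_def)

lemma interchange:
  assumes "composable C g f" "composable C g' f'"
  shows "(g \<otimes>\<^bsub>GA\<^esub> g') \<cdot>\<^bsub>C\<^esub> (f \<otimes>\<^bsub>GA\<^esub> f') = (g \<cdot>\<^bsub>C\<^esub> f) \<otimes>\<^bsub>GA\<^esub> (g' \<cdot>\<^bsub>C\<^esub> f')"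
proof -
  have "FA m (upair g g' \<cdot>\<^bsub>prod_cat C C\<^esub> upair f f') = FA m (upair g g') \<cdot>\<^bsub>C\<^esub> FA m (upair f f')"
    using m assms unfolding is_functor_iff by (metis composable_prod_cat)
  then show ?thesis
    using assms by (simp add: FA_m)
qed

lemma GA_closed [simp]:
  "\<lbrakk>f \<in> Ar C; g \<in> Ar C\<rbrakk> \<Longrightarrow> f \<otimes>\<^bsub>GA\<^esub> g \<in> Ar C" "f \<in> Ar C \<Longrightarrow> inv\<^bsub>GA\<^esub> f \<in> Ar C" "\<one>\<^bsub>GA\<^esub> \<in> Ar C"
  using GA.m_closed GA.inv_closed GA.one_closed by simp_all

lemma GA_cancel [simp]:
  assumes "x \<in> Ar C" "y \<in> Ar C"
  shows "inv\<^bsub>GA\<^esub> x \<otimes>\<^bsub>GA\<^esub> (x \<otimes>\<^bsub>GA\<^esub> y) = y" "x \<otimes>\<^bsub>GA\<^esub> (inv\<^bsub>GA\<^esub> x \<otimes>\<^bsub>GA\<^esub> y) = y"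
  using assms by (simp_all flip: GA.m_assoc)

lemma GO_closed [simp]:
  "\<lbrakk>x \<in> Ob C; y \<in> Ob C\<rbrakk> \<Longrightarrow> x \<otimes>\<^bsub>GO\<^esub> y \<in> Ob C" "x \<in> Ob C \<Longrightarrow> inv\<^bsub>GO\<^esub> x \<in> Ob C" "\<one>\<^bsub>GO\<^esub> \<in> Ob C"
  using GO.m_closed GO.inv_closed GO.one_closed by simp_all

lemma GO_cancel [simp]:
  assumes "x \<in> Ob C" "y \<in> Ob C"
  shows "inv\<^bsub>GO\<^esub> x \<otimes>\<^bsub>GO\<^esub> (x \<otimes>\<^bsub>GO\<^esub> y) = y" "x \<otimes>\<^bsub>GO\<^esub> (inv\<^bsub>GO\<^esub> x \<otimes>\<^bsub>GO\<^esub> y) = y"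
  using assms by (simp_all flip: GO.m_assoc)

lemma GA_simps [simp]:
  "\<lbrakk>f \<in> Ar C; g \<in> Ar C; h \<in> Ar C\<rbrakk> \<Longrightarrow> f \<otimes>\<^bsub>GA\<^esub> g \<otimes>\<^bsub>GA\<^esub> h = f \<otimes>\<^bsub>GA\<^esub> (g \<otimes>\<^bsub>GA\<^esub> h)"
  "f \<in> Ar C \<Longrightarrow> \<one>\<^bsub>GA\<^esub> \<otimes>\<^bsub>GA\<^esub> f = f" "f \<in> Ar C \<Longrightarrow> f \<otimes>\<^bsub>GA\<^esub> \<one>\<^bsub>GA\<^esub> = f"
  "f \<in> Ar C \<Longrightarrow> inv\<^bsub>GA\<^esub> f \<otimes>\<^bsub>GA\<^esub> f = \<one>\<^bsub>GA\<^esub>" "f \<in> Ar C \<Longrightarrow> f \<otimes>\<^bsub>GA\<^esub> inv\<^bsub>GA\<^esub> f = \<one>\<^bsub>GA\<^esub>"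
  by (simp_all add: GA.m_assoc)

lemma GO_simps [simp]:
  "\<lbrakk>x \<in> Ob C; y \<in> Ob C; z \<in> Ob C\<rbrakk> \<Longrightarrow> x \<otimes>\<^bsub>GO\<^esub> y \<otimes>\<^bsub>GO\<^esub> z = x \<otimes>\<^bsub>GO\<^esub> (y \<otimes>\<^bsub>GO\<^esub> z)"
  "x \<in> Ob C \<Longrightarrow> \<one>\<^bsub>GO\<^esub> \<otimes>\<^bsub>GO\<^esub> x = x" "x \<in> Ob C \<Longrightarrow> x \<otimes>\<^bsub>GO\<^esub> \<one>\<^bsub>GO\<^esub> = x"
  "x \<in> Ob C \<Longrightarrow> inv\<^bsub>GO\<^esub> x \<otimes>\<^bsub>GO\<^esub> x = \<one>\<^bsub>GO\<^esub>" "x \<in> Ob C \<Longrightarrow> x \<otimes>\<^bsub>GO\<^esub> inv\<^bsub>GO\<^esub> x = \<one>\<^bsub>GO\<^esub>"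
  by (simp_all add: GO.m_assoc)

text \<open>The Eckmann-Hilton argument.\<close>

lemma Cmp_eq:
  assumes "composable C g f"
  shows "g \<cdot>\<^bsub>C\<^esub> f = g \<otimes>\<^bsub>GA\<^esub> (inv\<^bsub>GA\<^esub> (Idn C (Cod C f)) \<otimes>\<^bsub>GA\<^esub> f)"
    "g \<cdot>\<^bsub>C\<^esub> f = f \<otimes>\<^bsub>GA\<^esub> (inv\<^bsub>GA\<^esub> (Idn C (Cod C f)) \<otimes>\<^bsub>GA\<^esub> g)"
proof -
  let ?y = "Cod C f"
  have [simp]: "f \<in> Ar C" "g \<in> Ar C" "Dom C g = ?y"
    using assms by (auto simp: composable_def)
  have one: "composable C h \<one>\<^bsub>GA\<^esub>" "h \<cdot>\<^bsub>C\<^esub> \<one>\<^bsub>GA\<^esub> = h" if "h \<in> Ar C" "Dom C h = \<one>\<^bsub>GO\<^esub>" for h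
    using that Cmp_Idn_simp [of h "\<one>\<^bsub>GO\<^esub>"] by (simp_all add: composable_def)
  \<comment> \<open>Write \<open>g\<close> as its quotient by the identity of \<open>?y\<close>
    times that identity, and \<open>f\<close> as the unit times \<open>f\<close>; interchange then
    composes factor by factor. The second formula places the quotient on the other side.\<close>
  show "g \<cdot>\<^bsub>C\<^esub> f = g \<otimes>\<^bsub>GA\<^esub> (inv\<^bsub>GA\<^esub> (Idn C ?y) \<otimes>\<^bsub>GA\<^esub> f)"
    using interchange [of "g \<otimes>\<^bsub>GA\<^esub> inv\<^bsub>GA\<^esub> (Idn C ?y)" "\<one>\<^bsub>GA\<^esub>" "Idn C ?y" f] by (simp add: one)
  show "g \<cdot>\<^bsub>C\<^esub> f = f \<otimes>\<^bsub>GA\<^esub> (inv\<^bsub>GA\<^esub> (Idn C ?y) \<otimes>\<^bsub>GA\<^esub> g)"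
    using interchange [of "Idn C ?y" f "inv\<^bsub>GA\<^esub> (Idn C ?y) \<otimes>\<^bsub>GA\<^esub> g" "\<one>\<^bsub>GA\<^esub>"] by (simp add: one)
qed

definition K :: "'u set" where
  "K = {f \<in> Ar C. Dom C f = \<one>\<^bsub>GO\<^esub>}"

lemma in_K_iff [simp]: "f \<in> K \<longleftrightarrow> f \<in> Ar C \<and> Dom C f = \<one>\<^bsub>GO\<^esub>"
  by (simp add: K_def)

text \<open>Dividing \<open>e\<close> by the identity of its codomain gives an arrow into the unit
  object, which can be composed with \<open>f\<close>. The two formulas of \<open>Cmp_eq\<close> for
  this composite say that the arrow commutes with \<open>f\<close>.\<close>

lemma peiffer:
  assumes ef: "e \<in> K" "f \<in> K"
  shows "Idn C (Cod C e) \<otimes>\<^bsub>GA\<^esub> (f \<otimes>\<^bsub>GA\<^esub> inv\<^bsub>GA\<^esub> (Idn C (Cod C e))) = e \<otimes>\<^bsub>GA\<^esub> (f \<otimes>\<^bsub>GA\<^esub> inv\<^bsub>GA\<^esub> e)"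
proof -
  let ?c = "Idn C (Cod C e)"
  have [simp]: "e \<in> Ar C" "f \<in> Ar C" "Dom C e = \<one>\<^bsub>GO\<^esub>" "Dom C f = \<one>\<^bsub>GO\<^esub>"
    using ef by simp_all
  have "composable C f (inv\<^bsub>GA\<^esub> ?c \<otimes>\<^bsub>GA\<^esub> e)"
    by simp
  then have "f \<otimes>\<^bsub>GA\<^esub> (inv\<^bsub>GA\<^esub> ?c \<otimes>\<^bsub>GA\<^esub> e) = inv\<^bsub>GA\<^esub> ?c \<otimes>\<^bsub>GA\<^esub> (e \<otimes>\<^bsub>GA\<^esub> f)"
    using Cmp_eq [of f "inv\<^bsub>GA\<^esub> ?c \<otimes>\<^bsub>GA\<^esub> e"] by simp
  then have "?c \<otimes>\<^bsub>GA\<^esub> (f \<otimes>\<^bsub>GA\<^esub> (inv\<^bsub>GA\<^esub> ?c \<otimes>\<^bsub>GA\<^esub> e)) \<otimes>\<^bsub>GA\<^esub> inv\<^bsub>GA\<^esub> e =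
      ?c \<otimes>\<^bsub>GA\<^esub> (inv\<^bsub>GA\<^esub> ?c \<otimes>\<^bsub>GA\<^esub> (e \<otimes>\<^bsub>GA\<^esub> f)) \<otimes>\<^bsub>GA\<^esub> inv\<^bsub>GA\<^esub> e"
    by simp
  then show ?thesis
    by simp
qed

definition \<chi> :: "'u xmod" where
  "\<chi> = \<lparr>xE = \<lparr>carrier = K, mult = \<lambda>e f. if e \<in> K \<and> f \<in> K then e \<otimes>\<^bsub>GA\<^esub> f else undefined, one = \<one>\<^bsub>GA\<^esub>\<rparr>,
     xH = GO, bd = restrict (Cod C) K,
     act = \<lambda>x e. if x \<in> Ob C \<and> e \<in> K then Idn C x \<otimes>\<^bsub>GA\<^esub> (e \<otimes>\<^bsub>GA\<^esub> inv\<^bsub>GA\<^esub> (Idn C x)) else undefined\<rparr>"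

lemma \<chi>_simps [simp]:
  "carrier (xE \<chi>) = K" "\<one>\<^bsub>xE \<chi>\<^esub> = \<one>\<^bsub>GA\<^esub>" "xH \<chi> = GO"
  "\<lbrakk>e \<in> K; f \<in> K\<rbrakk> \<Longrightarrow> e \<otimes>\<^bsub>xE \<chi>\<^esub> f = e \<otimes>\<^bsub>GA\<^esub> f"
  "e \<in> K \<Longrightarrow> bd \<chi> e = Cod C e"
  "\<lbrakk>x \<in> Ob C; e \<in> K\<rbrakk> \<Longrightarrow> act \<chi> x e = Idn C x \<otimes>\<^bsub>GA\<^esub> (e \<otimes>\<^bsub>GA\<^esub> inv\<^bsub>GA\<^esub> (Idn C x))"
  by (simp_all add: \<chi>_def)

lemma group_xE: "group (xE \<chi>)"
proof (rule groupI)
  show "\<exists>y \<in> carrier (xE \<chi>). y \<otimes>\<^bsub>xE \<chi>\<^esub> x = \<one>\<^bsub>xE \<chi>\<^esub>" if "x \<in> carrier (xE \<chi>)" for x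
    using that by (intro bexI [of _ "inv\<^bsub>GA\<^esub> x"]) simp_all
qed simp_all

lemma inv_xE [simp]: "e \<in> K \<Longrightarrow> inv\<^bsub>xE \<chi>\<^esub> e = inv\<^bsub>GA\<^esub> e"
  by (rule group.inv_equality [OF group_xE]) simp_all

lemma act_hom_xE: "x \<in> Ob C \<Longrightarrow> act \<chi> x \<in> hom (xE \<chi>) (xE \<chi>)"
  by (auto simp: hom_def)

lemma act_Bij:
  assumes "x \<in> Ob C"
  shows "act \<chi> x \<in> Bij (carrier (xE \<chi>))"
proof -
  have "bij_betw (act \<chi> x) K K"
    by (rule bij_betw_byWitness [where f' = "act \<chi> (inv\<^bsub>GO\<^esub> x)"]) (use assms in auto)
  moreover have "act \<chi> x \<in> extensional K"
    by (auto simp: \<chi>_def extensional_def)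
  ultimately show ?thesis
    by (simp add: Bij_def)
qed

text \<open>Equivariance of \<open>bd\<close> holds because \<open>Cod C\<close> is a homomorphism
  that sends the identity of \<open>x\<close> to \<open>x\<close>; the other crossed module law is
  \<open>peiffer\<close>.\<close>

lemma crossed_module_\<chi>: "crossed_module \<chi>"
proof -
  have "act \<chi> (x \<otimes>\<^bsub>GO\<^esub> y) = compose K (act \<chi> x) (act \<chi> y)" if "x \<in> Ob C" "y \<in> Ob C" for x y
    by (rule extensionalityI [of _ K])
      (use that in \<open>auto simp: compose_def GA.inv_mult_group, auto simp: \<chi>_def extensional_def\<close>)
  then have "act \<chi> \<in> hom GO (AutoGroup (xE \<chi>))"
    using act_hom_xE act_Bij by (auto simp: hom_def AutoGroup_def auto_def BijGroup_def)
  moreover have "bd \<chi> \<in> hom (xE \<chi>) GO \<inter> extensional K"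
    by (auto simp: hom_def) (simp add: \<chi>_def)
  moreover have "extensional2 K K (mult (xE \<chi>))" "extensional2 (Ob C) (Ob C) (mult GO)"
    "extensional2 (Ob C) K (act \<chi>)"
    by (auto simp: \<chi>_def GO_def extensional2_def)
  ultimately show ?thesis
    using group_xE GO.group_axioms peiffer by (simp add: crossed_module_def)
qed

sublocale X: crossed_mod \<chi>
  by unfold_locales (rule crossed_module_\<chi>)

section \<open>The isomorphism between a group object and the category of its crossed module\<close>

definition \<Phi> :: "'u sfun" where
  "\<Phi> = \<lparr>FO = \<lambda>x \<in> Ob C. x, FA = \<lambda>f \<in> uprod (Ob C) K. usnd f \<otimes>\<^bsub>GA\<^esub> Idn C (ufst f)\<rparr>"

definition \<Psi> :: "'u sfun" where
  "\<Psi> = \<lparr>FO = \<lambda>x \<in> Ob C. x, FA = \<lambda>f \<in> Ar C. upair (Dom C f) (f \<otimes>\<^bsub>GA\<^esub> inv\<^bsub>GA\<^esub> (Idn C (Dom C f)))\<rparr>"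

lemma \<Phi>\<Psi>_simps [simp]:
  "x \<in> Ob C \<Longrightarrow> FO \<Phi> x = x" "x \<in> Ob C \<Longrightarrow> FO \<Psi> x = x"
  "\<lbrakk>x \<in> Ob C; e \<in> K\<rbrakk> \<Longrightarrow> FA \<Phi> (upair x e) = e \<otimes>\<^bsub>GA\<^esub> Idn C x"
  "f \<in> Ar C \<Longrightarrow> FA \<Psi> f = upair (Dom C f) (f \<otimes>\<^bsub>GA\<^esub> inv\<^bsub>GA\<^esub> (Idn C (Dom C f)))"
  by (simp_all add: \<Phi>_def \<Psi>_def)

lemma functor_\<Phi>: "is_functor (xcat \<chi>) C \<Phi>"
proof -
  have "FA \<Phi> (k \<cdot>\<^bsub>xcat \<chi>\<^esub> h) = FA \<Phi> k \<cdot>\<^bsub>C\<^esub> FA \<Phi> h" if "composable (xcat \<chi>) k h" for k h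
    using that
  proof (rule X.composable_xcatE)
    fix x e f
    assume *: "h = upair x e" "k = upair (bd \<chi> e \<otimes>\<^bsub>xH \<chi>\<^esub> x) f"
      and "x \<in> carrier (xH \<chi>)" "e \<in> carrier (xE \<chi>)" "f \<in> carrier (xE \<chi>)"
    then have [simp]: "x \<in> Ob C" "e \<in> Ar C" "f \<in> Ar C" "Dom C e = \<one>\<^bsub>GO\<^esub>" "Dom C f = \<one>\<^bsub>GO\<^esub>"
      by simp_all
    have "composable C (FA \<Phi> k) (FA \<Phi> h)"
      by (simp add: *)
    \<comment> \<open>In \<open>Cmp_eq\<close> the inverse of the identity of the intermediate
      object cancels the one contained in \<open>FA \<Phi> k\<close>.\<close>
    then show ?thesis
      by (simp add: * Cmp_eq(1) GA.inv_mult_group)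
  qed
  moreover have "FO \<Phi> \<in> extensional (Ob C)" "FA \<Phi> \<in> extensional (uprod (Ob C) K)"
    by (simp_all add: \<Phi>_def)
  ultimately show ?thesis
    unfolding is_functor_iff by simp
qed

lemma functor_\<Psi>: "is_functor C (xcat \<chi>) \<Psi>"
proof -
  have "FA \<Psi> (k \<cdot>\<^bsub>C\<^esub> h) = FA \<Psi> k \<cdot>\<^bsub>xcat \<chi>\<^esub> FA \<Psi> h" if c: "composable C k h" for k h
  proof -
    have [simp]: "k \<in> Ar C" "h \<in> Ar C" "Dom C k = Cod C h"
      using c by (auto simp: composable_def)
    show ?thesis
      using c by (simp add: Cmp_eq(1))
  qed
  moreover have "FO \<Psi> \<in> extensional (Ob C)" "FA \<Psi> \<in> extensional (Ar C)"
    by (simp_all add: \<Psi>_def)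
  ultimately show ?thesis
    unfolding is_functor_iff by simp
qed

lemma \<Phi>_\<Psi>:
  "f \<in> Ar C \<Longrightarrow> FA \<Phi> (FA \<Psi> f) = f"
  "f \<in> uprod (Ob C) K \<Longrightarrow> FA \<Psi> (FA \<Phi> f) = f"
  by (auto elim!: uprodE)

end

section \<open>The correspondence\<close>

context symmetric_monoidal_category
begin

lemma bialgebra_hom_Idn:
  assumes "bialgebra_obj M B"
  shows "bialgebra_hom M B B (Idn M (carr B))"
  using bialgebra_objD [OF assms] by (simp add: bialgebra_hom_def algebra_hom_def Hom_def)

lemma bialgebra_hom_Cmp:
  assumes B: "bialgebra_obj M B" "bialgebra_obj M B'" "bialgebra_obj M B''"
    and f: "bialgebra_hom M B B' f" and g: "bialgebra_hom M B' B'' g"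
  shows "bialgebra_hom M B B'' (g \<cdot> f)"
proof -
  note [simp] = bialgebra_objD [OF B(1)] bialgebra_objD [OF B(2)] bialgebra_objD [OF B(3)]
  have [simp]: "f \<in> Ar M" "Dom M f = carr B" "Cod M f = carr B'"
    "g \<in> Ar M" "Dom M g = carr B'" "Cod M g = carr B''"
    and f': "f \<cdot> mlt B = mlt B' \<cdot> (f \<boxdot> f)" "f \<cdot> unt B = unt B'"
      "cmlt B' \<cdot> f = (f \<boxdot> f) \<cdot> cmlt B" "cunt B' \<cdot> f = cunt B"
    and g': "g \<cdot> mlt B' = mlt B'' \<cdot> (g \<boxdot> g)" "g \<cdot> unt B' = unt B''"
      "cmlt B'' \<cdot> g = (g \<boxdot> g) \<cdot> cmlt B'" "cunt B'' \<cdot> g = cunt B'"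
    using f g by (auto simp: bialgebra_hom_def algebra_hom_def Hom_def)
  have "(g \<cdot> f) \<cdot> mlt B = (g \<cdot> mlt B') \<cdot> (f \<boxdot> f)"
    by (simp add: f'(1))
  also have "\<dots> = mlt B'' \<cdot> ((g \<cdot> f) \<boxdot> (g \<cdot> f))"
    unfolding g' by simp
  finally have 1: "(g \<cdot> f) \<cdot> mlt B = \<dots>" .
  have "cmlt B'' \<cdot> (g \<cdot> f) = (cmlt B'' \<cdot> g) \<cdot> f"
    by simp
  also have "\<dots> = (g \<boxdot> g) \<cdot> (cmlt B' \<cdot> f)"
    unfolding g' by simp
  also have "\<dots> = ((g \<cdot> f) \<boxdot> (g \<cdot> f)) \<cdot> cmlt B"
    unfolding f' by simp
  finally have 2: "cmlt B'' \<cdot> (g \<cdot> f) = \<dots>" .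
  have "cunt B'' \<cdot> (g \<cdot> f) = (cunt B'' \<cdot> g) \<cdot> f"
    by simp
  then have 3: "cunt B'' \<cdot> (g \<cdot> f) = cunt B"
    unfolding g' f' .
  show ?thesis
    using 1 2 3 f'(2) g'(2) by (simp add: bialgebra_hom_def algebra_hom_def Hom_def)
qed

text \<open>Once \<open>B'\<close> is written as a transport of \<open>B\<close>, the equations for
  \<open>g\<close> are cancellations.\<close>

lemma bialgebra_hom_inverse:
  assumes B: "bialgebra_obj M B" "bialgebra_obj M B'"
    and f: "bialgebra_hom M B B' f" and g: "inverse_arrows M f g"
  shows "bialgebra_hom M B' B g"
proof -
  note [simp] = bialgebra_objD [OF B(1)] bialgebra_objD [OF B(2)]
  have [simp]: "f \<in> Ar M" "Dom M f = carr B" "Cod M f = carr B'"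
    using f by (auto simp: bialgebra_hom_def algebra_hom_def Hom_def)
  note [simp] = inverse_arrowsD [OF g] inverse_arrows_Cmp_cancel [OF g]
  have B': "B' = transport f g B"
    by (rule iso_bialgebra_hom_imp_transport [OF B(1) f g]) simp_all
  have "mlt B' = f \<cdot> mlt B \<cdot> (g \<boxdot> g)" "unt B' = f \<cdot> unt B" "cmlt B' = (f \<boxdot> f) \<cdot> cmlt B \<cdot> g"
    "cunt B' = cunt B \<cdot> g"
    by (subst B', simp add: transport_def)+
  then show ?thesis
    by (simp add: bialgebra_hom_def algebra_hom_def Hom_def)
qed

end

text \<open>Provides the functor of the inverse arrow when an isomorphism of crossed modules is
  turned into an isomorphism of \<open>E S\<close>.\<close>

lemma ex_inverse_functor:
  assumes C: "category C" and D: "category D" and F: "is_functor C D F"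
    and O: "bij_betw (FO F) (Ob C) (Ob D)" and A: "bij_betw (FA F) (Ar C) (Ar D)"
  obtains K where "is_functor D C K"
    "\<And>x. x \<in> Ob D \<Longrightarrow> FO F (FO K x) = x" "\<And>f. f \<in> Ar D \<Longrightarrow> FA F (FA K f) = f"
    "\<And>x. x \<in> Ob C \<Longrightarrow> FO K (FO F x) = x" "\<And>f. f \<in> Ar C \<Longrightarrow> FA K (FA F f) = f"
proof -
  interpret C: category C by fact
  interpret D: category D by fact
  define K where "K = \<lparr>FO = restrict (inv_into (Ob C) (FO F)) (Ob D), FA = restrict (inv_into (Ar C) (FA F)) (Ar D)\<rparr>"
  have FK: "FO F (FO K x) = x" "FO K x \<in> Ob C" if "x \<in> Ob D" for x
    using that bij_betw_inv_into_right [OF O] bij_betwE [OF bij_betw_inv_into [OF O]] by (auto simp: K_def)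
  have FK': "FA F (FA K f) = f" "FA K f \<in> Ar C" if "f \<in> Ar D" for f
    using that bij_betw_inv_into_right [OF A] bij_betwE [OF bij_betw_inv_into [OF A]] by (auto simp: K_def)
  have KF: "FO K (FO F x) = x" if "x \<in> Ob C" for x
    using that bij_betw_inv_into_left [OF O] bij_betwE [OF O] by (simp add: K_def)
  have KF': "FA K (FA F f) = f" if "f \<in> Ar C" for f
    using that bij_betw_inv_into_left [OF A] bij_betwE [OF A] by (simp add: K_def)
  have F': "Dom D (FA F f) = FO F (Dom C f)" "Cod D (FA F f) = FO F (Cod C f)" if "f \<in> Ar C" for f
    using F that unfolding is_functor_iff by blast+
  have F_Idn: "FA F (Idn C x) = Idn D (FO F x)" if "x \<in> Ob C" for x
    using F that unfolding is_functor_iff by blast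
  have F_Cmp: "FA F (g \<cdot>\<^bsub>C\<^esub> f) = FA F g \<cdot>\<^bsub>D\<^esub> FA F f" if "composable C g f" for g f
    using F that unfolding is_functor_iff by blast
  have dom: "Dom C (FA K f) = FO K (Dom D f)" "Cod C (FA K f) = FO K (Cod D f)" if "f \<in> Ar D" for f
    using F' [of "FA K f"] KF [of "Dom C (FA K f)"] KF [of "Cod C (FA K f)"] FK' that by simp_all
  have "FA K (Idn D x) = Idn C (FO K x)" if "x \<in> Ob D" for x
    using F_Idn [of "FO K x"] KF' [of "Idn C (FO K x)"] FK that by simp
  moreover have "FA K (g \<cdot>\<^bsub>D\<^esub> f) = FA K g \<cdot>\<^bsub>C\<^esub> FA K f" if "composable D g f" for g f
  proof -
    have fg: "f \<in> Ar D" "g \<in> Ar D" "Dom D g = Cod D f"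
      using that by (auto simp: composable_def)
    then have "composable C (FA K g) (FA K f)"
      using FK' dom by (simp add: composable_def)
    then show ?thesis
      using F_Cmp [of "FA K g" "FA K f"] KF' [of "FA K g \<cdot>\<^bsub>C\<^esub> FA K f"] FK' fg by simp
  qed
  moreover have "FO K \<in> extensional (Ob D)" "FA K \<in> extensional (Ar D)"
    by (simp_all add: K_def)
  ultimately have "is_functor D C K"
    unfolding is_functor_iff using FK FK' dom by simp
  then show thesis
    using that FK FK' KF KF' by blast
qed

text \<open>The image of a class of \<open>r\<close> need not be a whole class of \<open>s\<close>,
  hence the saturation by \<open>s\<close>. Injectivity comes from \<open>f\<close> reflecting the
  relations, surjectivity from \<open>f\<close> meeting every class of \<open>s\<close>.\<close>

lemma bij_betw_quotients:
  assumes r: "equiv A r" and s: "equiv B s"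
    and f: "\<And>a. a \<in> A \<Longrightarrow> f a \<in> B"
    and rs: "\<And>a a'. \<lbrakk>a \<in> A; a' \<in> A\<rbrakk> \<Longrightarrow> (a, a') \<in> r \<longleftrightarrow> (f a, f a') \<in> s"
    and surj: "\<And>b. b \<in> B \<Longrightarrow> \<exists>a \<in> A. (f a, b) \<in> s"
  shows "bij_betw (\<lambda>c. s `` (f ` c)) (A // r) (B // s)"
proof -
  \<comment> \<open>Saturation makes the image of a class depend on any one representative
    alone.\<close>
  have eq: "s `` (f ` (r `` {a})) = s `` {f a}" if "a \<in> A" for a
  proof -
    have "s `` {f a'} = s `` {f a}" if "a' \<in> r `` {a}" for a'
    proof -
      have "(a, a') \<in> r" "a' \<in> A"
        using that equivE [OF r] by (auto simp: refl_on_def)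
      then show ?thesis
        using equiv_class_eq [OF s] rs \<open>a \<in> A\<close> by blast
    qed
    moreover have "a \<in> r `` {a}"
      using equiv_class_self [OF r that] .
    ultimately show ?thesis
      by blast
  qed
  show ?thesis
  proof (rule bij_betw_imageI)
    show "inj_on (\<lambda>c. s `` (f ` c)) (A // r)"
    proof (rule inj_onI)
      fix c c' assume "c \<in> A // r" "c' \<in> A // r" and cc: "s `` (f ` c) = s `` (f ` c')"
      then obtain a a' where a: "a \<in> A" "c = r `` {a}" "a' \<in> A" "c' = r `` {a'}"
        by (auto elim!: quotientE)
      then have "s `` {f a} = s `` {f a'}"
        using cc eq by simp
      then have "(f a, f a') \<in> s"
        using a f by (intro eq_equiv_class [OF _ s]) auto
      then show "c = c'"
        using a rs equiv_class_eq [OF r] by blast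
    qed
    show "(\<lambda>c. s `` (f ` c)) ` (A // r) = B // s"
    proof (intro equalityI subsetI)
      fix d assume "d \<in> (\<lambda>c. s `` (f ` c)) ` (A // r)"
      then obtain a where "a \<in> A" "d = s `` {f a}"
        using eq by (auto elim!: quotientE)
      then show "d \<in> B // s"
        using f by (auto intro: quotientI)
    next
      fix d assume "d \<in> B // s"
      then obtain b where "b \<in> B" "d = s `` {b}"
        by (auto elim!: quotientE)
      then obtain a where a: "a \<in> A" "(f a, b) \<in> s"
        using surj by blast
      then have "d = s `` (f ` (r `` {a}))"
        using eq equiv_class_eq [OF s a(2)] \<open>d = s `` {b}\<close> by simp
      then show "d \<in> (\<lambda>c. s `` (f ` c)) ` (A // r)"
        using a by (auto intro: quotientI)
    qed
  qed
qed

context smc_base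
begin

lemma equiv_hopf_ident: "equiv (hopfs S) (hopf_ident S :: ('u::infinite, 'o, 'a) ebialg rel)"
proof (rule equivI)
  interpret E: symmetric_monoidal_category "E S :: (('u, 'o, 'a) eobj, ('u, 'o, 'a) earr) smc"
    by (rule symmetric_monoidal_category_E)
  show "hopf_ident S \<subseteq> (hopfs S \<times> hopfs S :: ('u, 'o, 'a) ebialg rel)"
    by (auto simp: hopf_ident_def)
  show "refl_on (hopfs S) (hopf_ident S :: ('u, 'o, 'a) ebialg rel)"
  proof (rule refl_onI)
    fix B :: "('u, 'o, 'a) ebialg" assume B: "B \<in> hopfs S"
    then have b: "bialgebra_obj (E S) B"
      by (simp add: hopfs_def hopf_algebra_def)
    have "iso_arr (E S) (Idn (E S) (carr B))"
      using E.iso_arr_Idn E.bialgebra_objD(1) [OF b] by simp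
    then show "(B, B) \<in> hopf_ident S"
      using B E.bialgebra_hom_Idn [OF b] by (auto simp: hopf_ident_def intro!: exI [of _ "Idn (E S) (carr B)"])
  qed
  show "sym (hopf_ident S :: ('u, 'o, 'a) ebialg rel)"
  proof (rule symI)
    fix B B' :: "('u, 'o, 'a) ebialg" assume BB': "(B, B') \<in> hopf_ident S"
    then obtain f where b: "bialgebra_obj (E S) B" "bialgebra_obj (E S) B'"
      and f: "bialgebra_hom (E S) B B' f" "iso_arr (E S) f"
      and id: "\<And>y. y \<in> Ob (fst (carr B')) \<Longrightarrow> e_nat f y = Idn S (FO (snd (carr B')) y)"
      by (auto simp: hopf_ident_def hopfs_def hopf_algebra_def)
    obtain g where g: "inverse_arrows (E S) f g"
      using f by (auto simp: iso_arr_def)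
    have [simp]: "f \<in> E_Ar S" "e_dom f = carr B" "e_cod f = carr B'"
      using f by (auto simp: bialgebra_hom_def algebra_hom_def Hom_def)
    have [simp]: "g \<in> E_Ar S" "e_dom g = carr B'" "e_cod g = carr B"
      using E.inverse_arrowsD [OF g] by simp_all
    have [simp]: "carr B \<in> E_Ob S" "carr B' \<in> E_Ob S"
      using E.bialgebra_objD [OF b(1)] E.bialgebra_objD [OF b(2)] by simp_all
    have "e_nat g x = Idn S (FO (snd (carr B)) x)" if x [simp]: "x \<in> Ob (fst (carr B))" for x
    proof -
      let ?y = "FO (e_fun g) x"
      have y [simp]: "?y \<in> Ob (fst (carr B'))" "FO (e_fun f) ?y = x"
        using iso_arr_E_imp_iso_arr(2) [OF E.inverse_arrows_sym [OF g], of x] by simp_all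
      \<comment> \<open>The component of \<open>g\<close> at \<open>x\<close> inverts the component
        of \<open>f\<close> at \<open>?y\<close>, which is an identity.\<close>
      have "inverse_arrows S (Idn S (FO (snd (carr B')) ?y)) (e_nat g x)"
        using iso_arr_E_imp_iso_arr(1) [OF g, of ?y] id [OF y(1)] by simp
      then have "e_nat g x = Idn S (FO (snd (carr B')) ?y)"
        using inverse_arrows_unique inverse_arrows_Idn [of "FO (snd (carr B')) ?y"] by simp
      \<comment> \<open>An identity component has equal domain and codomain, which identifies the
        objects assigned by the two functors.\<close>
      moreover have "FO (snd (carr B')) ?y = FO (snd (carr B)) x"
        using E_Ar_simps(7) [of f ?y] id [OF y(1)] by simp
      ultimately show ?thesis
        by simp
    qed
    moreover have "iso_arr (E S) g"
      using E.inverse_arrows_sym [OF g] by (auto simp: iso_arr_def)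
    ultimately show "(B', B) \<in> hopf_ident S"
      using BB' E.bialgebra_hom_inverse [OF b f(1) g] by (auto simp: hopf_ident_def)
  qed
  show "trans (hopf_ident S :: ('u, 'o, 'a) ebialg rel)"
  proof (rule transI)
    fix B B' B'' :: "('u, 'o, 'a) ebialg" assume BB': "(B, B') \<in> hopf_ident S" "(B', B'') \<in> hopf_ident S"
    then obtain f g where b: "bialgebra_obj (E S) B" "bialgebra_obj (E S) B'" "bialgebra_obj (E S) B''"
      and f: "bialgebra_hom (E S) B B' f" "iso_arr (E S) f"
      and g: "bialgebra_hom (E S) B' B'' g" "iso_arr (E S) g"
      and id: "\<And>y. y \<in> Ob (fst (carr B')) \<Longrightarrow> e_nat f y = Idn S (FO (snd (carr B')) y)"
      and id': "\<And>y. y \<in> Ob (fst (carr B'')) \<Longrightarrow> e_nat g y = Idn S (FO (snd (carr B'')) y)"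
      by (auto simp: hopf_ident_def hopfs_def hopf_algebra_def)
    have [simp]: "f \<in> E_Ar S" "e_dom f = carr B" "e_cod f = carr B'"
      "g \<in> E_Ar S" "e_dom g = carr B'" "e_cod g = carr B''"
      using f g by (auto simp: bialgebra_hom_def algebra_hom_def Hom_def)
    have [simp]: "carr B'' \<in> E_Ob S"
      using E.bialgebra_objD [OF b(3)] by simp
    obtain f' g' where "inverse_arrows (E S) f f'" "inverse_arrows (E S) g g'"
      using f g by (auto simp: iso_arr_def)
    then have "iso_arr (E S) (g \<cdot>\<^bsub>E S\<^esub> f)"
      using E.inverse_arrows_Cmp [of f f' g g'] by (auto simp: iso_arr_def)
    moreover have "e_nat (g \<cdot>\<^bsub>E S\<^esub> f) y = Idn S (FO (snd (carr B'')) y)" if y [simp]: "y \<in> Ob (fst (carr B''))" for y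
    proof -
      have "FO (snd (carr B')) (FO (e_fun g) y) = FO (snd (carr B'')) y"
        using E_Ar_simps(7) [of g y] id' [OF y] by simp
      then show ?thesis
        using id [of "FO (e_fun g) y"] id' [OF y] by simp
    qed
    ultimately show "(B, B'') \<in> hopf_ident S"
      using BB' E.bialgebra_hom_Cmp [OF b f(1) g(1)]
      by (auto simp: hopf_ident_def intro!: exI [of _ "g \<cdot>\<^bsub>E S\<^esub> f"])
  qed
qed

end

lemma is_functor_comp_functor:
  assumes "category A" and F: "is_functor A B F" and G: "is_functor B C G"
  shows "is_functor A C (comp_functor A G F)"
proof -
  interpret A: category A by fact
  have "FA (comp_functor A G F) (g \<cdot>\<^bsub>A\<^esub> f) = FA (comp_functor A G F) g \<cdot>\<^bsub>C\<^esub> FA (comp_functor A G F) f"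
    if c: "composable A g f" for g f
  proof -
    have "composable B (FA F g) (FA F f)" "f \<in> Ar A" "g \<in> Ar A"
      using F c by (simp_all add: is_functor_iff composable_def)
    then show ?thesis
      using F G c by (simp add: is_functor_iff)
  qed
  then show ?thesis
    using F G by (simp add: is_functor_iff)
qed

section \<open>Moving an arbitrary Hopf algebra over the group object of a crossed module\<close>

context hopf_E
begin

lemma group_object: "group_object C m u (e_fun s)"
proof -
  have "category C"
    by (rule E_ObD) simp
  moreover have "is_functor (prod_cat C C) C m" "is_functor one_cat C u" "is_functor C C (e_fun s)"
    using arrows(8-16) unfolding E_Ar_def by simp_all
  ultimately show ?thesis
    using monoid inverse by (intro group_object.intro group_object_axioms.intro)
qed

lemma ex_hopf_over_xmod:
  assumes "iso_arr (E S) s"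
  shows "\<exists>B' \<chi>. crossed_module \<chi> \<and> cat_part B' = xmod_hopf \<chi> \<and> (B, B') \<in> hopf_ident S"
proof -
  interpret X: group_object C m u "e_fun s"
    by (rule group_object)
  interpret E: symmetric_monoidal_category "E S :: (('u, 'o, 'a) eobj, ('u, 'o, 'a) earr) smc"
    by (rule symmetric_monoidal_category_E)
  \<comment> \<open>The family is reindexed along \<open>X.\<Phi>\<close> so that all components of
    \<open>f\<close> can be identities.\<close>
  let ?Z = "(xcat X.\<chi>, comp_functor (xcat X.\<chi>) F X.\<Phi>)"
  define f where "f = \<lparr>e_dom = carr B, e_cod = ?Z, e_fun = X.\<Phi>, e_nat = \<lambda>x \<in> Ob C. Idn S (FO F x)\<rparr>"
  have \<Phi>A: "FA X.\<Phi> h \<in> Ar C" "Dom C (FA X.\<Phi> h) = Dom (xcat X.\<chi>) h" "Cod C (FA X.\<Phi> h) = Cod (xcat X.\<chi>) h"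
    if "h \<in> uprod (Ob C) X.K" for h
    using X.functor_\<Phi> that by (auto simp: is_functor_iff elim!: uprodE)
  have "is_functor (xcat X.\<chi>) S (comp_functor (xcat X.\<chi>) F X.\<Phi>)"
    using X.X.small_category_xcat X.functor_\<Phi> E_ObD(3) [OF arrows(1)]
    by (intro is_functor_comp_functor) (simp_all add: small_category_def)
  then have Z: "?Z \<in> E_Ob S"
    using X.X.small_category_xcat by (simp add: E_Ob_def)
  have f [simp]: "f \<in> E_Ar S" "e_dom f = carr B" "e_cod f = ?Z"
    and f_fun [simp]: "e_fun f = X.\<Phi>"
    and f_nat: "\<And>x. x \<in> Ob C \<Longrightarrow> e_nat f x = Idn S (FO F x)"
  proof -
    show "f \<in> E_Ar S"
      by (rule E_ArI_functor [where X = "carr B" and Y = ?Z])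
        (use Z X.functor_\<Phi> \<Phi>A in \<open>auto simp: f_def elim!: uprodE\<close>)
  qed (simp_all add: f_def)
  have iso: "iso_arr S (e_nat f x)" if "x \<in> Ob C" for x
    using that iso_arr_Idn by (simp add: f_nat)
  define g where "g = \<lparr>e_dom = ?Z, e_cod = carr B, e_fun = X.\<Psi>,
    e_nat = \<lambda>x \<in> Ob (fst (carr B)). inv_arr S (e_nat f (FO X.\<Psi> x))\<rparr>"
  have fg: "inverse_arrows (E S) f g"
    unfolding g_def
    by (rule inverse_arrows_E) (use X.functor_\<Psi> X.\<Phi>_\<Psi> iso in \<open>simp_all\<close>)
  have g [simp]: "g \<in> E_Ar S" "e_dom g = ?Z" "e_cod g = carr B" "e_fun g = X.\<Psi>"
    using E.inverse_arrowsD [OF fg] by (simp_all add: g_def)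
  define B' where "B' = E.transport f g B"
  have df: "Dom (E S) f = carr B"
    by simp
  have hopf: "hopf_algebra (E S) B"
    using bialg antipode assms by (auto simp: hopf_algebra_def)
  have B': "hopf_algebra (E S) B'" "bialgebra_hom (E S) B B' f"
    unfolding B'_def
    using E.hopf_algebra_transport [OF bialg fg df hopf] E.bialgebra_hom_transport [OF bialg fg df] by simp_all
  have carr_B': "carr B' = ?Z"
    by (simp add: B'_def E.transport_def)
  have "cat_part B' = xmod_hopf X.\<chi>"
  proof (rule bialg.equality)
    \<comment> \<open>Conjugating the antipode puts \<open>B'\<close> into the locale again, so the
      typing of its structure functors and the diagonal are available.\<close>
    interpret B': hopf_E S B' "f \<cdot>\<^bsub>E S\<^esub> s \<cdot>\<^bsub>E S\<^esub> g"
      by unfold_locales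
        (use B' E.antipode_transport [OF bialg fg df antipode] in \<open>simp_all add: hopf_algebra_def B'_def\<close>)
    show "carr (cat_part B') = carr (xmod_hopf X.\<chi>)"
      by (simp add: cat_part_def xmod_hopf_def carr_B')
    show "mlt (cat_part B') = mlt (xmod_hopf X.\<chi>)"
      unfolding cat_part_def xmod_hopf_def bialg.simps
    proof (rule functor_eqI)
      show "is_functor (prod_cat (xcat X.\<chi>) (xcat X.\<chi>)) (xcat X.\<chi>) (e_fun (cmlt B'))"
        using B'.arrows(8-10) unfolding E_Ar_def carr_B' by simp
      show "is_functor (prod_cat (xcat X.\<chi>) (xcat X.\<chi>)) (xcat X.\<chi>) (xmult X.\<chi>)"
        by (rule X.X.functor_xmult)
    \<comment> \<open>On arrows the transported product sends (x,e) and (z,f) to e id_x f id_z times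
      the inverse of id_xz, that is, to e times the conjugate of f by id_x. This is why the action
      is conjugation.\<close>
    qed (auto simp: B'_def E.transport_def X.FO_m X.FA_m X.GA.inv_mult_group elim!: uprodE)
    show "unt (cat_part B') = unt (xmod_hopf X.\<chi>)"
      unfolding cat_part_def xmod_hopf_def bialg.simps
    proof (rule functor_eqI)
      show "is_functor one_cat (xcat X.\<chi>) (e_fun (cunt B'))"
        using B'.arrows(11-13) unfolding E_Ar_def carr_B' by simp
      show "is_functor one_cat (xcat X.\<chi>) (xunit X.\<chi>)"
        by (rule X.X.functor_xunit)
    qed (auto simp: B'_def E.transport_def X.u_eq elim!: uprodE)
    show "cmlt (cat_part B') = cmlt (xmod_hopf X.\<chi>)"
      unfolding cat_part_def xmod_hopf_def bialg.simps
    proof (rule functor_eqI)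
      show "is_functor (xcat X.\<chi>) (prod_cat (xcat X.\<chi>) (xcat X.\<chi>)) (e_fun (mlt B'))"
        using B'.arrows(2-4) unfolding E_Ar_def carr_B' by simp
      show "is_functor (xcat X.\<chi>) (prod_cat (xcat X.\<chi>) (xcat X.\<chi>)) (xdiag X.\<chi>)"
        by (rule X.X.functor_xdiag)
    \<comment> \<open>The diagonal is forced for every Hopf algebra of \<open>E S\<close>, so it
      determines this functor without unfolding the transport.\<close>
    qed (use B'.diag in \<open>simp_all add: carr_B'\<close>)
    show "cunt (cat_part B') = cunt (xmod_hopf X.\<chi>)"
      unfolding cat_part_def xmod_hopf_def bialg.simps
    proof (rule functor_eqI)
      show "is_functor (xcat X.\<chi>) one_cat (e_fun (unt B'))"
        using B'.arrows(5-7) unfolding E_Ar_def carr_B' by simp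
      show "is_functor (xcat X.\<chi>) one_cat (xcounit X.\<chi>)"
        by (rule X.X.functor_xcounit)
    qed (use e_fun_unit [OF B'.arrows(1-7)] in \<open>simp_all add: carr_B'\<close>)
  qed simp
  moreover have "iso_arr (E S) f"
    using fg by (auto simp: iso_arr_def)
  then have "(B, B') \<in> hopf_ident S"
    unfolding hopf_ident_def hopfs_def
    using B' hopf by (auto simp: carr_B' f_nat intro!: exI [of _ f])
  ultimately show ?thesis
    using X.crossed_module_\<chi> by blast
qed

end

lemma extensional2_eqI:
  assumes "extensional2 X Y f" "extensional2 X Y g"
    and "\<And>x y. \<lbrakk>x \<in> X; y \<in> Y\<rbrakk> \<Longrightarrow> f x y = g x y"
  shows "f = g"
  using assms unfolding extensional2_def by (intro ext) metis

section \<open>Comparison of two Hopf coalgebras with their Hopf algebras\<close>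

locale two_hopf_coalgs = P: hopf_coalg S \<chi> A + Q: hopf_coalg S \<chi>' A'
  for S :: "('o, 'a) smc" (structure) and \<chi> :: "'u::infinite xmod" and A and \<chi>' :: "'u xmod" and A'
begin

text \<open>All data of the crossed module are visible in its group object: \<open>bd\<close> in the
  codomains of arrows out of the unit object, the product of \<open>xE\<close> in composition, the
  product of \<open>xH\<close> and the action in \<open>xmult\<close>.\<close>

lemma assoc_hopf_inj:
  assumes eq: "P.B = Q.B"
  shows "\<chi> = \<chi>' \<and> A = A'"
proof -
  interpret E: symmetric_monoidal_category "E S :: (('u, 'o, 'a) eobj, ('u, 'o, 'a) earr) smc"
    by (rule P.symmetric_monoidal_category_E)
  have X: "assoc_obj (\<chi>, A) = assoc_obj (\<chi>', A')"
    using arg_cong [OF eq, of carr] by simp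
  have xcat: "xcat \<chi> = xcat \<chi>'"
    using arg_cong [OF X, of fst] by simp
  have xmult: "xmult \<chi> = xmult \<chi>'"
    using arg_cong [OF eq, of "\<lambda>B. e_fun (cmlt B)"] by simp
  have xunit: "xunit \<chi> = xunit \<chi>'"
    using arg_cong [OF eq, of "\<lambda>B. e_fun (cunt B)"] by simp
  have H [simp]: "carrier Q.H = carrier P.H"
    using arg_cong [OF xcat, of Ob] by simp
  have one: "\<one>\<^bsub>Q.H\<^esub> = \<one>\<^bsub>P.H\<^esub>" "\<one>\<^bsub>Q.G\<^esub> = \<one>\<^bsub>P.G\<^esub>"
    using arg_cong [OF xunit, of "\<lambda>F. FO F upoint"] arg_cong [OF xunit, of "\<lambda>F. FA F upoint"] by simp_all
  have G [simp]: "carrier Q.G = carrier P.G"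
  proof -
    have "e \<in> carrier Q.G \<longleftrightarrow> e \<in> carrier P.G" for e
      using arg_cong [OF xcat, of "\<lambda>C. upair \<one>\<^bsub>P.H\<^esub> e \<in> Ar C"] by simp
    then show ?thesis
      by blast
  qed
  have mult_H: "x \<otimes>\<^bsub>P.H\<^esub> y = x \<otimes>\<^bsub>Q.H\<^esub> y" if "x \<in> carrier P.H" "y \<in> carrier P.H" for x y
    using arg_cong [OF xmult, of "\<lambda>F. FO F (upair x y)"] that by simp
  have bd: "bd \<chi> e = bd \<chi>' e" if "e \<in> carrier P.G" for e
    using arg_cong [OF xcat, of "\<lambda>C. Cod C (upair \<one>\<^bsub>P.H\<^esub> e)"] that
      P.bd.hom_closed [of e] Q.bd.hom_closed [of e] Q.H.r_one [of "bd \<chi>' e"]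
    by (simp add: one)
  have mult_G: "e \<otimes>\<^bsub>P.G\<^esub> f = e \<otimes>\<^bsub>Q.G\<^esub> f" if "e \<in> carrier P.G" "f \<in> carrier P.G" for e f
  proof -
    \<comment> \<open>Composing two arrows, the first of them out of the unit object, exhibits the
      product of \<open>xE\<close>.\<close>
    have "upair (bd \<chi> f) e \<cdot>\<^bsub>xcat \<chi>\<^esub> upair \<one>\<^bsub>P.H\<^esub> f = upair (bd \<chi>' f) e \<cdot>\<^bsub>xcat \<chi>'\<^esub> upair \<one>\<^bsub>Q.H\<^esub> f"
      using that bd xcat one by simp
    moreover have "upair (bd \<chi> f) e \<cdot>\<^bsub>xcat \<chi>\<^esub> upair \<one>\<^bsub>P.H\<^esub> f = upair \<one>\<^bsub>P.H\<^esub> (e \<otimes>\<^bsub>P.G\<^esub> f)"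
      using that by (intro P.xcat_simps) simp_all
    moreover have "upair (bd \<chi>' f) e \<cdot>\<^bsub>xcat \<chi>'\<^esub> upair \<one>\<^bsub>Q.H\<^esub> f = upair \<one>\<^bsub>Q.H\<^esub> (e \<otimes>\<^bsub>Q.G\<^esub> f)"
      using that Q.bd.hom_closed [of f] Q.H.r_one [of "bd \<chi>' f"] Q.H.one_closed by (intro Q.xcat_simps) simp_all
    ultimately show ?thesis
      by simp
  qed
  have act: "act \<chi> x e = act \<chi>' x e" if "x \<in> carrier P.H" "e \<in> carrier P.G" for x e
  proof -
    \<comment> \<open>Multiplying the identity of \<open>x\<close> by an arrow out of the unit
      object isolates the action.\<close>
    have "FA (xmult \<chi>) (upair (upair x \<one>\<^bsub>P.G\<^esub>) (upair \<one>\<^bsub>P.H\<^esub> e)) = upair x (act \<chi> x e)"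
      using that by simp
    moreover have "FA (xmult \<chi>') (upair (upair x \<one>\<^bsub>Q.G\<^esub>) (upair \<one>\<^bsub>Q.H\<^esub> e)) = upair x (act \<chi>' x e)"
      using that Q.xfun_simps(2) [of x "\<one>\<^bsub>Q.H\<^esub>" "\<one>\<^bsub>Q.G\<^esub>" e] Q.H.one_closed Q.G.one_closed
        Q.act_closed [of x e] Q.H.r_one [of x] Q.G.l_one [of "act \<chi>' x e"] by simp
    ultimately show ?thesis
      using xmult one by simp
  qed
  note ext = P.extensional_xmod Q.extensional_xmod [unfolded G H]
  have "P.H = Q.H"
  proof (rule monoid.equality)
    show "mult P.H = mult Q.H"
      using ext(2,6) mult_H by (rule extensional2_eqI)
  qed (simp_all add: one)
  moreover have "P.G = Q.G"
  proof (rule monoid.equality)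
    show "mult P.G = mult Q.G"
      using ext(1,5) mult_G by (rule extensional2_eqI)
  qed (simp_all add: one)
  moreover have "bd \<chi> = bd \<chi>'"
    using ext(3,7) bd by (rule extensionalityI)
  moreover have "act \<chi> = act \<chi>'"
    using ext(4,8) act by (rule extensional2_eqI)
  ultimately have \<chi>: "\<chi> = \<chi>'"
    by (intro xmod.equality) simp_all
  \<comment> \<open>The record \<open>bialg\<close> does not mention the antipode; both arrows are
    antipodes of the same bialgebra.\<close>
  have ant: "assoc_antipode (\<chi>, A) = assoc_antipode (\<chi>', A')"
    by (rule E.antipode_unique [OF P.bialgebra_obj_B P.antipode_B]) (use Q.antipode_B eq in simp)
  have "A = A'"
  proof (rule hcoalg.equality)
    show "h_obj A = h_obj A'"
      using arg_cong [OF X, of "\<lambda>X. FO (snd X)"] by simp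
    show "h_mlt A = h_mlt A'"
      using arg_cong [OF eq, of "\<lambda>B. e_nat (mlt B)"] by simp
    show "h_unt A = h_unt A'"
      using arg_cong [OF eq, of "\<lambda>B. e_nat (unt B)"] by simp
    show "h_cunt A = h_cunt A'"
      using arg_cong [OF eq, of "\<lambda>B. e_nat (cunt B) upoint"] by simp
    show "h_ant A = h_ant A'"
      using arg_cong [OF ant, of e_nat] by simp
    show "h_cmlt A = h_cmlt A'"
    proof (rule extensional2_eqI [OF P.extensional_A(4) Q.extensional_A(4) [unfolded G H]])
      show "h_cmlt A x y = h_cmlt A' x y" if "x \<in> carrier P.H" "y \<in> carrier P.H" for x y
        using arg_cong [OF eq, of "\<lambda>B. e_nat (cmlt B) (upair x y)"] that by simp
    qed
    show "h_phi A = h_phi A'"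
    proof (rule extensional2_eqI [OF P.extensional_A(6) Q.extensional_A(6) [unfolded G H]])
      show "h_phi A x e = h_phi A' x e" if "x \<in> carrier P.H" "e \<in> carrier P.G" for x e
        using arg_cong [OF X, of "\<lambda>X. FA (snd X) (upair x e)"] that by simp
    qed
  qed simp
  with \<chi> show ?thesis
    by simp
qed

lemma pairs: "(\<chi>, A) \<in> xpairs S" "(\<chi>', A') \<in> xpairs S"
  using P.A Q.A P.crossed_module Q.crossed_module by (simp_all add: xpairs_def)

lemma hopfs: "P.B \<in> hopfs S" "Q.B \<in> hopfs S"
  using P.hopf_algebra_B Q.hopf_algebra_B by (simp_all add: hopfs_def)

text \<open>An isomorphism \<open>(k, h)\<close> of crossed modules gives an arrow of \<open>E S\<close> in the opposite direction.\<close>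

lemma xpair_ident_imp_hopf_ident:
  assumes "((\<chi>, A), (\<chi>', A')) \<in> xpair_ident S"
  shows "(Q.B, P.B) \<in> hopf_ident S"
proof -
  obtain k h where kh: "xmod_iso \<chi> \<chi>' k h"
    and A': "\<And>x. x \<in> carrier P.H \<Longrightarrow> h_obj A' (h x) = h_obj A x"
      "\<And>x. x \<in> carrier P.H \<Longrightarrow> h_mlt A' (h x) = h_mlt A x"
      "\<And>x. x \<in> carrier P.H \<Longrightarrow> h_unt A' (h x) = h_unt A x"
      "\<And>x y. \<lbrakk>x \<in> carrier P.H; y \<in> carrier P.H\<rbrakk> \<Longrightarrow> h_cmlt A' (h x) (h y) = h_cmlt A x y"
      "\<And>x e. \<lbrakk>x \<in> carrier P.H; e \<in> carrier P.G\<rbrakk> \<Longrightarrow> h_phi A' (h x) (k e) = h_phi A x e"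
      "h_cunt A' = h_cunt A"
    using assms by (auto simp: xpair_ident_def)
  have k: "k \<in> hom P.G Q.G" "bij_betw k (carrier P.G) (carrier Q.G)"
    and h: "h \<in> hom P.H Q.H" "bij_betw h (carrier P.H) (carrier Q.H)"
    using kh by (auto simp: xmod_iso_def iso_def)
  interpret k: group_hom "P.G" "Q.G" k
    using k(1) by unfold_locales
  interpret h: group_hom "P.H" "Q.H" h
    using h(1) by unfold_locales
  have bd: "bd \<chi>' (k e) = h (bd \<chi> e)" if "e \<in> carrier P.G" for e
    using kh that by (simp add: xmod_iso_def)
  have act: "act \<chi>' (h x) (k e) = k (act \<chi> x e)" if "x \<in> carrier P.H" "e \<in> carrier P.G" for x e
    using kh that by (simp add: xmod_iso_def)
  define T where "T = \<lparr>FO = restrict h (carrier P.H),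
    FA = \<lambda>f \<in> uprod (carrier P.H) (carrier P.G). upair (h (ufst f)) (k (usnd f))\<rparr>"
  have T [simp]: "x \<in> carrier P.H \<Longrightarrow> FO T x = h x"
    "\<lbrakk>x \<in> carrier P.H; e \<in> carrier P.G\<rbrakk> \<Longrightarrow> FA T (upair x e) = upair (h x) (k e)" for x e
    by (simp_all add: T_def)
  have functor_T: "is_functor (xcat \<chi>) (xcat \<chi>') T"
  proof -
    have "FA T (g \<cdot>\<^bsub>xcat \<chi>\<^esub> f) = FA T g \<cdot>\<^bsub>xcat \<chi>'\<^esub> FA T f" if "composable (xcat \<chi>) g f" for g f
      using that by (auto simp: bd elim!: P.composable_xcatE)
    moreover have "FO T \<in> extensional (carrier P.H)"
      "FA T \<in> extensional (uprod (carrier P.H) (carrier P.G))"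
      by (simp_all add: T_def)
    ultimately show ?thesis
      unfolding is_functor_iff by (simp add: bd)
  qed
  have TO: "bij_betw (FO T) (carrier P.H) (carrier Q.H)"
    using h(2) by (simp add: T_def bij_betw_def inj_on_def)
  have TA: "bij_betw (FA T) (uprod (carrier P.H) (carrier P.G)) (uprod (carrier Q.H) (carrier Q.G))"
  proof (rule bij_betw_imageI)
    show "inj_on (FA T) (uprod (carrier P.H) (carrier P.G))"
      using h(2) k(2) by (auto simp: bij_betw_def inj_on_def elim!: uprodE)
    have "upair y f \<in> FA T ` uprod (carrier P.H) (carrier P.G)"
      if y: "y \<in> carrier Q.H" and f: "f \<in> carrier Q.G" for y f
    proof -
      have "y \<in> h ` carrier P.H" "f \<in> k ` carrier P.G"
        using h(2) k(2) y f by (simp_all add: bij_betw_imp_surj_on)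
      then obtain x e where "x \<in> carrier P.H" "y = h x" "e \<in> carrier P.G" "f = k e"
        by blast
      then show ?thesis
        by (intro image_eqI [of _ _ "upair x e"]) simp_all
    qed
    then show "FA T ` uprod (carrier P.H) (carrier P.G) = uprod (carrier Q.H) (carrier Q.G)"
      by (auto elim!: uprodE)
  qed
  obtain K where K: "is_functor (xcat \<chi>') (xcat \<chi>) K"
    "\<And>x. x \<in> carrier Q.H \<Longrightarrow> FO T (FO K x) = x"
    "\<And>f. f \<in> Ar (xcat \<chi>') \<Longrightarrow> FA T (FA K f) = f"
    "\<And>x. x \<in> carrier P.H \<Longrightarrow> FO K (FO T x) = x"
    "\<And>f. f \<in> Ar (xcat \<chi>) \<Longrightarrow> FA K (FA T f) = f"
    using ex_inverse_functor [OF _ _ functor_T] TO TA P.small_category_xcat Q.small_category_xcat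
    by (metis P.xcat_simps(1,2) Q.xcat_simps(1,2) small_category_def)
  \<comment> \<open>Identities are well typed as components because \<open>h_obj A' (h x)\<close>
    equals \<open>h_obj A x\<close>.\<close>
  define f where "f = \<lparr>e_dom = Q.X, e_cod = P.X, e_fun = T, e_nat = \<lambda>x \<in> carrier P.H. Idn S (h_obj A x)\<rparr>"
  have f [simp]: "e_dom f = Q.X" "e_cod f = P.X" "e_fun f = T"
    "x \<in> carrier P.H \<Longrightarrow> e_nat f x = Idn S (h_obj A x)" for x
    by (simp_all add: f_def)
  have f_arrow [simp]: "f \<in> E_Ar S"
    by (rule P.E_ArI_functor [where X = Q.X and Y = P.X])
      (use functor_T in \<open>auto simp: A' f_def elim!: uprodE\<close>)
  have iso: "iso_arr (E S) f"
    unfolding iso_arr_def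
    by (intro exI) (rule P.inverse_arrows_E [OF f_arrow f(1,2), of K],
      use K P.iso_arr_Idn in simp_all)
  have "f \<cdot>\<^bsub>E S\<^esub> mlt Q.B = mlt P.B \<cdot>\<^bsub>E S\<^esub> (f \<boxdot>\<^bsub>E S\<^esub> f)"
    by (rule P.E_Ar_eqI) (auto simp: P.E_arrows A' elim!: uprodE)
  moreover have "f \<cdot>\<^bsub>E S\<^esub> unt Q.B = unt P.B"
    by (rule P.E_Ar_eqI) (auto simp: P.E_arrows A' elim!: uprodE)
  moreover have "cmlt P.B \<cdot>\<^bsub>E S\<^esub> f = (f \<boxdot>\<^bsub>E S\<^esub> f) \<cdot>\<^bsub>E S\<^esub> cmlt Q.B"
    by (rule P.E_Ar_eqI) (auto simp: P.E_arrows A' act elim!: uprodE)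
  moreover have "cunt P.B \<cdot>\<^bsub>E S\<^esub> f = cunt Q.B"
    by (rule P.E_Ar_eqI) (auto simp: P.E_arrows A')
  ultimately have "bialgebra_hom (E S) Q.B P.B f"
    by (simp add: bialgebra_hom_def algebra_hom_def Hom_def)
  then show ?thesis
    using iso hopfs by (auto simp: hopf_ident_def)
qed

text \<open>An isomorphism of small categories that respects the product is determined by its effect
  on objects and on arrows out of the unit object. These two maps form the isomorphism of crossed
  modules.\<close>

lemma hopf_ident_imp_xpair_ident:
  assumes "(Q.B, P.B) \<in> hopf_ident S"
  shows "((\<chi>, A), (\<chi>', A')) \<in> xpair_ident S"
proof -
  interpret E: symmetric_monoidal_category "E S :: (('u, 'o, 'a) eobj, ('u, 'o, 'a) earr) smc"
    by (rule P.symmetric_monoidal_category_E)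
  obtain f where hom: "bialgebra_hom (E S) Q.B P.B f" and iso: "iso_arr (E S) f"
    and id: "\<And>x. x \<in> carrier P.H \<Longrightarrow> e_nat f x = Idn S (h_obj A x)"
    using assms by (auto simp: hopf_ident_def)
  have f [simp]: "f \<in> E_Ar S" "e_dom f = Q.X" "e_cod f = P.X"
    and f_mlt: "f \<cdot>\<^bsub>E S\<^esub> mlt Q.B = mlt P.B \<cdot>\<^bsub>E S\<^esub> (f \<boxdot>\<^bsub>E S\<^esub> f)" and f_unt: "f \<cdot>\<^bsub>E S\<^esub> unt Q.B = unt P.B"
    and f_cmlt: "cmlt P.B \<cdot>\<^bsub>E S\<^esub> f = (f \<boxdot>\<^bsub>E S\<^esub> f) \<cdot>\<^bsub>E S\<^esub> cmlt Q.B" and f_cunt: "cunt P.B \<cdot>\<^bsub>E S\<^esub> f = cunt Q.B"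
    using hom by (auto simp: bialgebra_hom_def algebra_hom_def Hom_def)
  have f_ant: "assoc_antipode (\<chi>, A) \<cdot>\<^bsub>E S\<^esub> f = f \<cdot>\<^bsub>E S\<^esub> assoc_antipode (\<chi>', A')"
    by (rule E.iso_bialgebra_hom_antipode [OF Q.bialgebra_obj_B P.bialgebra_obj_B hom iso Q.antipode_B P.antipode_B])
  obtain g where g: "inverse_arrows (E S) f g"
    using iso by (auto simp: iso_arr_def)
  have [simp]: "g \<in> E_Ar S" "e_dom g = P.X" "e_cod g = Q.X"
    and gf: "g \<cdot>\<^bsub>E S\<^esub> f = Idn (E S) Q.X" and fg: "f \<cdot>\<^bsub>E S\<^esub> g = Idn (E S) P.X"
    using E.inverse_arrowsD [OF g] by simp_all
  define h where "h = FO (e_fun f)"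
  \<comment> \<open>\<open>k\<close> is the effect on arrows out of the unit object;
    \<open>f_one\<close> shows that their images again start at the unit object.\<close>
  define k where "k = (\<lambda>e. usnd (FA (e_fun f) (upair \<one>\<^bsub>P.H\<^esub> e)))"
  have h_closed [simp]: "h x \<in> carrier Q.H" if "x \<in> carrier P.H" for x
    using P.E_Ar_functor_simps(1) [OF f(1,2), of x] that by (simp add: h_def)
  have h_mult: "h (x \<otimes>\<^bsub>P.H\<^esub> y) = h x \<otimes>\<^bsub>Q.H\<^esub> h y" if "x \<in> carrier P.H" "y \<in> carrier P.H" for x y
    using arg_cong [OF f_cmlt, of "\<lambda>f. FO (e_fun f) (upair x y)"] that h_closed [of x] h_closed [of y]
    by (simp add: h_def)
  have h_one [simp]: "h \<one>\<^bsub>P.H\<^esub> = \<one>\<^bsub>Q.H\<^esub>"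
    using arg_cong [OF f_cunt, of "\<lambda>f. FO (e_fun f) upoint"] by (simp add: h_def)
  let ?Ar = "uprod (carrier P.H) (carrier P.G)" and ?Ar' = "uprod (carrier Q.H) (carrier Q.G)"
  have fA: "FA (e_fun f) a \<in> ?Ar'" if "a \<in> ?Ar" for a
    using P.E_Ar_functor_simps(2) [OF f(1,2), of a] that by simp
  have f_mult: "FA (e_fun f) (FA (xmult \<chi>) (upair a b)) =
      FA (xmult \<chi>') (upair (FA (e_fun f) a) (FA (e_fun f) b))" if "a \<in> ?Ar" "b \<in> ?Ar" for a b
    using arg_cong [OF f_cmlt, of "\<lambda>f. FA (e_fun f) (upair a b)"] that fA by simp
  have f_one: "FA (e_fun f) (upair \<one>\<^bsub>P.H\<^esub> e) = upair \<one>\<^bsub>Q.H\<^esub> (k e) \<and> k e \<in> carrier Q.G"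
    if e: "e \<in> carrier P.G" for e
  proof -
    obtain y e' where ye: "FA (e_fun f) (upair \<one>\<^bsub>P.H\<^esub> e) = upair y e'" "y \<in> carrier Q.H" "e' \<in> carrier Q.G"
      using fA [of "upair \<one>\<^bsub>P.H\<^esub> e"] e by (auto elim!: uprodE)
    have "y = Dom (xcat \<chi>') (FA (e_fun f) (upair \<one>\<^bsub>P.H\<^esub> e))"
      using ye by simp
    also have "\<dots> = \<one>\<^bsub>Q.H\<^esub>"
      using P.E_Ar_functor_simps(3) [OF f(1,2), of "upair \<one>\<^bsub>P.H\<^esub> e"] e h_one by (simp add: h_def)
    finally show ?thesis
      using ye by (simp add: k_def)
  qed
  then have k_closed [simp]: "k e \<in> carrier Q.G" if "e \<in> carrier P.G" for e
    using that by blast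
  have f_Idn: "FA (e_fun f) (upair x \<one>\<^bsub>P.G\<^esub>) = upair (h x) \<one>\<^bsub>Q.G\<^esub>" if x: "x \<in> carrier P.H" for x
    using P.E_Ar_functor_simps(5) [OF f(1,3), of x] x h_closed [OF x] by (simp add: h_def)
  \<comment> \<open>\<open>upair x e\<close> is the product of \<open>upair \<one> e\<close> and the
    identity of \<open>x\<close>, and the images of both factors are known.\<close>
  have f_eq: "FA (e_fun f) (upair x e) = upair (h x) (k e)" if "x \<in> carrier P.H" "e \<in> carrier P.G" for x e
    using f_mult [of "upair \<one>\<^bsub>P.H\<^esub> e" "upair x \<one>\<^bsub>P.G\<^esub>"] that f_one [of e] f_Idn [of x] by simp
  have k_mult: "k (e \<otimes>\<^bsub>P.G\<^esub> e') = k e \<otimes>\<^bsub>Q.G\<^esub> k e'" if "e \<in> carrier P.G" "e' \<in> carrier P.G" for e e'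
    using f_mult [of "upair \<one>\<^bsub>P.H\<^esub> e" "upair \<one>\<^bsub>P.H\<^esub> e'"] that by (simp add: f_eq)
  \<comment> \<open>The product in the other order, identity of \<open>x\<close> first, has second
    coordinate \<open>act \<chi> x e\<close>.\<close>
  have act: "k (act \<chi> x e) = act \<chi>' (h x) (k e)" if "x \<in> carrier P.H" "e \<in> carrier P.G" for x e
    using f_mult [of "upair x \<one>\<^bsub>P.G\<^esub>" "upair \<one>\<^bsub>P.H\<^esub> e"] that f_Idn [of x] f_one [of e] by (simp add: f_eq)
  have bd: "bd \<chi>' (k e) = h (bd \<chi> e)" if "e \<in> carrier P.G" for e
    using P.E_Ar_functor_simps(4) [OF f(1,2), of "upair \<one>\<^bsub>P.H\<^esub> e"] that f_one [OF that] by (simp add: h_def)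
  have gO: "FO (e_fun g) y \<in> carrier P.H" if "y \<in> carrier Q.H" for y
    using P.E_Ar_functor_simps(1) [of g P.X y] that by simp
  have gA: "FA (e_fun g) a \<in> ?Ar" if "a \<in> ?Ar'" for a
    using P.E_Ar_functor_simps(2) [of g P.X a] that by simp
  have hg: "h (FO (e_fun g) y) = y" if "y \<in> carrier Q.H" for y
    using arg_cong [OF gf, of "\<lambda>f. FO (e_fun f) y"] that by (simp add: h_def)
  have gh: "FO (e_fun g) (h x) = x" if "x \<in> carrier P.H" for x
    using arg_cong [OF fg, of "\<lambda>f. FO (e_fun f) x"] that by (simp add: h_def)
  have fgA: "FA (e_fun f) (FA (e_fun g) a) = a" if "a \<in> ?Ar'" for a
    using arg_cong [OF gf, of "\<lambda>f. FA (e_fun f) a"] that by simp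
  have gfA: "FA (e_fun g) (FA (e_fun f) a) = a" if "a \<in> ?Ar" for a
    using arg_cong [OF fg, of "\<lambda>f. FA (e_fun f) a"] that by simp
  have "h \<in> iso P.H Q.H"
  proof -
    have "bij_betw h (carrier P.H) (carrier Q.H)"
      by (rule bij_betw_byWitness [where f' = "FO (e_fun g)"]) (auto simp: hg gh gO)
    then show ?thesis
      by (auto simp: iso_def hom_def h_mult)
  qed
  moreover have "k \<in> iso P.G Q.G"
  proof -
    have "inj_on k (carrier P.G)"
    proof (rule inj_onI)
      fix e e' assume e: "e \<in> carrier P.G" "e' \<in> carrier P.G" "k e = k e'"
      then have eq: "FA (e_fun f) (upair \<one>\<^bsub>P.H\<^esub> e) = FA (e_fun f) (upair \<one>\<^bsub>P.H\<^esub> e')"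
        by (simp add: f_eq)
      have "upair \<one>\<^bsub>P.H\<^esub> e = FA (e_fun g) (FA (e_fun f) (upair \<one>\<^bsub>P.H\<^esub> e))"
        using e(1) by (simp add: gfA)
      also have "\<dots> = upair \<one>\<^bsub>P.H\<^esub> e'"
        unfolding eq using e(2) by (simp add: gfA)
      finally show "e = e'"
        by simp
    qed
    moreover have "e' \<in> k ` carrier P.G" if "e' \<in> carrier Q.G" for e'
    proof -
      have "FA (e_fun g) (upair \<one>\<^bsub>Q.H\<^esub> e') \<in> ?Ar"
        using that by (intro gA) simp
      then obtain x e where xe: "FA (e_fun g) (upair \<one>\<^bsub>Q.H\<^esub> e') = upair x e" "x \<in> carrier P.H" "e \<in> carrier P.G"
        by (rule uprodE)
      then have "k e = e'"
        using fgA [of "upair \<one>\<^bsub>Q.H\<^esub> e'"] that by (simp add: f_eq)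
      then show ?thesis
        using xe by blast
    qed
    ultimately have "bij_betw k (carrier P.G) (carrier Q.G)"
      by (intro bij_betw_imageI) auto
    then show ?thesis
      by (auto simp: iso_def hom_def k_mult)
  qed
  ultimately have "xmod_iso \<chi> \<chi>' k h"
    by (simp add: xmod_iso_def bd act)
  moreover have obj: "h_obj A x = h_obj A' (h x)" if "x \<in> carrier P.H" for x
    using P.E_Ar_simps(7) [OF f(1), of x] id [OF that] that by (simp add: h_def)
  moreover have "h_mlt A x = h_mlt A' (h x)" if x: "x \<in> carrier P.H" for x
    using arg_cong [OF f_mlt, of "\<lambda>f. e_nat f x"] x h_closed [OF x] obj [OF x] by (simp add: id flip: h_def)
  moreover have "h_unt A x = h_unt A' (h x)" if x: "x \<in> carrier P.H" for x
    using arg_cong [OF f_unt, of "\<lambda>f. e_nat f x"] x h_closed [OF x] obj [OF x] by (simp add: id flip: h_def)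
  \<comment> \<open>Here the fact is used that an isomorphism of bialgebras commutes with
    antipodes.\<close>
  moreover have "h_ant A x = h_ant A' (h x)" if x: "x \<in> carrier P.H" for x
    using arg_cong [OF f_ant, of "\<lambda>f. e_nat f x"] x h_closed [OF x] obj [OF x]
      obj [of "inv\<^bsub>P.H\<^esub> x"] by (simp add: id flip: h_def)
  moreover have "h_cmlt A x y = h_cmlt A' (h x) (h y)"
    if "x \<in> carrier P.H" "y \<in> carrier P.H" for x y
    using arg_cong [OF f_cmlt, of "\<lambda>f. e_nat f (upair x y)"] that h_closed [of x] h_closed [of y]
      obj [of x] obj [of y] by (simp add: id flip: h_def)
  \<comment> \<open>With identity components the naturality square of \<open>f\<close> says that the
    two functors agree.\<close>
  moreover have "h_phi A x e = h_phi A' (h x) (k e)"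
    if "x \<in> carrier P.H" "e \<in> carrier P.G" for x e
    using P.E_Ar_nat [OF f(1), of "upair x e"] that h_closed [of x] k_closed [of e] obj [of x]
      obj [of "bd \<chi> e \<otimes>\<^bsub>P.H\<^esub> x"] by (simp add: id f_eq h_mult bd)
  moreover have "h_cunt A = h_cunt A'"
    using arg_cong [OF f_cunt, of "\<lambda>f. e_nat f upoint"] obj [of "\<one>\<^bsub>P.H\<^esub>"] by (simp add: id)
  ultimately show ?thesis
    using pairs by (auto simp: xpair_ident_def)
qed

end

section \<open>Assembling the two bijections\<close>

context smc_base
begin

lemma hopfs_imp_hopf_E:
  assumes "B \<in> hopfs S"
  obtains s where "hopf_E S B s" "iso_arr (E S) s"
  using assms smc_base_axioms by (auto simp: hopfs_def hopf_algebra_def hopf_E_def hopf_E_axioms_def)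

lemma xpairs_imp_hopf_coalg: "(\<chi>, A) \<in> xpairs S \<Longrightarrow> hopf_coalg S \<chi> A"
  using smc_base_axioms
  by (auto simp: xpairs_def hopf_coalg_def hopf_coalg_axioms_def crossed_mod_def)

lemma cat_part_imp_assoc_hopf:
  fixes B :: "('u::infinite, 'o, 'a) ebialg"
  assumes "B \<in> hopfs S" "crossed_module \<chi>" "cat_part B = xmod_hopf \<chi>"
  shows "B \<in> assoc_hopf S ` xpairs S"
proof -
  obtain s where "hopf_E S B s" "iso_arr (E S) s"
    using assms(1) by (rule hopfs_imp_hopf_E)
  then interpret hopf_over_xmod S B s \<chi>
    using assms by (simp add: hopf_over_xmod_def hopf_over_xmod_axioms_def crossed_mod_def)
  show ?thesis
    using hopf_coalgebra_A assms(2) assoc_hopf_A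
    by (intro image_eqI [of _ _ "(\<chi>, A)"]) (simp_all add: xpairs_def)
qed

end

text \<open>The first bijection is up to equality, so its target consists of the Hopf algebras whose
  underlying group object literally comes from a crossed module. A general group object is only
  isomorphic to one of these, so the bijection that covers all Hopf algebras is stated for classes
  under the two identifications.\<close>

theorem theorem10p1:
  fixes S :: "('o, 'a) smc"
  assumes "symmetric_monoidal_category S"
  shows
    "bij_betw (assoc_hopf S)
       (xpairs S :: ('u::infinite, 'o, 'a) xpair set)
       {X \<in> hopfs S. \<exists>\<chi>. crossed_module \<chi> \<and> cat_part X = xmod_hopf \<chi>} \<and>
     (\<forall>P \<in> (xpairs S :: ('u, 'o, 'a) xpair set).
       antipode (E S) (assoc_hopf S P) (assoc_antipode P) \<and> iso_arr (E S) (assoc_antipode P)) \<and>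
     equiv (xpairs S) (xpair_ident S :: ('u, 'o, 'a) xpair rel) \<and>
     equiv (hopfs S) (hopf_ident S :: ('u, 'o, 'a) ebialg rel) \<and>
     bij_betw (\<lambda>c. hopf_ident S `` (assoc_hopf S ` c))
       (xpairs S // (xpair_ident S :: ('u, 'o, 'a) xpair rel)) (hopfs S // hopf_ident S)"
proof -
  interpret smc_base S
    using assms by (simp add: smc_base_def)
  let ?P = "xpairs S :: ('u, 'o, 'a) xpair set" and ?I = "xpair_ident S :: ('u, 'o, 'a) xpair rel"
    and ?J = "hopf_ident S :: ('u, 'o, 'a) ebialg rel"
  have two: "two_hopf_coalgs S \<chi> A \<chi>' A'" if "(\<chi>, A) \<in> ?P" "(\<chi>', A') \<in> ?P" for \<chi> A \<chi>' A'
    using that by (auto simp: two_hopf_coalgs_def intro: xpairs_imp_hopf_coalg)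
  have hopf: "assoc_hopf S P \<in> hopfs S \<and> (\<exists>\<chi>. crossed_module \<chi> \<and> cat_part (assoc_hopf S P) = xmod_hopf \<chi>) \<and>
      antipode (E S) (assoc_hopf S P) (assoc_antipode P) \<and> iso_arr (E S) (assoc_antipode P)"
    if "P \<in> ?P" for P
  proof -
    obtain \<chi> A where P: "P = (\<chi>, A)"
      by (cases P)
    interpret hopf_coalg S \<chi> A
      using that unfolding P by (rule xpairs_imp_hopf_coalg)
    show ?thesis
      using hopf_algebra_B cat_part_B crossed_module antipode_B iso_antipode by (auto simp: P hopfs_def)
  qed
  have equiv_J: "equiv (hopfs S) ?J"
    by (rule equiv_hopf_ident)
  have ident: "(P, Q) \<in> ?I \<longleftrightarrow> (assoc_hopf S P, assoc_hopf S Q) \<in> ?J" if "P \<in> ?P" "Q \<in> ?P" for P Q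
  proof -
    obtain \<chi> A \<chi>' A' where PQ: "P = (\<chi>, A)" "Q = (\<chi>', A')"
      by (cases P, cases Q)
    \<comment> \<open>Arrows of \<open>E S\<close> run against isomorphisms of crossed modules;
      symmetry of \<open>?J\<close> then restores the order.\<close>
    have "(P, Q) \<in> ?I \<longleftrightarrow> (assoc_hopf S Q, assoc_hopf S P) \<in> ?J"
      using two_hopf_coalgs.xpair_ident_imp_hopf_ident [OF two] two_hopf_coalgs.hopf_ident_imp_xpair_ident [OF two]
        that unfolding PQ by blast
    then show ?thesis
      using equiv_J by (meson equivE symD)
  qed
  \<comment> \<open>Each property is pulled back from \<open>?J\<close> along \<open>ident\<close>,
    which avoids composing and inverting isomorphisms of crossed modules.\<close>
  have equiv_I: "equiv ?P ?I"
  proof (rule equivI)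
    show sub: "?I \<subseteq> ?P \<times> ?P"
      by (auto simp: xpair_ident_def)
    show "refl_on ?P ?I"
    proof (rule refl_onI)
      show "(P, P) \<in> ?I" if "P \<in> ?P" for P
        using ident [OF that that] hopf [OF that] equiv_J by (meson equivE refl_onD)
    qed
    show "sym ?I"
    proof (rule symI)
      show "(Q, P) \<in> ?I" if "(P, Q) \<in> ?I" for P Q
        using that sub ident [of P Q] ident [of Q P] equiv_J by (blast elim: equivE dest: symD)
    qed
    show "trans ?I"
    proof (rule transI)
      show "(P, R) \<in> ?I" if "(P, Q) \<in> ?I" "(Q, R) \<in> ?I" for P Q R
        using that sub ident [of P Q] ident [of Q R] ident [of P R] equiv_J
        by (blast elim: equivE dest: transD)
    qed
  qed
  have "bij_betw (assoc_hopf S) ?P {X \<in> hopfs S. \<exists>\<chi>. crossed_module \<chi> \<and> cat_part X = xmod_hopf \<chi>}"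
  proof (rule bij_betw_imageI)
    show "inj_on (assoc_hopf S) ?P"
    proof (rule inj_onI)
      fix P Q assume *: "P \<in> ?P" "Q \<in> ?P" "assoc_hopf S P = assoc_hopf S Q"
      then show "P = Q"
        using two_hopf_coalgs.assoc_hopf_inj [OF two] by (cases P, cases Q) blast
    qed
    show "assoc_hopf S ` ?P = {X \<in> hopfs S. \<exists>\<chi>. crossed_module \<chi> \<and> cat_part X = xmod_hopf \<chi>}"
      using hopf cat_part_imp_assoc_hopf by blast
  qed
  moreover have "bij_betw (\<lambda>c. ?J `` (assoc_hopf S ` c)) (?P // ?I) (hopfs S // ?J)"
  proof (rule bij_betw_quotients [OF equiv_I equiv_J])
    show "assoc_hopf S P \<in> hopfs S" if "P \<in> ?P" for P
      using hopf that by blast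
    show "(P, Q) \<in> ?I \<longleftrightarrow> (assoc_hopf S P, assoc_hopf S Q) \<in> ?J" if "P \<in> ?P" "Q \<in> ?P" for P Q
      using ident that .
    \<comment> \<open>The Hopf algebra is first moved over the group object of a crossed module,
      where \<open>cat_part_imp_assoc_hopf\<close> gives a preimage.\<close>
    show "\<exists>P \<in> ?P. (assoc_hopf S P, B) \<in> ?J" if "B \<in> hopfs S" for B
    proof -
      obtain s where s: "hopf_E S B s" "iso_arr (E S) s"
        using \<open>B \<in> hopfs S\<close> by (rule hopfs_imp_hopf_E)
      obtain B' \<chi> where B': "crossed_module \<chi>" "cat_part B' = xmod_hopf \<chi>" "(B, B') \<in> ?J"
        using hopf_E.ex_hopf_over_xmod [OF s] by blast
      then obtain P where "P \<in> ?P" "B' = assoc_hopf S P"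
        using cat_part_imp_assoc_hopf [of B' \<chi>] by (auto simp: hopf_ident_def)
      then show ?thesis
        using B'(3) equiv_J by (meson equivE symD)
    qed
  qed
  ultimately show ?thesis
    using hopf equiv_I equiv_J by blast
qed

end
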